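(* Let $t\ge 0$ be a real number and let $$W_2^*(t)=\{(x_1,x_2)\in[0,1)^2:\ |T_2^nx_1|<e^{-nt}\ \text{and}\ |T_3^nx_2|<e^{-n^2}\ \text{for infinitely many }n\in\mathbb N\}.$$ Let $f$ be a dimension function such that $f\preceq 2$ and either $1\preceq f$ or $f\preceq1$. Then the following statements hold. (1) Suppose that $t>\log3$. If $1\preceq f$, then $\mathcal H^f(W_2^*(t))=0$. Conversely, if $f\prec1$, then $$\mathcal H^f\big(W_2^*(t)\big)=\begin{cases}0&\text{if }\sum_{n=1}^\infty f(2^{-n}e^{-nt})6^n<\infty,\\ \mathcal H^f([0,1]^2)&\text{if }\sum_{n=1}^\infty f(2^{-n}e^{-nt})6^n=\infty.\end{cases}$$ (2) Suppose that $t\le\log3$. If $f\prec1$, then $\mathcal H^f(W_2^*(t))=\mathcal H^f([0,1]^2)=\infty$. Conversely, if $1\preceq f\preceq(1+\log2/\log3)$, then $$\mathcal H^f\big(W_2^*(t)\big)=\begin{cases}0&\text{if }\sum_{n=1}^\infty f(3^{-n}e^{-n^2})9^ne^{n^2-nt}<\infty,\\ \mathcal H^f([0,1]^2)&\text{if }\sum_{n=1}^\infty f(3^{-n}e^{-n^2})9^ne^{n^2-nt}=\infty.\end{cases}$$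
   Context: For $\beta>1$, $T_\beta:[0,1)\to[0,1)$ is the map $T_\beta x=\beta x\ (\mathrm{mod}\ 1)$, and $T_\beta^n$ is its $n$-th iterate. A dimension function is a continuous nondecreasing function $f$ on $\mathbb R_{\ge0}$ with $f(0)=0$ (positive on $(0,\infty)$). For dimension functions $f,g$, write $f\preceq g$ if $\frac{f(y)}{g(y)}\le\frac{f(x)}{g(x)}$ for all $0<x<y$; then $\lim_{r\to0^+}f(r)/g(r)\in(0,\infty]$ exists, and if moreover this limit is $\infty$ we write $f\prec g$. For a real number $s>0$, in such relations $s$ stands for the function $r\mapsto r^s$ (e.g. $f\preceq s$ means $f\preceq g$ with $g(r)=r^s$, and $s\preceq f$ means $g\preceq f$). $\mathbb R^2$ carries the maximum norm. The Hausdorff $f$-measure of $A$ is $\mathcal H^f(A)=\lim_{\eta\to0}\inf\{\sum_i f(|B_i|): A\subset\bigcup_i B_i,\ B_i\text{ balls with }|B_i|\le\eta\}$, where $|B|$ denotes diameter. *)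

theory Defs
  imports "HOL-Analysis.Analysis"
begin

definition dimension_function :: "(real \<Rightarrow> real) \<Rightarrow> bool" where
  "dimension_function f \<longleftrightarrow>
     continuous_on {0..} f \<and> mono_on {0..} f \<and> f 0 = 0 \<and> (\<forall>r>0. 0 < f r)"

definition dim_preceq :: "(real \<Rightarrow> real) \<Rightarrow> (real \<Rightarrow> real) \<Rightarrow> bool"  (infix "\<preceq>" 50) where
  "f \<preceq> g \<longleftrightarrow> (\<forall>x y. 0 < x \<and> x < y \<longrightarrow> f y / g y \<le> f x / g x)"

definition dim_prec :: "(real \<Rightarrow> real) \<Rightarrow> (real \<Rightarrow> real) \<Rightarrow> bool"  (infix "\<prec>" 50) where
  "f \<prec> g \<longleftrightarrow> f \<preceq> g \<and> filterlim (\<lambda>r. f r / g r) at_top (at_right 0)"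

text \<open>The function \<open>r \<mapsto> r\<^sup>s\<close> that a real number \<open>s > 0\<close> stands for in \<open>\<preceq>\<close> and \<open>\<prec>\<close>.\<close>

definition pow_fun :: "real \<Rightarrow> real \<Rightarrow> real" where
  "pow_fun s = (\<lambda>r. r powr s)"

text \<open>The library metric on \<open>real \<times> real\<close> is Euclidean, so balls and diameters for the
  maximum norm are introduced separately.\<close>

definition max_norm :: "real \<times> real \<Rightarrow> real" where
  "max_norm x = max \<bar>fst x\<bar> \<bar>snd x\<bar>"

definition max_ball :: "real \<times> real \<Rightarrow> real \<Rightarrow> (real \<times> real) set" where
  "max_ball x r = {y. max_norm (y - x) < r}"

definition max_diam :: "(real \<times> real) set \<Rightarrow> real" where
  "max_diam B = (SUP (x, y) \<in> B \<times> B. max_norm (x - y))"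

text \<open>Covers are infinite sequences of balls. Finite covers are not lost: for a dimension
  function they can be continued by balls of arbitrarily small total cost.\<close>

definition hausdorff_content :: "(real \<Rightarrow> real) \<Rightarrow> real \<Rightarrow> (real \<times> real) set \<Rightarrow> ennreal" where
  "hausdorff_content f \<eta> A =
     Inf {(\<Sum>i. ennreal (f (max_diam (B i)))) | B :: nat \<Rightarrow> (real \<times> real) set.
            A \<subseteq> (\<Union>i. B i) \<and>
            (\<forall>i. (\<exists>x r. 0 < r \<and> B i = max_ball x r) \<and> max_diam (B i) \<le> \<eta>)}"

definition hausdorff_measure :: "(real \<Rightarrow> real) \<Rightarrow> (real \<times> real) set \<Rightarrow> ennreal" where
  "hausdorff_measure f A = Lim (at_right 0) (\<lambda>\<eta>. hausdorff_content f \<eta> A)"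

definition beta_map :: "real \<Rightarrow> real \<Rightarrow> real" where
  "beta_map \<beta> x = frac (\<beta> * x)"

definition W2_star :: "real \<Rightarrow> (real \<times> real) set" where
  "W2_star t = {(x1, x2). x1 \<in> {0..<1} \<and> x2 \<in> {0..<1} \<and>
     (\<exists>\<^sub>\<infinity>n. \<bar>(beta_map 2 ^^ n) x1\<bar> < exp (- (real n * t)) \<and>
           \<bar>(beta_map 3 ^^ n) x2\<bar> < exp (- (real n ^ 2)))}"

lemma max_diam_max_ball:
  assumes "0 < r"
  shows "max_diam (max_ball x r) = 2 * r"
proof -
  obtain a b where x: "x = (a, b)" by (cases x)
  let ?S = "(\<lambda>(u, v). max_norm (u - v)) ` (max_ball x r \<times> max_ball x r)"
  have "Sup ?S = 2 * r"
  proof (rule cSup_eq_non_empty)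
    show "?S \<noteq> {}"
    proof -
      have "x \<in> max_ball x r"
        using assms by (simp add: max_ball_def max_norm_def)
      then show ?thesis by blast
    qed
  next
    fix s assume "s \<in> ?S"
    then show "s \<le> 2 * r"
      by (auto simp: max_ball_def max_norm_def x)
  next
    fix z assume z: "\<And>s. s \<in> ?S \<Longrightarrow> s \<le> z"
    show "2 * r \<le> z"
    proof (rule dense_ge)
      fix w assume "z < w"
      show "2 * r \<le> w"
      proof (rule ccontr)
        assume "\<not> 2 * r \<le> w"
        define q where "q = max 0 (w / 2)"
        have q: "0 \<le> q" "q < r" "w \<le> 2 * q"
          using \<open>\<not> 2 * r \<le> w\<close> assms by (auto simp: q_def)
        have m: "(a + q, b) \<in> max_ball x r" "(a - q, b) \<in> max_ball x r"
          using q by (auto simp: max_ball_def max_norm_def x)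
        have "max_norm ((a + q, b) - (a - q, b)) \<in> ?S"
          using m by (intro image_eqI[where x = "((a + q, b), (a - q, b))"]) auto
        then have "max_norm ((a + q, b) - (a - q, b)) \<le> z" by (rule z)
        then show False
          using q \<open>z < w\<close> by (auto simp: max_norm_def)
      qed
    qed
  qed
  then show ?thesis by (simp add: max_diam_def)
qed

lemma hausdorff_content_antimono:
  assumes "\<eta> \<le> \<eta>'"
  shows "hausdorff_content f \<eta>' A \<le> hausdorff_content f \<eta> A"
  unfolding hausdorff_content_def
proof (rule Inf_superset_mono, clarify)
  fix B :: "nat \<Rightarrow> (real \<times> real) set"
  assume B: "A \<subseteq> (\<Union>i. B i)"
    "\<forall>i. (\<exists>x r. 0 < r \<and> B i = max_ball x r) \<and> max_diam (B i) \<le> \<eta>"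
  have "\<forall>i. (\<exists>x r. 0 < r \<and> B i = max_ball x r) \<and> max_diam (B i) \<le> \<eta>'"
    using B(2) assms by (meson order_trans)
  with B(1) show "\<exists>B'. (\<Sum>i. ennreal (f (max_diam (B i)))) = (\<Sum>i. ennreal (f (max_diam (B' i)))) \<and>
      A \<subseteq> (\<Union>i. B' i) \<and>
      (\<forall>i. (\<exists>x r. 0 < r \<and> B' i = max_ball x r) \<and> max_diam (B' i) \<le> \<eta>')"
    by (intro exI[of _ B] conjI refl)
qed

text \<open>The limit defining the Hausdorff measure exists.\<close>

lemma hausdorff_content_tendsto:
  "((\<lambda>\<eta>. hausdorff_content f \<eta> A) \<longlongrightarrow> (SUP \<eta>\<in>{0<..}. hausdorff_content f \<eta> A)) (at_right 0)"
proof (rule order_tendstoI)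
  fix a assume "a < (SUP \<eta>\<in>{0<..}. hausdorff_content f \<eta> A)"
  then obtain e where e: "0 < e" "a < hausdorff_content f e A"
    by (auto simp: less_SUP_iff)
  then have "\<forall>\<eta>. 0 < \<eta> \<and> \<eta> < e \<longrightarrow> a < hausdorff_content f \<eta> A"
    by (meson hausdorff_content_antimono less_imp_le less_le_trans)
  then show "\<forall>\<^sub>F \<eta> in at_right 0. a < hausdorff_content f \<eta> A"
    using e(1) by (auto simp: eventually_at_right_field)
next
  fix a assume a: "(SUP \<eta>\<in>{0<..}. hausdorff_content f \<eta> A) < a"
  have "hausdorff_content f \<eta> A < a" if "0 < \<eta>" for \<eta>
    using that by (intro le_less_trans[OF SUP_upper a]) auto
  then show "\<forall>\<^sub>F \<eta> in at_right 0. hausdorff_content f \<eta> A < a"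
    by (auto simp: eventually_at_right_field intro: exI[of _ 1])
qed

lemma hausdorff_measure_eq_SUP:
  "hausdorff_measure f A = (SUP \<eta>\<in>{0<..}. hausdorff_content f \<eta> A)"
  unfolding hausdorff_measure_def
  by (rule tendsto_Lim[OF _ hausdorff_content_tendsto]) simp

end

theory Submission
  imports Defs
begin

text \<open>
  The level set \<open>E n\<close> consists of \<open>6 ^ n\<close> rectangles with sides \<open>a = side1 t n\<close> and \<open>b = side2 n\<close>. When the series
  converges, covering the rectangles by squares of side \<open>a\<close> (respectively \<open>b\<close>) gives measure zero.

  When it diverges, a cover of the limsup set by balls \<open>B i\<close> of small total cost is defeated by a descent: given a
  square of side \<open>l\<close> such that the balls meeting it have total cost below \<open>c * f l\<close>, find a much smaller square
  inside it, contained in a later level set, with the same property. The squares obtained shrink to a point of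
  the limsup set, and a ball containing that point would alone be too expensive. The descent
  step is a pigeonhole argument over a finite family of weighted squares such that every ball meeting at least
  two of them is at least as expensive as their total weight. In the vertical direction the family consists of rows of many
  levels \<open>m\<close>, each surrounded by an empty gap proportional to the mass it carries; the divergence of the
  series is what allows the gaps to fill a fixed proportion of the square.

  If \<open>f \<prec> pow_fun 1\<close> and \<open>t \<le> ln 3\<close>, the measure is compared with that for \<open>f r = r\<close>, whose series diverges.
\<close>

section \<open>Level sets\<close>

text \<open>In the divergent cases no finite nonzero measure occurs: the descent can start with any
  total weight \<open>K\<close>, so \<open>W2_star t\<close> has infinite measure and the unit
  square inherits it. The obstacle is that a level repeats with period \<open>1 / 2 ^ m\<close>
  horizontally but \<open>1 / 3 ^ m\<close> vertically. Weight is laid out with a prescribed area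
  density \<open>D\<close>, which is only visible to a ball that sees full periods in both
  directions. A ball with \<open>1 / 3 ^ m \<le> r < 1 / 2 ^ m\<close> may meet many rows, yet of
  each row only a bounded number of rectangles, and may carry mass of order
  \<open>D * r / 2 ^ m\<close>. Since \<open>1 / 2 ^ m \<le> r powr crit\<close>, this is affordable
  when \<open>f\<close> dominates \<open>D * r powr (1 + crit)\<close>, which is the origin of the
  exponent \<open>1 + ln 2 / ln 3\<close>. Smaller balls meet at most two rows of a level but may
  still meet rows of many levels, which is why the weights have to be tamed across levels. For
  \<open>f r = r\<close> both series have the terms \<open>(3 * exp (- t)) ^ n\<close>; hence the
  threshold \<open>ln 3\<close>.\<close>

lemma frac_mult_frac_of_nat: "frac (of_nat c * frac y) = frac (of_nat c * y)" for y :: real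
proof -
  have "of_nat c * frac y = of_nat c * y + of_int (- (int c * \<lfloor>y\<rfloor>))"
    by (simp add: frac_def algebra_simps)
  then show ?thesis by (metis frac_add_of_int_right)
qed

lemma beta_map_funpow:
  assumes "0 \<le> x" "x < 1"
  shows "(beta_map (of_nat c) ^^ n) x = frac (of_nat c ^ n * x)"
proof (induction n)
  case 0
  then show ?case using assms by (simp add: frac_eq)
next
  case (Suc n)
  then show ?case
    by (simp add: beta_map_def frac_mult_frac_of_nat mult.assoc)
qed

definition level_set :: "real \<Rightarrow> nat \<Rightarrow> (real \<times> real) set" where
  "level_set t n = {(x1, x2). x1 \<in> {0..<1} \<and> x2 \<in> {0..<1} \<and>
     frac (2 ^ n * x1) < exp (- (real n * t)) \<and> frac (3 ^ n * x2) < exp (- (real n ^ 2))}"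

lemma W2_star_eq: "W2_star t = {x. \<exists>\<^sub>\<infinity>n. x \<in> level_set t n}"
proof -
  have "(x1, x2) \<in> W2_star t \<longleftrightarrow> (\<exists>\<^sub>\<infinity>n. (x1, x2) \<in> level_set t n)" for x1 x2 :: real
  proof (cases "x1 \<in> {0..<1} \<and> x2 \<in> {0..<1}")
    case True
    then have "(beta_map 2 ^^ n) x1 = frac (2 ^ n * x1)" "(beta_map 3 ^^ n) x2 = frac (3 ^ n * x2)" for n
      using beta_map_funpow[of x1 n 2] beta_map_funpow[of x2 n 3] by auto
    then show ?thesis using True by (auto simp: W2_star_def level_set_def)
  qed (auto simp: W2_star_def level_set_def)
  then show ?thesis by auto
qed

definition side1 :: "real \<Rightarrow> nat \<Rightarrow> real" where "side1 t n = exp (- (real n * t)) / 2 ^ n"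
definition side2 :: "nat \<Rightarrow> real" where "side2 n = exp (- (real n ^ 2)) / 3 ^ n"

lemma side1_pos [simp]: "0 < side1 t n" by (simp add: side1_def)
lemma side2_pos [simp]: "0 < side2 n" by (simp add: side2_def)

lemma side1_le: "0 \<le> t \<Longrightarrow> side1 t n \<le> 1 / 2 ^ n"
  by (simp add: side1_def divide_simps)

lemma side2_le: "side2 n \<le> 1 / 3 ^ n"
  by (simp add: side2_def divide_simps)

text \<open>From level \<open>t\<close> on no rectangle is higher than wide, so covers and columns
  of squares run horizontally.\<close>

lemma side2_le_side1:
  assumes "t \<le> real n"
  shows "side2 n \<le> side1 t n"
proof -
  have "real n * t \<le> real n ^ 2"
    using assms by (simp add: power2_eq_square mult_left_mono)
  then show ?thesis
    unfolding side1_def side2_def by (intro frac_le) (auto intro: power_mono)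
qed

lemma level_setI:
  fixes k j :: int
  assumes "0 \<le> x1" "x1 < 1" "0 \<le> x2" "x2 < 1"
    and "k / 2 ^ n \<le> x1" "x1 < k / 2 ^ n + side1 t n"
    and "j / 3 ^ n \<le> x2" "x2 < j / 3 ^ n + side2 n" and "0 \<le> t"
  shows "(x1, x2) \<in> level_set t n"
proof -
  have *: "frac z < e" if "of_int i \<le> z" "z < of_int i + e" "e \<le> 1" for z e :: real and i
  proof -
    have "\<lfloor>z\<rfloor> = i" using that by (intro floor_unique) auto
    then show ?thesis using that by (simp add: frac_def)
  qed
  have "frac (2 ^ n * x1) < exp (- (real n * t))"
    by (rule *[where i=k]) (use assms in \<open>auto simp: side1_def field_simps\<close>)
  moreover have "frac (3 ^ n * x2) < exp (- (real n ^ 2))"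
    by (rule *[where i=j]) (use assms in \<open>auto simp: side2_def field_simps\<close>)
  ultimately show ?thesis using assms by (auto simp: level_set_def)
qed

lemma level_setD:
  assumes "(x1, x2) \<in> level_set t n"
  obtains k j :: nat where "k < 2 ^ n" "j < 3 ^ n"
    "k / 2 ^ n \<le> x1" "x1 < k / 2 ^ n + side1 t n"
    "j / 3 ^ n \<le> x2" "x2 < j / 3 ^ n + side2 n"
proof -
  have *: "\<exists>k::nat. k < c ^ n \<and> k / c ^ n \<le> x \<and> x < k / c ^ n + e / c ^ n"
    if "0 \<le> x" "x < 1" "frac (c ^ n * x) < e" "0 < c" for x e :: real and c :: nat
  proof (intro exI conjI)
    let ?k = "nat \<lfloor>c ^ n * x\<rfloor>"
    have "real c ^ n * x < real c ^ n" using that by simp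
    moreover have r: "real ?k = of_int \<lfloor>c ^ n * x\<rfloor>" using that by simp
    ultimately have "real ?k < real (c ^ n)" by (auto intro: le_less_trans[OF of_int_floor_le])
    then show "?k < c ^ n" by linarith
    show "real ?k / c ^ n \<le> x" unfolding r using that by (simp add: divide_simps mult.commute)
    show "x < real ?k / c ^ n + e / c ^ n"
      unfolding r using that by (simp add: frac_def divide_simps mult.commute)
  qed
  show ?thesis
    using *[of x1 2 "exp (- (real n * t))"] *[of x2 3 "exp (- (real n ^ 2))"] assms that
    by (auto simp: level_set_def side1_def side2_def)
qed

section \<open>Upper bounds for the Hausdorff measure\<close>

lemma max_ball_eq: "max_ball z r = {fst z - r<..<fst z + r} \<times> {snd z - r<..<snd z + r}"
  by (auto simp: max_ball_def max_norm_def abs_less_iff)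

lemma hausdorff_measure_mono:
  assumes "A \<subseteq> B"
  shows "hausdorff_measure f A \<le> hausdorff_measure f B"
  unfolding hausdorff_measure_eq_SUP hausdorff_content_def
  by (intro SUP_mono' Inf_superset_mono) (use assms in blast)

lemma dimension_function_pos: "dimension_function f \<Longrightarrow> 0 < r \<Longrightarrow> 0 < f r"
  by (simp add: dimension_function_def)

lemma dimension_function_mono: "dimension_function f \<Longrightarrow> 0 \<le> r \<Longrightarrow> r \<le> s \<Longrightarrow> f r \<le> f s"
  by (auto simp: dimension_function_def mono_on_def)

lemma dimension_function_small:
  assumes "dimension_function f" "0 < e" "0 < \<eta>"
  obtains r where "0 < r" "2 * r \<le> \<eta>" "f (2 * r) \<le> e"
proof -
  have "continuous_on {0..} f" "f 0 = 0" using assms by (auto simp: dimension_function_def)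
  then obtain d where d: "d > 0" "\<And>x. x \<ge> 0 \<Longrightarrow> dist x 0 < d \<Longrightarrow> dist (f x) (f 0) < e"
    using assms(2) unfolding continuous_on_iff by (metis atLeast_iff order_refl)
  define r where "r = min (d / 4) (\<eta> / 2)"
  have "dist (f (2 * r)) (f 0) < e" by (rule d(2)) (use d(1) assms in \<open>auto simp: r_def dist_real_def min_def\<close>)
  then show ?thesis using that[of r] d(1) assms \<open>f 0 = 0\<close> by (auto simp: r_def dist_real_def)
qed

lemma hausdorff_content_le_countable:
  fixes J :: "'i :: countable set"
  assumes f: "dimension_function f" and "0 < \<eta>"
    and cov: "A \<subseteq> (\<Union>j\<in>J. max_ball (z j) (\<rho> j))"
    and rho: "\<And>j. j \<in> J \<Longrightarrow> 0 < \<rho> j \<and> 2 * \<rho> j \<le> \<eta>"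
    and C: "\<And>F. finite F \<Longrightarrow> F \<subseteq> J \<Longrightarrow> (\<Sum>j\<in>F. f (2 * \<rho> j)) \<le> C"
  shows "hausdorff_content f \<eta> A \<le> ennreal C"
proof (rule ennreal_le_epsilon)
  fix e :: real assume "0 < e"
  have "0 < e * (1/2) ^ Suc i" for i using \<open>0 < e\<close> by simp
  then have "\<exists>s. 0 < s \<and> 2 * s \<le> \<eta> \<and> f (2 * s) \<le> e * (1/2) ^ Suc i" for i
    using dimension_function_small[OF f _ \<open>0 < \<eta>\<close>] by metis
  then obtain s where s: "\<And>i. 0 < s i \<and> 2 * s i \<le> \<eta> \<and> f (2 * s i) \<le> e * (1/2) ^ Suc i"
    by metis
  define I where "I = to_nat ` J"
  define r where "r i = (if i \<in> I then \<rho> (from_nat i) else s i)" for i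
  define B where "B i = max_ball (z (from_nat i)) (r i)" for i
  have r: "0 < r i \<and> 2 * r i \<le> \<eta>" for i
    using s rho by (auto simp: r_def I_def)
  have diam: "max_diam (B i) = 2 * r i" for i
    using r by (simp add: B_def max_diam_max_ball)
  have "A \<subseteq> (\<Union>i. B i)"
  proof
    fix x assume "x \<in> A"
    then obtain j where "j \<in> J" "x \<in> max_ball (z j) (\<rho> j)" using cov by auto
    then have "x \<in> B (to_nat j)" by (auto simp: B_def r_def I_def)
    then show "x \<in> (\<Union>i. B i)" by auto
  qed
  then have "hausdorff_content f \<eta> A \<le> (\<Sum>i. ennreal (f (max_diam (B i))))"
    unfolding hausdorff_content_def
  proof (intro Inf_lower CollectI exI[of _ B] conjI allI)
    fix i
    show "\<exists>x \<rho>. 0 < \<rho> \<and> B i = max_ball x \<rho>" using r B_def by blast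
    show "max_diam (B i) \<le> \<eta>" using r diam by simp
  qed auto
  also have "\<dots> \<le> ennreal C + ennreal e"
  proof (rule suminf_le_const)
    fix n
    have "(\<Sum>i<n. f (2 * r i)) \<le> (\<Sum>i<n. (if i \<in> I then f (2 * \<rho> (from_nat i)) else 0) + e * (1/2) ^ Suc i)"
    proof (intro sum_mono)
      fix i
      show "f (2 * r i) \<le> (if i \<in> I then f (2 * \<rho> (from_nat i)) else 0) + e * (1/2) ^ Suc i"
        using s[of i] \<open>0 < e\<close> by (auto simp: r_def)
    qed
    also have "\<dots> = (\<Sum>i\<in>{..<n} \<inter> I. f (2 * \<rho> (from_nat i))) + e * (\<Sum>i<n. (1/2) ^ Suc i)"
      by (simp add: sum.distrib sum_distrib_left sum.inter_restrict)
    also have "(\<Sum>i\<in>{..<n} \<inter> I. f (2 * \<rho> (from_nat i))) = (\<Sum>j\<in>from_nat ` ({..<n} \<inter> I). f (2 * \<rho> j))"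
      by (subst sum.reindex) (auto simp: inj_on_def I_def)
    also have "\<dots> \<le> C" by (intro C) (auto simp: I_def)
    also have "(\<Sum>i<n. (1/2) ^ Suc i) \<le> (1::real)"
      using sum_gp_strict[of "1/2::real" n] by (simp add: sum_divide_distrib[symmetric])
    finally have "(\<Sum>i<n. f (2 * r i)) \<le> C + e" using \<open>0 < e\<close> by simp
    moreover have "0 \<le> C" using C[of "{}"] by simp
    moreover have "(\<Sum>i<n. ennreal (f (max_diam (B i)))) = ennreal (\<Sum>i<n. f (2 * r i))"
      unfolding diam using r dimension_function_pos[OF f] by (intro sum_ennreal) (simp add: less_imp_le)
    ultimately show "(\<Sum>i<n. ennreal (f (max_diam (B i)))) \<le> ennreal C + ennreal e"
      using \<open>0 < e\<close> by (simp add: ennreal_plus[symmetric] del: ennreal_plus)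
  qed auto
  finally show "hausdorff_content f \<eta> A \<le> ennreal C + ennreal e" .
qed

lemma infsum_ennreal_eq_SUP:
  fixes g :: "'a \<Rightarrow> ennreal"
  shows "infsum g A = (SUP F\<in>{F. finite F \<and> F \<subseteq> A}. sum g F)"
  by (rule nonneg_infsum_complete) simp

text \<open>Links the extended series of the theorem, which begin at \<open>n = 1\<close>, with real
  summability; the missing term at \<open>0\<close> is finite.\<close>

lemma infsum_ennreal_less_top_iff:
  fixes g :: "nat \<Rightarrow> real"
  assumes "\<And>n. 0 \<le> g n"
  shows "(\<Sum>\<^sub>\<infinity>n\<in>{1..}. ennreal (g n)) < \<infinity> \<longleftrightarrow> summable g"
proof
  assume *: "summable g"
  have "(\<Sum>\<^sub>\<infinity>n\<in>{1..}. ennreal (g n)) \<le> ennreal (suminf g)"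
    unfolding infsum_ennreal_eq_SUP
    using * assms by (auto intro!: SUP_least sum_le_suminf ennreal_leI)
  then show "(\<Sum>\<^sub>\<infinity>n\<in>{1..}. ennreal (g n)) < \<infinity>"
    by (metis ennreal_less_top infinity_ennreal_def le_less_trans)
next
  let ?S = "\<Sum>\<^sub>\<infinity>n\<in>{1..}. ennreal (g n)"
  assume "?S < \<infinity>"
  then obtain C where C: "0 \<le> C" "?S = ennreal C"
    by (metis enn2real_nonneg ennreal_enn2real infinity_ennreal_def)
  have "summable (\<lambda>n. g (Suc n))"
  proof (rule summableI_nonneg_bounded)
    fix n
    have "ennreal (\<Sum>i<n. g (Suc i)) = (\<Sum>i\<in>Suc ` {..<n}. ennreal (g i))"
      using assms by (simp add: sum.reindex)
    also have "\<dots> \<le> ?S" unfolding infsum_ennreal_eq_SUP by (intro SUP_upper) auto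
    finally show "(\<Sum>i<n. g (Suc i)) \<le> C" using C by (simp add: ennreal_le_iff)
  qed (rule assms)
  then show "summable g" by (simp add: summable_Suc_iff)
qed

lemma preceq_powD:
  assumes "f \<preceq> pow_fun s" "0 < x" "x \<le> y"
  shows "f y / y powr s \<le> f x / x powr s"
  using assms by (cases "x = y") (auto simp: dim_preceq_def pow_fun_def)

section \<open>Convergent series: measure zero\<close>

lemma preceq_two_doubling:
  assumes "f \<preceq> pow_fun 2" "0 < r"
  shows "f (2 * r) \<le> 4 * f r"
proof -
  have "f (2 * r) / (2 * r) powr 2 \<le> f r / r powr 2"
    using preceq_powD[OF assms(1), of r "2 * r"] assms by simp
  then show ?thesis using assms(2) by (simp add: powr_numeral field_simps)
qed

text \<open>Each rectangle of level \<open>n\<close> is lined horizontally with about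
  \<open>side1 t n / \<rho> n\<close> balls of radius \<open>\<rho> n\<close>, which are high enough
  because \<open>side2 n \<le> \<rho> n\<close>. The summand is the cost of a level up to a
  constant, and tails of the series tend to 0. Leaving \<open>\<rho>\<close> free serves both
  series.\<close>

lemma hausdorff_measure_W2_star_eq_0:
  assumes t: "0 \<le> t" and f: "dimension_function f" "f \<preceq> pow_fun 2"
    and rho: "\<And>n. N0 \<le> n \<Longrightarrow> side2 n \<le> \<rho> n" "\<And>n. \<rho> n \<le> side1 t n" "\<And>n. 0 < \<rho> n"
    and summ: "summable (\<lambda>n. 6 ^ n * (side1 t n / \<rho> n) * f (\<rho> n))"
  shows "hausdorff_measure f (W2_star t) = 0"
proof -
  \<comment> \<open>The factor 8 is 2 for rounding the number of balls up and 4 for passing from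
    radius to diameter by doubling.\<close>
  define c where "c n = 8 * (6 ^ n * (side1 t n / \<rho> n) * f (\<rho> n))" for n
  have c: "summable c" unfolding c_def by (intro summable_mult summ)
  have c0: "0 \<le> c n" for n
    using rho(3)[of n] dimension_function_pos[OF f(1), of "\<rho> n"] side1_pos[of t n]
    by (simp add: c_def less_imp_le)
  define I :: "nat \<Rightarrow> (nat \<times> nat \<times> nat) set"
    where "I n = {..<2 ^ n} \<times> {..<3 ^ n} \<times> {..nat \<lfloor>side1 t n / \<rho> n\<rfloor>}" for n
  define z :: "nat \<times> nat \<times> nat \<times> nat \<Rightarrow> real \<times> real"
    where "z = (\<lambda>(n, k, j, i). (k / 2 ^ n + i * \<rho> n, j / 3 ^ n))"
  have cov: "\<exists>p\<in>I n. x \<in> max_ball (z (n, p)) (\<rho> n)"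
    if "x \<in> level_set t n" "N0 \<le> n" for x n
  proof -
    obtain x1 x2 where x: "x = (x1, x2)" by (cases x)
    from that[unfolded x] obtain k j :: nat where kj: "k < 2 ^ n" "j < 3 ^ n"
      "k / 2 ^ n \<le> x1" "x1 < k / 2 ^ n + side1 t n"
      "j / 3 ^ n \<le> x2" "x2 < j / 3 ^ n + side2 n" using level_setD by metis
    define u where "u = (x1 - k / 2 ^ n) / \<rho> n"
    define i where "i = nat \<lfloor>u\<rfloor>"
    have "0 \<le> u" using kj rho(3)[of n] by (simp add: u_def)
    then have i: "real i \<le> u" "u < real i + 1" unfolding i_def by linarith+
    have "u \<le> side1 t n / \<rho> n"
      using kj rho(3)[of n] unfolding u_def by (intro divide_right_mono) auto
    then have "i \<le> nat \<lfloor>side1 t n / \<rho> n\<rfloor>" unfolding i_def by (intro nat_mono floor_mono)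
    then have "(k, j, i) \<in> I n" using kj by (auto simp: I_def)
    moreover have "x \<in> max_ball (z (n, k, j, i)) (\<rho> n)"
    proof -
      have "real i * \<rho> n \<le> u * \<rho> n" "u * \<rho> n < (real i + 1) * \<rho> n"
        using i rho(3)[of n] by (simp_all add: mult_right_mono)
      moreover have "u * \<rho> n = x1 - k / 2 ^ n" using rho(3)[of n] by (simp add: u_def)
      ultimately show ?thesis
        using kj rho(1)[OF that(2)] rho(3)[of n] by (auto simp: x max_ball_eq z_def algebra_simps)
    qed
    ultimately show ?thesis by blast
  qed
  have card: "(\<Sum>p\<in>I n. f (2 * \<rho> n)) \<le> c n" for n
  proof -
    have 1: "1 \<le> side1 t n / \<rho> n" using rho(2,3)[of n] by simp
    have "real (card (I n)) = 6 ^ n * real (nat \<lfloor>side1 t n / \<rho> n\<rfloor> + 1)"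
    proof -
      have "(6::real) ^ n = 2 ^ n * 3 ^ n" by (simp flip: power_mult_distrib)
      then show ?thesis by (simp add: I_def card_cartesian_product algebra_simps)
    qed
    also have "\<dots> \<le> 6 ^ n * (2 * (side1 t n / \<rho> n))"
      using 1 by (intro mult_left_mono) (linarith, simp)
    finally have "real (card (I n)) * f (2 * \<rho> n) \<le> 6 ^ n * (2 * (side1 t n / \<rho> n)) * (4 * f (\<rho> n))"
      using preceq_two_doubling[OF f(2) rho(3)] dimension_function_pos[OF f(1), of "2 * \<rho> n"]
        rho(3)[of n] 1 by (intro mult_mono) auto
    then show ?thesis by (simp add: c_def)
  qed
  have small: "hausdorff_content f \<eta> (W2_star t) \<le> ennreal e" if "0 < \<eta>" "0 < e" for \<eta> e
  proof -
    have "(\<lambda>N. \<Sum>n. c (n + N)) \<longlonglongrightarrow> 0" using suminf_exist_split2[OF c] .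
    then have "\<forall>\<^sub>F N in sequentially. (\<Sum>n. c (n + N)) < e"
      by (rule order_tendstoD(2)) (rule that(2))
    moreover have "(\<lambda>n. 1 / 2 ^ n :: real) \<longlonglongrightarrow> 0"
      using LIMSEQ_realpow_zero[of "1/2::real"] by (simp add: power_divide)
    then have "\<forall>\<^sub>F N in sequentially. 1 / 2 ^ N < \<eta> / 2"
      by (rule order_tendstoD(2)) (use that(1) in simp)
    ultimately have "\<forall>\<^sub>F N in sequentially. (\<Sum>n. c (n + N)) < e \<and> 1 / 2 ^ N < \<eta> / 2 \<and> N0 \<le> N"
      using eventually_ge_at_top[of N0] by eventually_elim auto
    then obtain N where N: "(\<Sum>n. c (n + N)) < e" "1 / 2 ^ N < \<eta> / 2" "N0 \<le> N"
      using that unfolding eventually_sequentially by blast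
    have rho_le: "2 * \<rho> n \<le> \<eta>" if "N \<le> n" for n
    proof -
      have "\<rho> n \<le> 1 / 2 ^ n" using rho(2)[of n] side1_le[OF t, of n] by simp
      also have "\<dots> \<le> 1 / 2 ^ N" using that by (intro divide_left_mono power_increasing) auto
      finally show ?thesis using N by simp
    qed
    show ?thesis
    proof (rule hausdorff_content_le_countable[OF f(1) that(1), where z = z and \<rho> = "\<lambda>q. \<rho> (fst q)" and J = "Sigma {N..} I"])
      show "W2_star t \<subseteq> (\<Union>q\<in>Sigma {N..} I. max_ball (z q) (\<rho> (fst q)))"
      proof
        fix x assume "x \<in> W2_star t"
        then obtain n where "N \<le> n" "x \<in> level_set t n"
          unfolding W2_star_eq INFM_nat_le by blast
        moreover from this obtain p where "p \<in> I n" "x \<in> max_ball (z (n, p)) (\<rho> n)"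
          using cov[of x n, OF _ order_trans[OF N(3)]] by auto
        ultimately show "x \<in> (\<Union>q\<in>Sigma {N..} I. max_ball (z q) (\<rho> (fst q)))"
          by (intro UN_I[of "(n, p)"]) simp_all
      qed
      show "\<And>q. q \<in> Sigma {N..} I \<Longrightarrow> 0 < \<rho> (fst q) \<and> 2 * \<rho> (fst q) \<le> \<eta>"
        using rho_le rho(3) by auto
      fix F assume F: "finite F" "F \<subseteq> Sigma {N..} I"
      obtain M where M: "fst ` F \<subseteq> {..<M}" using F(1) finite_nat_iff_bounded by blast
      have "(\<Sum>q\<in>F. f (2 * \<rho> (fst q))) \<le> (\<Sum>q\<in>Sigma {N..<N + M} I. f (2 * \<rho> (fst q)))"
      proof (rule sum_mono2)
        show "finite (Sigma {N..<N + M} I)" by (auto simp: I_def)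
        show "F \<subseteq> Sigma {N..<N + M} I"
        proof
          fix q assume "q \<in> F"
          then have "fst q < M" "q \<in> Sigma {N..} I" using F(2) M by auto
          then show "q \<in> Sigma {N..<N + M} I" by (cases q) simp
        qed
        show "0 \<le> f (2 * \<rho> (fst q))" for q
          using dimension_function_pos[OF f(1), of "2 * \<rho> (fst q)"] rho(3)[of "fst q"] by simp
      qed
      also have "\<dots> = (\<Sum>n\<in>{N..<N + M}. \<Sum>p\<in>I n. f (2 * \<rho> n))"
        by (subst sum.Sigma) (auto simp: I_def split_beta)
      also have "\<dots> \<le> (\<Sum>n\<in>{N..<N + M}. c n)" by (intro sum_mono card)
      also have "\<dots> = (\<Sum>n<M. c (n + N))"
        using sum.shift_bounds_nat_ivl[of c 0 N M] by (simp only: lessThan_atLeast0 add_0 add.commute[of M N])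
      also have "\<dots> \<le> (\<Sum>n. c (n + N))"
        by (intro sum_le_suminf summable_ignore_initial_segment c) (simp_all add: c0)
      finally show "(\<Sum>q\<in>F. f (2 * \<rho> (fst q))) \<le> e" using N by simp
    qed
  qed
  have "hausdorff_content f \<eta> (W2_star t) \<le> 0" if "0 < \<eta>" for \<eta>
    by (rule ennreal_le_epsilon) (use small[OF that] in simp)
  then have "hausdorff_measure f (W2_star t) \<le> 0"
    unfolding hausdorff_measure_eq_SUP by (intro SUP_least) simp
  then show ?thesis by simp
qed

lemma six_power_side1_eq: "6 ^ n * side1 t n = (3 * exp (- t)) ^ n"
proof -
  have "(6::real) ^ n = 3 ^ n * 2 ^ n" by (simp flip: power_mult_distrib)
  moreover have "exp (- (real n * t)) = exp (- t) ^ n" by (simp flip: exp_of_nat_mult)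
  ultimately show ?thesis by (simp add: side1_def power_mult_distrib)
qed

lemma pow_one_preceqD:
  assumes "dimension_function f" "pow_fun 1 \<preceq> f" "0 < x" "x \<le> y"
  shows "f x / x \<le> f y / y"
proof -
  have "y / f y \<le> x / f x"
    using assms by (cases "x = y") (auto simp: dim_preceq_def pow_fun_def)
  then show ?thesis
    using assms(3,4) dimension_function_pos[OF assms(1), of x] dimension_function_pos[OF assms(1), of y]
    by (simp add: field_simps)
qed

lemma hausdorff_measure_W2_star_eq_0_side1:
  assumes "0 \<le> t" "dimension_function f" "f \<preceq> pow_fun 2" "summable (\<lambda>n. f (side1 t n) * 6 ^ n)"
  shows "hausdorff_measure f (W2_star t) = 0"
proof (rule hausdorff_measure_W2_star_eq_0[where \<rho> = "side1 t" and ?N0.0 = "nat \<lceil>t\<rceil>"])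
  show "side2 n \<le> side1 t n" if "nat \<lceil>t\<rceil> \<le> n" for n
    using that by (intro side2_le_side1) linarith
qed (use assms in \<open>auto simp: mult.commute less_imp_neq[OF side1_pos, symmetric]\<close>)

lemma hausdorff_measure_W2_star_eq_0_side2:
  assumes "0 \<le> t" "dimension_function f" "f \<preceq> pow_fun 2"
    "summable (\<lambda>n. f (side2 n) * 9 ^ n * exp (real n ^ 2 - real n * t))"
  shows "hausdorff_measure f (W2_star t) = 0"
\<comment> \<open>The minimum agrees with \<open>side2\<close> from level \<open>t\<close> on; it
  enforces \<open>\<rho> n \<le> side1 t n\<close> on the finitely many earlier levels.\<close>
proof (rule hausdorff_measure_W2_star_eq_0[where \<rho> = "\<lambda>n. min (side1 t n) (side2 n)" and ?N0.0 = "nat \<lceil>t\<rceil>"])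
  have le: "side2 n \<le> side1 t n" if "nat \<lceil>t\<rceil> \<le> n" for n
    using that by (intro side2_le_side1) linarith
  then show "side2 n \<le> min (side1 t n) (side2 n)" if "nat \<lceil>t\<rceil> \<le> n" for n using that by auto
  have eq: "6 ^ n * (side1 t n / side2 n) = 9 ^ n * exp (real n ^ 2 - real n * t)" for n
  proof -
    have "(6::real) ^ n * 3 ^ n = 9 ^ n * 2 ^ n" by (simp flip: power_mult_distrib)
    then show ?thesis by (simp add: side1_def side2_def exp_diff exp_minus field_simps)
  qed
  have "summable (\<lambda>n. 6 ^ n * (side1 t n / side2 n) * f (side2 n))"
    using assms(4) unfolding eq by (simp add: mult_ac)
  then show "summable (\<lambda>n. 6 ^ n * (side1 t n / min (side1 t n) (side2 n)) * f (min (side1 t n) (side2 n)))"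
    by (rule summable_cong[THEN iffD1, rotated])
       (use le in \<open>auto simp: eventually_sequentially min_absorb2 intro!: exI[of _ "nat \<lceil>t\<rceil>"]\<close>)
qed (use assms in auto)

text \<open>Since \<open>f r / r\<close> is nondecreasing,
  \<open>f (side1 t n) \<le> f 1 * side1 t n\<close>, and \<open>6 ^ n * side1 t n\<close> is
  geometric with ratio \<open>3 * exp (- t) < 1\<close>.\<close>

lemma hausdorff_measure_W2_star_eq_0_of_one_preceq:
  assumes "0 \<le> t" "ln 3 < t" "dimension_function f" "f \<preceq> pow_fun 2" "pow_fun 1 \<preceq> f"
  shows "hausdorff_measure f (W2_star t) = 0"
proof (rule hausdorff_measure_W2_star_eq_0_side1)
  have "exp (ln 3) < exp t" using assms(2) by (simp only: exp_less_cancel_iff)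
  then have lt: "3 * exp (- t) < 1" by (simp add: exp_minus field_simps)
  have le: "f (side1 t n) * 6 ^ n \<le> f 1 * (3 * exp (- t)) ^ n" for n
  proof -
    have "side1 t n \<le> 1" using side1_le[OF assms(1), of n] by (rule order_trans) (simp add: divide_simps)
    then have "f (side1 t n) \<le> f 1 * side1 t n"
      using pow_one_preceqD[OF assms(3,5) side1_pos, of t n 1] by (simp add: divide_simps split: if_splits)
    then have "f (side1 t n) * 6 ^ n \<le> f 1 * side1 t n * 6 ^ n" by simp
    also have "\<dots> = f 1 * (3 * exp (- t)) ^ n" using arg_cong[OF six_power_side1_eq[of n t], of "\<lambda>x. f 1 * x"] by (simp add: mult_ac power_mult_distrib)
    finally show ?thesis .
  qed
  have sm: "summable (\<lambda>n. f 1 * (3 * exp (- t)) ^ n)"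
    using lt by (intro summable_mult summable_geometric) simp
  have nn: "0 \<le> f (side1 t n) * 6 ^ n" for n
    using dimension_function_pos[OF assms(3) side1_pos, of t n] by simp
  show "summable (\<lambda>n. f (side1 t n) * 6 ^ n)"
    by (rule summable_comparison_test'[OF sm, of 0]) (use le nn in \<open>simp only: real_norm_def abs_of_nonneg\<close>)
qed (use assms in simp_all)

section \<open>Lower bounds by descent\<close>

definition sq :: "real \<times> real \<Rightarrow> real \<Rightarrow> (real \<times> real) set" where
  "sq p l = {fst p..fst p + l} \<times> {snd p..snd p + l}"

text \<open>Suppose every index had hitting cost at least its weight. Let a ball pay to each index
  it hits the minimum of the weight and its own cost. These payments still cover every weight, while
  one ball pays in total at most its cost: trivially if it hits one index, by \<open>two\<close>
  otherwise. Summing contradicts \<open>less\<close>.\<close>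

lemma pigeonhole_weights:
  fixes g :: "nat \<Rightarrow> real" and w :: "'i \<Rightarrow> real" and hit :: "nat \<Rightarrow> 'i \<Rightarrow> bool"
  assumes "finite I" and w: "\<And>\<tau>. \<tau> \<in> I \<Longrightarrow> 0 \<le> w \<tau>" and g: "\<And>i. 0 \<le> g i"
    and two: "\<And>i \<sigma> \<tau>. \<sigma> \<in> I \<Longrightarrow> \<tau> \<in> I \<Longrightarrow> \<sigma> \<noteq> \<tau> \<Longrightarrow> hit i \<sigma> \<Longrightarrow> hit i \<tau> \<Longrightarrow>
      (\<Sum>\<tau> | \<tau> \<in> I \<and> hit i \<tau>. w \<tau>) \<le> g i"
    and less: "(\<Sum>i. ennreal (if \<exists>\<tau>\<in>I. hit i \<tau> then g i else 0)) < ennreal (sum w I)"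
  shows "\<exists>\<tau>\<in>I. (\<Sum>i. ennreal (if hit i \<tau> then g i else 0)) < ennreal (w \<tau>)"
proof (rule ccontr)
  assume "\<not> ?thesis"
  then have ge: "ennreal (w \<tau>) \<le> (\<Sum>i. ennreal (if hit i \<tau> then g i else 0))" if "\<tau> \<in> I" for \<tau>
    using that by (auto simp: not_less)
  define c where "c i \<tau> = (if hit i \<tau> then min (w \<tau>) (g i) else 0)" for i \<tau>
  have c_nonneg: "0 \<le> c i \<tau>" if "\<tau> \<in> I" for i \<tau> using w[OF that] g by (simp add: c_def)
  have "ennreal (w \<tau>) \<le> (\<Sum>i. ennreal (c i \<tau>))" if "\<tau> \<in> I" for \<tau>
  \<comment> \<open>A ball costing at least \<open>w \<tau>\<close> pays for \<open>\<tau>\<close>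
    alone; without such a ball no payment is truncated.\<close>
  proof (cases "\<exists>i. hit i \<tau> \<and> w \<tau> \<le> g i")
    case True
    then obtain i where "hit i \<tau>" "w \<tau> \<le> g i" by blast
    then have "ennreal (w \<tau>) = sum (\<lambda>i. ennreal (c i \<tau>)) {i}" by (simp add: c_def)
    also have "\<dots> \<le> (\<Sum>i. ennreal (c i \<tau>))" by (intro sum_le_suminf) auto
    finally show ?thesis .
  next
    case False
    then have "c i \<tau> = (if hit i \<tau> then g i else 0)" for i by (auto simp: c_def)
    then show ?thesis using ge[OF that] by simp
  qed
  then have "(\<Sum>\<tau>\<in>I. ennreal (w \<tau>)) \<le> (\<Sum>\<tau>\<in>I. \<Sum>i. ennreal (c i \<tau>))" by (rule sum_mono)
  also have "\<dots> = (\<Sum>i. \<Sum>\<tau>\<in>I. ennreal (c i \<tau>))" by (rule suminf_sum[symmetric]) auto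
  also have "\<dots> \<le> (\<Sum>i. ennreal (if \<exists>\<tau>\<in>I. hit i \<tau> then g i else 0))"
  proof (intro suminf_le)
    fix i
    have sum_c: "sum (c i) I = (\<Sum>\<tau> | \<tau> \<in> I \<and> hit i \<tau>. min (w \<tau>) (g i))"
      unfolding c_def using \<open>finite I\<close> by (simp add: sum.inter_filter)
    have "sum (c i) I \<le> (if \<exists>\<tau>\<in>I. hit i \<tau> then g i else 0)"
    proof (cases "\<exists>\<sigma>\<in>I. \<exists>\<tau>\<in>I. \<sigma> \<noteq> \<tau> \<and> hit i \<sigma> \<and> hit i \<tau>")
      case True
      have "sum (c i) I \<le> (\<Sum>\<tau> | \<tau> \<in> I \<and> hit i \<tau>. w \<tau>)" unfolding sum_c by (intro sum_mono) auto
      then show ?thesis using two True by fastforce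
    next
      case False
      show ?thesis
      proof (cases "\<exists>\<tau>\<in>I. hit i \<tau>")
        case True
        then obtain \<tau> where "\<tau> \<in> I" "hit i \<tau>" by blast
        with False have "{\<tau> \<in> I. hit i \<tau>} = {\<tau>}" by blast
        then show ?thesis unfolding sum_c using \<open>hit i \<tau>\<close> \<open>\<tau> \<in> I\<close> by auto
      next
        case False
        then have "{\<tau> \<in> I. hit i \<tau>} = {}" by blast
        with False show ?thesis unfolding sum_c by (simp only: sum.empty if_False)
      qed
    qed
    then show "(\<Sum>\<tau>\<in>I. ennreal (c i \<tau>)) \<le> ennreal (if \<exists>\<tau>\<in>I. hit i \<tau> then g i else 0)"
      using c_nonneg by (simp add: sum_ennreal ennreal_leI)
  qed auto
  finally show False using less w by (simp add: sum_ennreal)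
qed

text \<open>The square \<open>sq p l\<close> contains weighted squares of late level sets, of total weight at least \<open>K\<close>, whose weight no
  ball of diameter at most \<open>R\<close> can capture cheaply.\<close>

definition spread ::
  "(real \<Rightarrow> real) \<Rightarrow> (nat \<Rightarrow> (real \<times> real) set) \<Rightarrow> (nat \<Rightarrow> real) \<Rightarrow> ('i \<Rightarrow> nat) \<Rightarrow> ('i \<Rightarrow> real \<times> real) \<Rightarrow> real \<Rightarrow>
    real \<Rightarrow> nat \<Rightarrow> real \<times> real \<Rightarrow> real \<Rightarrow> real \<Rightarrow> bool" where
  "spread f E h lev cor C R N p l K \<longleftrightarrow> (\<exists>I w. finite I \<and>
     (\<forall>\<tau>\<in>I. N \<le> lev \<tau> \<and> sq (cor \<tau>) (h (lev \<tau>)) \<subseteq> sq p l \<inter> E (lev \<tau>) \<and> 0 \<le> w \<tau> \<and> w \<tau> \<le> f (h (lev \<tau>))) \<and>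
     K \<le> sum w I \<and>
     (\<forall>z r. 0 < r \<and> r \<le> R \<and>
        (\<exists>\<sigma>\<in>I. \<exists>\<tau>\<in>I. \<sigma> \<noteq> \<tau> \<and> max_ball z (r / 2) \<inter> sq (cor \<sigma>) (h (lev \<sigma>)) \<noteq> {} \<and>
           max_ball z (r / 2) \<inter> sq (cor \<tau>) (h (lev \<tau>)) \<noteq> {}) \<longrightarrow>
        (\<Sum>\<tau> | \<tau> \<in> I \<and> max_ball z (r / 2) \<inter> sq (cor \<tau>) (h (lev \<tau>)) \<noteq> {}. w \<tau>) \<le> C * f r))"

text \<open>The invariant is that the balls meeting the current square cost less than
  \<open>f (h m) / C\<close>. The pigeonhole yields a square with cost below
  \<open>w \<tau> / C\<close>, and \<open>w \<tau> \<le> f (h (lev \<tau>))\<close> restores the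
  invariant. As \<open>C\<close> divides every weight alike, it is lost once and not again at each
  level.\<close>

lemma hausdorff_content_ge_of_spread:
  assumes f: "dimension_function f" and C: "1 \<le> C" and h: "\<And>m. 0 < h m" "h \<longlonglongrightarrow> 0"
    and "0 < K" and start: "spread f E h lev cor C \<eta> N0 p0 l0 K"
    and step: "\<And>N p m. sq p (h m) \<subseteq> E m \<Longrightarrow> spread f E h lev cor C \<eta> N p (h m) (f (h m))"
  shows "ennreal (K / C) \<le> hausdorff_content f \<eta> {x. \<exists>\<^sub>\<infinity>n. x \<in> E n}"
  unfolding hausdorff_content_def
proof (rule Inf_greatest, clarify)
  fix B :: "nat \<Rightarrow> (real \<times> real) set"
  assume cov: "{x. \<exists>\<^sub>\<infinity>n. x \<in> E n} \<subseteq> (\<Union>i. B i)"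
    and B: "\<forall>i. (\<exists>x r. 0 < r \<and> B i = max_ball x r) \<and> max_diam (B i) \<le> \<eta>"
  define r where "r i = max_diam (B i)" for i
  have "\<exists>z. B i = max_ball z (r i / 2) \<and> 0 < r i" for i
    using B max_diam_max_ball unfolding r_def by (metis mult_2 field_sum_of_halves half_gt_zero_iff nonzero_mult_div_cancel_left zero_neq_numeral)
  then obtain z where z: "\<And>i. B i = max_ball (z i) (r i / 2)" and r0: "\<And>i. 0 < r i" by metis
  have r: "r i \<le> \<eta>" for i using B by (simp add: r_def)
  have fr: "0 < f (r i)" for i using dimension_function_pos[OF f r0] .
  define cost where "cost S = (\<Sum>i. ennreal (if B i \<inter> S \<noteq> {} then f (r i) else 0))" for S
  have descend: "\<exists>m p'. N \<le> m \<and> sq p' (h m) \<subseteq> sq p l \<inter> E m \<and> cost (sq p' (h m)) < ennreal (f (h m) / C)"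
    if sp: "spread f E h lev cor C \<eta> N p l K'" and less: "cost (sq p l) < ennreal (K' / C)" for N p l K'
  proof -
    obtain I w where I: "finite I" "K' \<le> sum w I"
      and Iw: "\<And>\<tau>. \<tau> \<in> I \<Longrightarrow> N \<le> lev \<tau> \<and> sq (cor \<tau>) (h (lev \<tau>)) \<subseteq> sq p l \<inter> E (lev \<tau>) \<and> 0 \<le> w \<tau> \<and> w \<tau> \<le> f (h (lev \<tau>))"
      and two: "\<And>z r. 0 < r \<Longrightarrow> r \<le> \<eta> \<Longrightarrow>
        (\<exists>\<sigma>\<in>I. \<exists>\<tau>\<in>I. \<sigma> \<noteq> \<tau> \<and> max_ball z (r / 2) \<inter> sq (cor \<sigma>) (h (lev \<sigma>)) \<noteq> {} \<and>
           max_ball z (r / 2) \<inter> sq (cor \<tau>) (h (lev \<tau>)) \<noteq> {}) \<Longrightarrow>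
        (\<Sum>\<tau> | \<tau> \<in> I \<and> max_ball z (r / 2) \<inter> sq (cor \<tau>) (h (lev \<tau>)) \<noteq> {}. w \<tau>) \<le> C * f r"
      using sp unfolding spread_def by auto
    define hit where "hit i \<tau> \<longleftrightarrow> B i \<inter> sq (cor \<tau>) (h (lev \<tau>)) \<noteq> {}" for i \<tau>
    have "\<exists>\<tau>\<in>I. (\<Sum>i. ennreal (if hit i \<tau> then f (r i) else 0)) < ennreal (w \<tau> / C)"
    proof (rule pigeonhole_weights[OF I(1)])
      fix i \<sigma> \<tau> assume "\<sigma> \<in> I" "\<tau> \<in> I" "\<sigma> \<noteq> \<tau>" "hit i \<sigma>" "hit i \<tau>"
      then have "(\<Sum>\<tau> | \<tau> \<in> I \<and> hit i \<tau>. w \<tau>) \<le> C * f (r i)"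
        using two[OF r0 r, of "z i" i] unfolding hit_def z by blast
      then show "(\<Sum>\<tau> | \<tau> \<in> I \<and> hit i \<tau>. w \<tau> / C) \<le> f (r i)"
        using C by (simp add: sum_divide_distrib[symmetric] divide_le_eq mult.commute)
    next
      have "(\<Sum>i. ennreal (if \<exists>\<tau>\<in>I. hit i \<tau> then f (r i) else 0)) \<le> cost (sq p l)"
        unfolding cost_def
      proof (intro suminf_le ennreal_leI)
        fix i
        have "B i \<inter> sq p l \<noteq> {}" if "\<exists>\<tau>\<in>I. hit i \<tau>" using that Iw unfolding hit_def by blast
        then show "(if \<exists>\<tau>\<in>I. hit i \<tau> then f (r i) else 0) \<le> (if B i \<inter> sq p l \<noteq> {} then f (r i) else 0)"
          using fr[of i] by simp
      qed auto
      also note less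
      also have "ennreal (K' / C) \<le> ennreal (\<Sum>\<tau>\<in>I. w \<tau> / C)"
        unfolding sum_divide_distrib[symmetric] using I(2) C by (intro ennreal_leI divide_right_mono) auto
      finally show "(\<Sum>i. ennreal (if \<exists>\<tau>\<in>I. hit i \<tau> then f (r i) else 0)) < ennreal (\<Sum>\<tau>\<in>I. w \<tau> / C)" .
    qed (use Iw C fr in \<open>auto intro: less_imp_le\<close>)
    then obtain \<tau> where \<tau>: "\<tau> \<in> I" "cost (sq (cor \<tau>) (h (lev \<tau>))) < ennreal (w \<tau> / C)"
      unfolding hit_def cost_def by blast
    moreover have "ennreal (w \<tau> / C) \<le> ennreal (f (h (lev \<tau>)) / C)"
      using Iw[OF \<tau>(1)] C by (intro ennreal_leI divide_right_mono) auto
    ultimately show ?thesis using Iw[OF \<tau>(1)] by (meson less_le_trans)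
  qed
  show "ennreal (K / C) \<le> (\<Sum>i. ennreal (f (max_diam (B i))))"
  proof (rule ccontr)
    assume "\<not> ?thesis"
    moreover have "cost (sq p0 l0) \<le> (\<Sum>i. ennreal (f (max_diam (B i))))"
      unfolding cost_def r_def[symmetric] by (intro suminf_le ennreal_leI) (auto simp: fr less_imp_le)
    ultimately have cost0: "cost (sq p0 l0) < ennreal (K / C)" by (auto simp: not_le)
    define P where "P = (\<lambda>(m, p). sq p (h m) \<subseteq> E m \<and> cost (sq p (h m)) < ennreal (f (h m) / C))"
    have "\<exists>s. \<forall>n. P (s n) \<and> fst (s n) < fst (s (Suc n)) \<and>
        sq (snd (s (Suc n))) (h (fst (s (Suc n)))) \<subseteq> sq (snd (s n)) (h (fst (s n)))"
    proof (rule dependent_nat_choice)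
      show "\<exists>x. P x" using descend[OF start cost0] by (auto simp: P_def)
    next
      fix x and n :: nat assume "P x"
      then have "sq (snd x) (h (fst x)) \<subseteq> E (fst x)" "cost (sq (snd x) (h (fst x))) < ennreal (f (h (fst x)) / C)"
        by (auto simp: P_def split_beta)
      from descend[OF step[OF this(1)] this(2), of "Suc (fst x)"]
      show "\<exists>y. P y \<and> fst x < fst y \<and> sq (snd y) (h (fst y)) \<subseteq> sq (snd x) (h (fst x))"
        by (fastforce simp: P_def)
    qed
    then obtain s where P: "\<And>n. P (s n)" and lt: "\<And>n. fst (s n) < fst (s (Suc n))"
      and sub: "\<And>n. sq (snd (s (Suc n))) (h (fst (s (Suc n)))) \<subseteq> sq (snd (s n)) (h (fst (s n)))"
      by blast
    define S where "S n = sq (snd (s n)) (h (fst (s n)))" for n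
    have "\<Inter> (range S) \<noteq> {}"
    \<comment> \<open>The level sets are built from half-open rectangles; the closed squares inside
      them are what makes the nested intersection nonempty.\<close>
    proof (rule compact_nest)
      show "compact (S n)" "S n \<noteq> {}" for n
        using h(1)[of "fst (s n)"] by (auto simp: S_def sq_def compact_Times)
      show "S n \<subseteq> S m" if "m \<le> n" for m n
        using that by (rule lift_Suc_antimono_le[rotated]) (auto simp: S_def sub)
    qed
    then obtain x where x: "\<And>n. x \<in> S n" by blast
    have mono: "strict_mono (\<lambda>n. fst (s n))" using lt by (rule strict_monoI_Suc)
    have "\<exists>n\<ge>N. x \<in> E n" for N
      using seq_suble[OF mono, of N] x[of N] P[of N] by (auto simp: P_def S_def split_beta)
    then have "x \<in> (\<Union>i. B i)" using cov by (auto simp: INFM_nat_le)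
    then obtain i where i: "x \<in> B i" by blast
    have "(\<lambda>n. h (fst (s n))) \<longlonglongrightarrow> 0" using LIMSEQ_subseq_LIMSEQ[OF h(2) mono] by (simp add: o_def)
    then have "\<forall>\<^sub>F n in sequentially. h (fst (s n)) < r i" using order_tendstoD(2) r0 by blast
    then obtain n where n: "h (fst (s n)) < r i" by (auto simp: eventually_sequentially)
    have "ennreal (f (r i)) = (\<Sum>i\<in>{i}. ennreal (if B i \<inter> S n \<noteq> {} then f (r i) else 0))"
      using x[of n] i by auto
    also have "\<dots> \<le> cost (S n)" unfolding cost_def by (intro sum_le_suminf) auto
    also have "\<dots> < ennreal (f (h (fst (s n))) / C)" using P[of n] by (auto simp: P_def S_def split_beta)
    also have "\<dots> \<le> ennreal (f (r i) / 1)"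
      using dimension_function_mono[OF f, of "h (fst (s n))" "r i"] n h(1)[of "fst (s n)"] C fr[of i]
      by (intro ennreal_leI frac_le) auto
    finally show False by simp
  qed
qed

section \<open>Separated rows\<close>

text \<open>Each cell of length \<open>d\<close>, counted from \<open>u\<close>, contains at most
  one value; the \<open>+ 1\<close> is for the last, possibly incomplete cell.\<close>

lemma card_separated_le:
  fixes g :: "'i \<Rightarrow> real"
  assumes "0 < d" "u \<le> v" and range: "\<And>\<tau>. \<tau> \<in> I \<Longrightarrow> u \<le> g \<tau> \<and> g \<tau> \<le> v"
    and sep: "\<And>\<sigma> \<tau>. \<sigma> \<in> I \<Longrightarrow> \<tau> \<in> I \<Longrightarrow> \<sigma> \<noteq> \<tau> \<Longrightarrow> d \<le> \<bar>g \<sigma> - g \<tau>\<bar>"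
  shows "real (card I) \<le> (v - u) / d + 1"
proof -
  define c where "c \<tau> = \<lfloor>(g \<tau> - u) / d\<rfloor>" for \<tau>
  have "inj_on c I"
  proof
    fix \<sigma> \<tau> assume *: "\<sigma> \<in> I" "\<tau> \<in> I" "c \<sigma> = c \<tau>"
    have "\<bar>(g \<sigma> - u) / d - (g \<tau> - u) / d\<bar> < 1" using *(3) unfolding c_def by linarith
    then have "\<bar>g \<sigma> - g \<tau>\<bar> < d"
      using \<open>0 < d\<close> by (simp add: diff_divide_distrib[symmetric] abs_divide)
    then show "\<sigma> = \<tau>" using sep * by force
  qed
  moreover have "c ` I \<subseteq> {0..\<lfloor>(v - u) / d\<rfloor>}"
    using range \<open>0 < d\<close> by (auto simp: c_def intro!: floor_mono divide_right_mono)
  ultimately have "card I \<le> card {0..\<lfloor>(v - u) / d\<rfloor>}" by (intro card_inj_on_le) auto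
  moreover have "0 \<le> (v - u) / d" using assms by simp
  ultimately show ?thesis by simp linarith
qed

text \<open>The intervals of length \<open>\<delta> \<tau>\<close> centred at
  \<open>y \<tau>\<close> are disjoint and lie between \<open>A\<close> and \<open>B\<close>, so
  their lengths add up to at most \<open>B - A\<close>. They are taken half-open because neighbours
  may touch.\<close>

lemma sum_separated_le:
  fixes y \<delta> :: "'i \<Rightarrow> real"
  assumes I: "finite I" "A \<le> B" and \<delta>: "\<And>\<tau>. \<tau> \<in> I \<Longrightarrow> 0 \<le> \<delta> \<tau>"
    and range: "\<And>\<tau>. \<tau> \<in> I \<Longrightarrow> A \<le> y \<tau> - \<delta> \<tau> / 2 \<and> y \<tau> + \<delta> \<tau> / 2 \<le> B"
    and sep: "\<And>\<sigma> \<tau>. \<sigma> \<in> I \<Longrightarrow> \<tau> \<in> I \<Longrightarrow> \<sigma> \<noteq> \<tau> \<Longrightarrow> (\<delta> \<sigma> + \<delta> \<tau>) / 2 \<le> \<bar>y \<sigma> - y \<tau>\<bar>"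
  shows "sum \<delta> I \<le> B - A"
proof -
  define J where "J \<tau> = {y \<tau> - \<delta> \<tau> / 2..<y \<tau> + \<delta> \<tau> / 2}" for \<tau>
  have "disjoint_family_on J I"
  proof (unfold disjoint_family_on_def, intro ballI impI)
    fix \<sigma> \<tau> assume *: "\<sigma> \<in> I" "\<tau> \<in> I" "\<sigma> \<noteq> \<tau>"
    show "J \<sigma> \<inter> J \<tau> = {}" using sep[OF *] \<delta>[OF *(1)] \<delta>[OF *(2)] by (auto simp: J_def abs_if field_simps split: if_splits)
  qed
  then have "sum (\<lambda>\<tau>. measure lborel (J \<tau>)) I = measure lborel (\<Union>\<tau>\<in>I. J \<tau>)"
    using I(1) by (intro measure_finite_Union[symmetric]) (use \<delta> in \<open>simp_all add: J_def[abs_def] image_subset_iff\<close>)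
  also have "\<dots> \<le> measure lborel {A..B}"
    using range by (intro measure_mono_fmeasurable) (fastforce simp: J_def fmeasurable_def I intro!: sets.finite_UN)+
  finally show ?thesis using I(2) \<delta> by (simp add: J_def)
qed

text \<open>Rows of level \<open>m\<close> are heights \<open>j / 3 ^ m\<close>. Only \<open>j \<equiv> 1 (mod 3)\<close> is used, so that a new row is at
  distance at least \<open>3 ^ (-m)\<close> from all rows of lower levels.\<close>

lemma exists_separated_rows:
  fixes \<delta> :: "nat \<Rightarrow> real" and v l :: real
  assumes \<delta>: "\<And>m. 0 \<le> \<delta> m" "\<And>m. \<delta> m \<le> 1 / 3 ^ m" and "0 < l"
    and div: "\<not> summable (\<lambda>m. \<delta> m * 3 ^ m)"
  obtains S :: "(nat \<times> int) set" where "finite S"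
    "\<And>m j. (m, j) \<in> S \<Longrightarrow> N \<le> m \<and> 0 < \<delta> m \<and> v \<le> j / 3 ^ m - \<delta> m / 2 \<and> j / 3 ^ m + \<delta> m / 2 \<le> v + l"
    "\<And>m j m' j'. (m, j) \<in> S \<Longrightarrow> (m', j') \<in> S \<Longrightarrow> (m, j) \<noteq> (m', j') \<Longrightarrow>
       (\<delta> m + \<delta> m') / 2 \<le> \<bar>j / 3 ^ m - j' / 3 ^ m'\<bar>"
    "l / 24 \<le> (\<Sum>s\<in>S. \<delta> (fst s))"
proof -
  \<comment> \<open>With \<open>16 \<le> l * 3 ^ m\<close> the \<open>(l * 3 ^ m - 4) / 3\<close>
    guaranteed candidates of level \<open>m\<close> are at least
    \<open>l * 3 ^ m / 4\<close>.\<close>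
  obtain N1 where N1: "16 / l < 3 ^ N1" using real_arch_pow[of 3 "16 / l"] by auto
  define N' where "N' = max N N1"
  have big: "16 \<le> l * 3 ^ m" if "N' \<le> m" for m
  proof -
    have "(3::real) ^ N1 \<le> 3 ^ m" using that by (intro power_increasing) (auto simp: N'_def)
    with N1 have "16 / l < 3 ^ m" by (rule less_le_trans)
    then show ?thesis using \<open>0 < l\<close> by (simp add: divide_less_eq mult.commute)
  qed
  define y :: "nat \<times> int \<Rightarrow> real" where "y s = real_of_int (snd s) / 3 ^ fst s" for s
  define valid where "valid k S \<longleftrightarrow> finite S \<and>
      (\<forall>s\<in>S. N' \<le> fst s \<and> fst s < N' + k \<and> 0 < \<delta> (fst s) \<and> v \<le> y s - \<delta> (fst s) / 2 \<and> y s + \<delta> (fst s) / 2 \<le> v + l) \<and>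
      (\<forall>s\<in>S. \<forall>s'\<in>S. s \<noteq> s' \<longrightarrow> (\<delta> (fst s) + \<delta> (fst s')) / 2 \<le> \<bar>y s - y s'\<bar>)" for k S
  define T where "T S = (\<Sum>s\<in>S. \<delta> (fst s))" for S :: "(nat \<times> int) set"
  \<comment> \<open>Greedy choice over the levels: while the gaps chosen so far total less than
    \<open>l / 24\<close>, they block at most \<open>l * 3 ^ m / 8\<close> candidates of the next
    level \<open>m\<close>. So at least as many are left, and the level adds
    \<open>l / 8 * (\<delta> m * 3 ^ m)\<close> or more.\<close>
  have "\<exists>S. valid k S \<and> (l / 24 \<le> T S \<or> l / 8 * (\<Sum>i<k. \<delta> (N' + i) * 3 ^ (N' + i)) \<le> T S)" for k
  proof (induction k)
    case 0
    show ?case by (rule exI[of _ "{}"]) (simp add: valid_def T_def)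
  next
    case (Suc k)
    then obtain S where S: "valid k S" "l / 24 \<le> T S \<or> l / 8 * (\<Sum>i<k. \<delta> (N' + i) * 3 ^ (N' + i)) \<le> T S"
      by blast
    define m where "m = N' + k"
    have "valid (Suc k) S" using S(1) by (auto simp: valid_def)
    show ?case
    proof (cases "l / 24 \<le> T S \<or> \<delta> m = 0")
      case True
      then show ?thesis using S(2) \<open>valid (Suc k) S\<close> by (intro exI[of _ S]) (auto simp: m_def)
    next
      case False
      then have small: "T S < l / 24" and \<delta>m: "0 < \<delta> m" using \<delta>(1)[of m] by auto
      \<comment> \<open>\<open>\<alpha>\<close> and \<open>\<beta>\<close> bound the
        \<open>i\<close> for which row \<open>3 * i + 1\<close> keeps distance
        \<open>1 / (2 * 3 ^ m) \<ge> \<delta> m / 2\<close> from both ends of the interval.\<close>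
      define \<alpha> where "\<alpha> = (v * 3 ^ m - 1 / 2) / 3"
      define \<beta> where "\<beta> = ((v + l) * 3 ^ m - 3 / 2) / 3"
      define Z where "Z = {\<lceil>\<alpha>\<rceil>..\<lfloor>\<beta>\<rfloor>}"
      define p where "p i = (m, 3 * i + 1)" for i :: int
      define bad where "bad s = {i \<in> Z. \<bar>y (p i) - y s\<bar> < (\<delta> m + \<delta> (fst s)) / 2}" for s
      define G where "G = Z - (\<Union>s\<in>S. bad s)"
      have y_p: "y (p i) = (3 * of_int i + 1) / 3 ^ m" for i by (simp add: y_def p_def)
      \<comment> \<open>Candidates are at distance at least \<open>1 / 3 ^ m\<close> from the older
        row \<open>s\<close>, so blocking even one forces
        \<open>1 / 3 ^ m \<le> \<delta> (fst s)\<close>. This absorbs the rounding term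
        \<open>+ 1\<close> of the count.\<close>
      have bad_card: "real (card (bad s)) \<le> 3 * 3 ^ m * \<delta> (fst s)" if "s \<in> S" for s
      proof (cases "bad s = {}")
        case True
        then show ?thesis using \<delta>(1)[of "fst s"] by simp
      next
        case False
        then obtain i where i: "\<bar>y (p i) - y s\<bar> < (\<delta> m + \<delta> (fst s)) / 2" by (auto simp: bad_def)
        have "fst s < m" using S(1) that by (auto simp: valid_def m_def)
        then obtain e where e: "m = fst s + Suc e" using less_iff_Suc_add[of "fst s" m] by auto
        have "y s = of_int (snd s * 3 ^ Suc e) / 3 ^ m" by (simp add: y_def e power_add)
        then have eq: "y (p i) - y s = of_int (3 * i + 1 - snd s * 3 ^ Suc e) / 3 ^ m"
          by (simp add: y_p diff_divide_distrib)
        have "3 * i + 1 - snd s * 3 ^ Suc e = 3 * (i - snd s * 3 ^ e) + 1" by (simp add: algebra_simps)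
        then have "3 * i + 1 - snd s * 3 ^ Suc e \<noteq> 0" by presburger
        then have "1 \<le> \<bar>3 * i + 1 - snd s * 3 ^ Suc e\<bar>" by linarith
        then have "(1::real) \<le> \<bar>of_int (3 * i + 1 - snd s * 3 ^ Suc e)\<bar>" by linarith
        then have "1 / 3 ^ m \<le> \<bar>y (p i) - y s\<bar>" unfolding eq by (simp add: abs_divide divide_right_mono)
        then have less: "1 / 3 ^ m < (\<delta> m + \<delta> (fst s)) / 2" using i by (rule le_less_trans)
        have "u \<le> b" if "u < (a + b) / 2" "a \<le> u" for u a b :: real using that by simp
        from this[OF less \<delta>(2)] have \<delta>s: "1 / 3 ^ m \<le> \<delta> (fst s)" .
        define d where "d = (\<delta> m + \<delta> (fst s)) / 2"
        have "0 \<le> d" using \<delta>(1)[of m] \<delta>(1)[of "fst s"] by (simp add: d_def)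
        have "real (card (bad s)) \<le> ((y s + d) - (y s - d)) / (3 / 3 ^ m) + 1"
        proof (rule card_separated_le[where g = "\<lambda>i. y (p i)"])
          show "y s - d \<le> y s + d" using \<open>0 \<le> d\<close> by simp
          show "y s - d \<le> y (p i) \<and> y (p i) \<le> y s + d" if "i \<in> bad s" for i
            using that by (auto simp: bad_def d_def[symmetric] abs_less_iff)
          fix i i' :: int assume "i \<noteq> i'"
          then have "1 \<le> \<bar>i - i'\<bar>" by linarith
          then have "(1::real) \<le> \<bar>of_int i - of_int i'\<bar>" by linarith
          moreover have "y (p i) - y (p i') = 3 * (of_int i - of_int i') / 3 ^ m"
            by (simp add: y_p diff_divide_distrib[symmetric] algebra_simps)
          ultimately show "3 / 3 ^ m \<le> \<bar>y (p i) - y (p i')\<bar>" by (simp add: abs_divide abs_mult divide_right_mono)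
        qed auto
        also have "\<dots> = (\<delta> m + \<delta> (fst s)) * 3 ^ m / 3 + 1" by (simp add: d_def)
        also have "\<dots> \<le> (\<delta> (fst s) + \<delta> (fst s)) * 3 ^ m / 3 + \<delta> (fst s) * 3 ^ m"
          using \<delta>s order_trans[OF \<delta>(2)[of m] \<delta>s]
          by (intro add_mono divide_right_mono mult_right_mono) (simp_all add: pos_divide_le_eq)
        also have "\<dots> \<le> 3 * 3 ^ m * \<delta> (fst s)" using \<delta>(1)[of "fst s"] by (simp add: field_simps)
        finally show ?thesis .
      qed
      have "real (card (\<Union>s\<in>S. bad s)) \<le> (\<Sum>s\<in>S. real (card (bad s)))"
        using card_UN_le[of S bad] S(1) unfolding valid_def by (metis of_nat_le_iff of_nat_sum)
      also have "\<dots> \<le> (\<Sum>s\<in>S. 3 * 3 ^ m * \<delta> (fst s))" by (intro sum_mono bad_card)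
      also have "\<dots> = 3 * 3 ^ m * T S" by (simp add: T_def sum_distrib_left)
      also have "\<dots> \<le> 3 * 3 ^ m * (l / 24)" using small by (intro mult_left_mono) auto
      finally have card_bad: "real (card (\<Union>s\<in>S. bad s)) \<le> l * 3 ^ m / 8" by (simp add: field_simps)
      have "\<beta> - \<alpha> = (l * 3 ^ m - 1) / 3" by (simp add: \<alpha>_def \<beta>_def field_simps)
      then have "l * 3 ^ m / 4 \<le> \<beta> - \<alpha> - 1" using big[of m] by (simp add: m_def)
      moreover have "\<beta> - \<alpha> - 1 \<le> real (card Z)" unfolding Z_def by simp linarith
      moreover have "card Z \<le> card G + card (\<Union>s\<in>S. bad s)"
      proof -
        have "Z \<subseteq> G \<union> (\<Union>s\<in>S. bad s)" by (auto simp: G_def)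
        moreover have "bad s \<subseteq> Z" "finite Z" for s by (auto simp: bad_def Z_def)
        then have "finite (G \<union> (\<Union>s\<in>S. bad s))" using S(1) finite_subset[OF \<open>bad _ \<subseteq> Z\<close>] by (auto simp: G_def valid_def)
        ultimately show ?thesis by (metis card_Un_le card_mono order_trans)
      qed
      ultimately have card_G: "l * 3 ^ m / 8 \<le> real (card G)" using card_bad by linarith
      have fin: "finite S" "finite G" using S(1) by (auto simp: valid_def G_def Z_def)
      have inj: "inj_on p G" by (auto simp: inj_on_def p_def)
      have disj: "S \<inter> p ` G = {}" using S(1) by (auto simp: valid_def p_def m_def)
      have G_range: "v \<le> y (p i) - \<delta> m / 2 \<and> y (p i) + \<delta> m / 2 \<le> v + l" if "i \<in> G" for i
      proof -
        have "\<alpha> \<le> of_int i" "of_int i \<le> \<beta>" using that unfolding G_def Z_def by auto linarith+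
        then have 1: "v * 3 ^ m + 1 / 2 \<le> 3 * of_int i + 1" "3 * of_int i + 1 \<le> (v + l) * 3 ^ m - 1 / 2"
          by (auto simp: \<alpha>_def \<beta>_def)
        have 2: "\<delta> m * 3 ^ m / 2 \<le> 1 / 2" using \<delta>(2)[of m] by (simp add: field_simps)
        have 3: "y (p i) * 3 ^ m = 3 * of_int i + 1" by (simp add: y_p)
        have "a * c \<le> (u - d / 2) * c" "(u + d / 2) * c \<le> b * c"
          if "u * c = e" "a * c + 1 / 2 \<le> e" "e \<le> b * c - 1 / 2" "d * c / 2 \<le> 1 / 2" for a b c d e u :: real
          using that by (simp_all add: left_diff_distrib distrib_right)
        from this[OF 3 1 2]
        have "v * 3 ^ m \<le> (y (p i) - \<delta> m / 2) * 3 ^ m" "(y (p i) + \<delta> m / 2) * 3 ^ m \<le> (v + l) * 3 ^ m" .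
        then show ?thesis by simp
      qed
      have "valid (Suc k) (S \<union> p ` G)"
        unfolding valid_def
      proof (intro conjI ballI impI)
        show "finite (S \<union> p ` G)" using fin by simp
        fix s assume s: "s \<in> S \<union> p ` G"
        show "N' \<le> fst s" "fst s < N' + Suc k" "0 < \<delta> (fst s)" "v \<le> y s - \<delta> (fst s) / 2" "y s + \<delta> (fst s) / 2 \<le> v + l"
          using s G_range \<delta>m S(1) by (auto simp: valid_def p_def m_def less_Suc_eq)
        fix s' assume s': "s' \<in> S \<union> p ` G" and "s \<noteq> s'"
        have old: "(\<delta> m + \<delta> (fst u)) / 2 \<le> \<bar>y (p i) - y u\<bar>" if "u \<in> S" "i \<in> G" for u i
          using that by (force simp: G_def bad_def not_less)
        consider "s \<in> S" "s' \<in> S" | i where "s = p i" "i \<in> G" "s' \<in> S" | i where "s' = p i" "i \<in> G" "s \<in> S"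
          | i i' where "s = p i" "s' = p i'" using s s' by blast
        then show "(\<delta> (fst s) + \<delta> (fst s')) / 2 \<le> \<bar>y s - y s'\<bar>"
        proof cases
          case 1
          then show ?thesis using S(1) \<open>s \<noteq> s'\<close> by (auto simp: valid_def)
        next
          case 2
          then show ?thesis using old[of s' i] by (simp add: p_def)
        next
          case 3
          then show ?thesis using old[of s i] by (simp add: p_def abs_minus_commute add.commute)
        next
          case 4
          then have "i \<noteq> i'" using \<open>s \<noteq> s'\<close> by auto
          then have "1 \<le> \<bar>i - i'\<bar>" by linarith
          then have "(1::real) \<le> \<bar>of_int i - of_int i'\<bar>" by linarith
          moreover have "y (p i) - y (p i') = 3 * (of_int i - of_int i') / 3 ^ m"
            by (simp add: y_p diff_divide_distrib[symmetric] algebra_simps)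
          ultimately have "3 / 3 ^ m \<le> \<bar>y (p i) - y (p i')\<bar>" by (simp add: abs_divide abs_mult divide_right_mono)
          moreover have "\<delta> m \<le> 3 / 3 ^ m" using \<delta>(2)[of m] by (rule order_trans) (simp add: divide_right_mono)
          ultimately show ?thesis using 4 by (simp add: p_def)
        qed
      qed
      moreover have "T (S \<union> p ` G) = T S + real (card G) * \<delta> m"
      proof -
        have "(\<Sum>s\<in>p ` G. \<delta> (fst s)) = real (card G) * \<delta> m"
          unfolding sum.reindex[OF inj] by (simp add: p_def)
        then show ?thesis unfolding T_def using fin disj by (subst sum.union_disjoint) auto
      qed
      moreover have "l / 8 * (\<delta> m * 3 ^ m) \<le> real (card G) * \<delta> m"
        using mult_right_mono[OF card_G, of "\<delta> m"] \<delta>m by (simp add: mult_ac)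
      ultimately show ?thesis
        using S(2) small by (intro exI[of _ "S \<union> p ` G"]) (auto simp: m_def distrib_left)
    qed
  qed
  \<comment> \<open>Partial sums reaching \<open>1 / 3\<close> turn the gain \<open>l / 8\<close>
    into the required \<open>l / 24\<close>.\<close>
  moreover have "\<exists>k. 1 / 3 \<le> (\<Sum>i<k. \<delta> (N' + i) * 3 ^ (N' + i))"
  proof (rule ccontr)
    assume "\<not> ?thesis"
    then have "summable (\<lambda>i. \<delta> (N' + i) * 3 ^ (N' + i))"
      using \<delta>(1) by (intro summableI_nonneg_bounded[where x = "1/3"]) (auto simp: not_le less_imp_le)
    then have "summable (\<lambda>i. \<delta> (i + N') * 3 ^ (i + N'))" by (simp add: add.commute)
    then show False using div by (simp only: summable_iff_shift[of "\<lambda>i. \<delta> i * 3 ^ i" N'])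
  qed
  ultimately obtain k S where k: "1 / 3 \<le> (\<Sum>i<k. \<delta> (N' + i) * 3 ^ (N' + i))" and S: "valid k S"
    "l / 24 \<le> T S \<or> l / 8 * (\<Sum>i<k. \<delta> (N' + i) * 3 ^ (N' + i)) \<le> T S" by meson
  have "l / 24 \<le> T S" using S(2) mult_left_mono[OF k, of "l / 8"] \<open>0 < l\<close> by linarith
  show ?thesis
  proof (rule that[of S])
    show "finite S" using S(1) by (simp add: valid_def)
    show "l / 24 \<le> (\<Sum>s\<in>S. \<delta> (fst s))" using \<open>l / 24 \<le> T S\<close> by (simp add: T_def)
    show "N \<le> m \<and> 0 < \<delta> m \<and> v \<le> j / 3 ^ m - \<delta> m / 2 \<and> j / 3 ^ m + \<delta> m / 2 \<le> v + l" if "(m, j) \<in> S" for m j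
    proof -
      have "N' \<le> fst (m, j) \<and> 0 < \<delta> (fst (m, j)) \<and> v \<le> y (m, j) - \<delta> (fst (m, j)) / 2 \<and>
          y (m, j) + \<delta> (fst (m, j)) / 2 \<le> v + l"
        using S(1) that unfolding valid_def by blast
      then show ?thesis by (simp add: y_def N'_def)
    qed
    show "(\<delta> m + \<delta> m') / 2 \<le> \<bar>j / 3 ^ m - j' / 3 ^ m'\<bar>"
      if "(m, j) \<in> S" "(m', j') \<in> S" "(m, j) \<noteq> (m', j')" for m j m' j'
    proof -
      have "(\<delta> (fst (m, j)) + \<delta> (fst (m', j'))) / 2 \<le> \<bar>y (m, j) - y (m', j')\<bar>"
        using S(1) that unfolding valid_def by blast
      then show ?thesis by (simp only: y_def fst_conv snd_conv)
    qed
  qed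
qed

section \<open>Weighted squares\<close>

text \<open>Closed squares of half the height of a rectangle of level \<open>m\<close> fit into the half-open rectangles with
  gaps as wide as the squares themselves.\<close>

definition half :: "nat \<Rightarrow> real" where "half m = side2 m / 2"

definition column_count :: "real \<Rightarrow> nat \<Rightarrow> nat" where "column_count t m = nat \<lfloor>side1 t m / side2 m\<rfloor>"

text \<open>Grouping the indices as (row, position in the row) lets a family of squares be a
  \<open>Sigma\<close> over the selected rows.\<close>

definition corner :: "(nat \<times> int) \<times> (int \<times> nat) \<Rightarrow> real \<times> real" where
  "corner = (\<lambda>((m, j), (k, i)). (of_int k / 2 ^ m + real i * side2 m, of_int j / 3 ^ m))"

lemma half_pos [simp]: "0 < half m" by (simp add: half_def)

lemma half_tendsto_0: "half \<longlonglongrightarrow> 0"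
proof (rule tendsto_sandwich[where f = "\<lambda>_. 0" and h = "\<lambda>m. (1/3) ^ m"])
  show "(\<lambda>m. (1/3) ^ m :: real) \<longlonglongrightarrow> 0" by (rule LIMSEQ_realpow_zero) auto
  show "\<forall>\<^sub>F m in sequentially. half m \<le> (1/3) ^ m"
  proof (intro always_eventually allI)
    fix m
    show "half m \<le> (1/3) ^ m"
      using order_trans[OF _ side2_le[of m], of "half m"] side2_pos[of m] by (simp add: half_def power_divide del: side2_pos)
  qed
qed (simp_all add: less_imp_le)

lemma column_count_bounds:
  assumes "t \<le> real m"
  shows "side1 t m / 2 \<le> column_count t m * side2 m" "column_count t m * side2 m \<le> side1 t m"
proof -
  let ?z = "side1 t m / side2 m"
  have 1: "1 \<le> ?z" using side2_le_side1[OF assms] by simp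
  have "z / 2 \<le> real (nat \<lfloor>z\<rfloor>)" "real (nat \<lfloor>z\<rfloor>) \<le> z" if "1 \<le> z" for z :: real
  proof -
    have "1 \<le> \<lfloor>z\<rfloor>" using that by (simp add: le_floor_iff)
    then have "real (nat \<lfloor>z\<rfloor>) = of_int \<lfloor>z\<rfloor>" "1 \<le> real_of_int \<lfloor>z\<rfloor>" by simp_all
    then show "z / 2 \<le> real (nat \<lfloor>z\<rfloor>)" "real (nat \<lfloor>z\<rfloor>) \<le> z" by linarith+
  qed
  from this[OF 1] have "?z / 2 \<le> real (column_count t m)" "real (column_count t m) \<le> ?z"
    unfolding column_count_def .
  then have "?z / 2 * side2 m \<le> real (column_count t m) * side2 m" "real (column_count t m) * side2 m \<le> ?z * side2 m"
    by (intro mult_right_mono; simp add: less_imp_le)+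
  then show "side1 t m / 2 \<le> column_count t m * side2 m" "column_count t m * side2 m \<le> side1 t m"
    using side2_pos[of m] by auto
qed

text \<open>Inside a rectangle the corners step by \<open>side2 m\<close>. Across rectangles, the
  last column of \<open>k\<close> ends by \<open>(k + 1) / 2 ^ m\<close>, because
  \<open>column_count t m * side2 m \<le> side1 t m \<le> 1 / 2 ^ m\<close>.\<close>

lemma corner_separated:
  assumes t: "0 \<le> t" "t \<le> real m" and i: "i < column_count t m" "i' < column_count t m" and ne: "(k, i) \<noteq> (k', i')"
  shows "side2 m \<le> \<bar>fst (corner ((m, j), (k, i))) - fst (corner ((m, j'), (k', i')))\<bar>"
proof -
  have *: "side2 m \<le> \<bar>fst (corner ((m, j), (k, i))) - fst (corner ((m, j'), (k', i')))\<bar>"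
    if "k < k'" "i < column_count t m" for k k' :: int and i i' j j'
  proof -
    have "real (Suc i) * side2 m \<le> real (column_count t m) * side2 m"
      using that(2) by (intro mult_right_mono) (auto simp: less_imp_le)
    also have "\<dots> \<le> 1 / 2 ^ m" using column_count_bounds(2)[OF t(2)] side1_le[OF t(1), of m] by linarith
    finally have 1: "real i * side2 m + side2 m \<le> 1 / 2 ^ m" by (simp add: algebra_simps)
    have "(of_int k + 1) / 2 ^ m \<le> (of_int k' / 2 ^ m :: real)" using that(1) by (intro divide_right_mono) auto
    then have 2: "of_int k / 2 ^ m + 1 / 2 ^ m \<le> (of_int k' / 2 ^ m :: real)" by (simp add: add_divide_distrib)
    have "0 \<le> real i' * side2 m" by (simp add: less_imp_le)
    with 1 2 show ?thesis unfolding corner_def by simp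
  qed
  show ?thesis
  proof (cases k k' rule: linorder_cases)
    case equal
    then have "i \<noteq> i'" using ne by simp
    then have "1 \<le> \<bar>real i - real i'\<bar>" by linarith
    then have "1 * side2 m \<le> \<bar>real i - real i'\<bar> * side2 m" by (intro mult_right_mono) (auto simp: less_imp_le)
    also have "\<dots> = \<bar>(real i - real i') * side2 m\<bar>" by (simp add: abs_mult abs_of_pos)
    finally show ?thesis using equal by (simp add: corner_def left_diff_distrib)
  next
    case less
    then show ?thesis using *[OF less i(1), of j j' i'] by simp
  next
    case greater
    then show ?thesis using *[OF greater i(2), of j' j i] by (simp add: abs_minus_commute)
  qed
qed

section \<open>Squares of a row that meet a ball\<close>

definition hits :: "real \<times> real \<Rightarrow> real \<Rightarrow> (nat \<times> int) \<times> (int \<times> nat) \<Rightarrow> bool" where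
  "hits z r \<tau> \<longleftrightarrow> max_ball z (r / 2) \<inter> sq (corner \<tau>) (half (fst (fst \<tau>))) \<noteq> {}"

lemma hitsD:
  assumes "hits z r \<tau>"
  shows "fst z - r / 2 - half (fst (fst \<tau>)) \<le> fst (corner \<tau>)" "fst (corner \<tau>) \<le> fst z + r / 2"
    "snd z - r / 2 - half (fst (fst \<tau>)) \<le> snd (corner \<tau>)" "snd (corner \<tau>) \<le> snd z + r / 2"
  using assms unfolding hits_def max_ball_eq sq_def by auto

text \<open>Up to a constant, the mass carried by those squares of one row of level \<open>m\<close> that meet a ball of
  diameter \<open>r\<close>.\<close>

definition row_mass :: "real \<Rightarrow> (nat \<Rightarrow> real) \<Rightarrow> nat \<Rightarrow> real \<Rightarrow> real" where
  "row_mass t q m r = q m * (if r < 1 / 2 ^ m then min (side1 t m) r else side1 t m * 2 ^ m * r)"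

lemma half_le: "half m \<le> 1 / (2 * 3 ^ m)" "half m \<le> 1 / 2 ^ m"
proof -
  show *: "half m \<le> 1 / (2 * 3 ^ m)" using side2_le[of m] by (simp add: half_def field_simps)
  have "(2::real) ^ m \<le> 2 * 3 ^ m" using power_mono[of "2::real" 3 m] zero_le_power[of "3::real" m] by linarith
  then have "1 / (2 * 3 ^ m) \<le> (1 / 2 ^ m :: real)" by (intro divide_left_mono) auto
  with * show "half m \<le> 1 / 2 ^ m" by simp
qed

text \<open>Two counts compete. Separation of the corners gives mass of order \<open>r\<close>, with
  rounding absorbed by \<open>half m \<le> r\<close>. Counting the rectangles met, at most
  \<open>r * 2 ^ m + 3\<close>, and filling each completely gives mass of order
  \<open>side1 t m\<close> for \<open>r < 1 / 2 ^ m\<close> and \<open>side1 t m * 2 ^ m * r\<close>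
  for larger \<open>r\<close>.\<close>

lemma card_hits_row:
  assumes t: "0 \<le> t" "t \<le> real m" and r: "half m \<le> r" and q: "0 \<le> q m"
    and X: "\<And>x. x \<in> X \<Longrightarrow> snd x < column_count t m \<and> hits z r ((m, j), x)"
  shows "real (card X) * (q m * half m) \<le> 2 * row_mass t q m r"
proof -
  let ?g = "\<lambda>x. fst (corner ((m, j), x))"
  have r0: "0 < r" using r half_pos[of m] by linarith
  have range: "fst z - r / 2 - half m \<le> ?g x \<and> ?g x \<le> fst z + r / 2" if "x \<in> X" for x
    using hitsD[of z r "((m, j), x)"] X[OF that] by simp
  have "real (card X) \<le> (fst z + r / 2 - (fst z - r / 2 - half m)) / side2 m + 1"
  proof (rule card_separated_le[where g = ?g])
    show "side2 m \<le> \<bar>?g x - ?g y\<bar>" if "x \<in> X" "y \<in> X" "x \<noteq> y" for x y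
      using corner_separated[OF t, of "snd x" "snd y" "fst x" "fst y" j j] X[OF that(1)] X[OF that(2)] that(3)
      by (simp add: prod_eq_iff)
  qed (use range r0 less_imp_le[OF half_pos, of m] in auto)
  then have "real (card X) * half m \<le> ((r + half m) / side2 m + 1) * half m"
    by (intro mult_right_mono) (simp_all add: less_imp_le)
  also have "\<dots> = r / 2 + 3 / 2 * half m" using side2_pos[of m] by (simp add: half_def field_simps less_imp_neq[symmetric])
  also have "\<dots> \<le> 2 * r" using r by simp
  finally have 1: "real (card X) * half m \<le> 2 * r" .
  define Y where "Y = fst ` X"
  have n: "real (column_count t m) * half m \<le> side1 t m / 2"
    using column_count_bounds(2)[OF t(2)] by (simp add: half_def)
  have "real (card Y) \<le> (fst z + r / 2 - (fst z - r / 2 - half m - side1 t m)) / (1 / 2 ^ m) + 1"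
  proof (rule card_separated_le[where g = "\<lambda>k. of_int k / 2 ^ m"])
    fix k k' :: int assume "k \<noteq> k'"
    then have "1 \<le> \<bar>k - k'\<bar>" by linarith
    then have "(1::real) \<le> \<bar>of_int k - of_int k'\<bar>" by linarith
    then show "(1::real) / 2 ^ m \<le> \<bar>of_int k / 2 ^ m - of_int k' / 2 ^ m\<bar>"
      by (simp add: diff_divide_distrib[symmetric] abs_divide divide_right_mono)
  next
    fix k assume "k \<in> Y"
    then obtain i where ki: "(k, i) \<in> X" by (auto simp: Y_def)
    have "real i * side2 m \<le> real (column_count t m) * side2 m"
      using X[OF ki] by (intro mult_right_mono) (auto simp: less_imp_le)
    then have "real i * side2 m \<le> side1 t m" using column_count_bounds(2)[OF t(2)] by linarith
    moreover have "0 \<le> real i * side2 m" by (simp add: less_imp_le)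
    ultimately show "fst z - r / 2 - half m - side1 t m \<le> of_int k / 2 ^ m \<and> of_int k / 2 ^ m \<le> fst z + r / 2"
      using range[OF ki] by (simp add: corner_def)
  qed (use r0 less_imp_le[OF half_pos, of m] less_imp_le[OF side1_pos, of t m] in auto)
  also have "\<dots> = r * 2 ^ m + (half m * 2 ^ m + side1 t m * 2 ^ m) + 1" by (simp add: algebra_simps)
  also have "half m * 2 ^ m \<le> 1" using half_le(2)[of m] by (simp add: pos_le_divide_eq)
  also have "side1 t m * 2 ^ m \<le> 1" using side1_le[OF t(1), of m] by (simp add: pos_le_divide_eq)
  finally have Y: "real (card Y) \<le> r * 2 ^ m + 3" by simp
  have "X \<subseteq> Y \<times> {..<column_count t m}" using X by (force simp: Y_def)
  then have 2: "real (card X) * half m \<le> (r * 2 ^ m + 3) * (side1 t m / 2)"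
  proof (cases "finite X")
    case True
    then have "card X \<le> card (Y \<times> {..<column_count t m})"
      using \<open>X \<subseteq> Y \<times> {..<column_count t m}\<close> by (intro card_mono) (auto simp: Y_def)
    then have "real (card X) \<le> real (card Y) * real (column_count t m)"
      by (simp add: card_cartesian_product flip: of_nat_mult)
    then have "real (card X) * half m \<le> real (card Y) * real (column_count t m) * half m"
      by (intro mult_right_mono) (simp_all add: less_imp_le)
    also have "\<dots> \<le> (r * 2 ^ m + 3) * (side1 t m / 2)"
      unfolding mult.assoc using Y n r0 by (intro mult_mono) (auto simp: less_imp_le)
    finally show ?thesis .
  next
    case False
    have "0 \<le> (r * 2 ^ m + 3) * (side1 t m / 2)" using r0 by (intro mult_nonneg_nonneg) (auto simp: less_imp_le)
    then show ?thesis using False by simp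
  qed
  have "real (card X) * half m \<le> 2 * (if r < 1 / 2 ^ m then min (side1 t m) r else side1 t m * 2 ^ m * r)"
  proof (cases "r < 1 / 2 ^ m")
    case True
    then have "r * 2 ^ m + 3 \<le> 4" by (simp add: pos_less_divide_eq)
    then have "(r * 2 ^ m + 3) * (side1 t m / 2) \<le> 4 * (side1 t m / 2)" by (intro mult_right_mono) (simp_all add: less_imp_le)
    then have "real (card X) * half m \<le> 2 * side1 t m" using 2 by linarith
    then show ?thesis using 1 True by (simp add: min_def)
  next
    case False
    then have "r * 2 ^ m + 3 \<le> 4 * (r * 2 ^ m)" by (simp add: not_less pos_divide_le_eq)
    then have "(r * 2 ^ m + 3) * (side1 t m / 2) \<le> 4 * (r * 2 ^ m) * (side1 t m / 2)"
      by (intro mult_right_mono) (simp_all add: less_imp_le)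
    with 2 have "real (card X) * half m \<le> 4 * (r * 2 ^ m) * (side1 t m / 2)" by (rule order_trans)
    then show ?thesis using False by (simp add: mult_ac)
  qed
  from mult_left_mono[OF this q] show ?thesis by (simp add: row_mass_def mult_ac)
qed

text \<open>Up to a constant, \<open>q m\<close> is the mass per unit length inside a rectangle.
  Averaged over the period \<open>1 / 2 ^ m\<close>, a row carries
  \<open>q m * exp (- (real m * t))\<close> per unit length; dividing by \<open>D\<close> gives the
  height of a strip in which this mass has area density \<open>D\<close>. That height is the gap
  around the row. Being at least \<open>8 * half m\<close>, it makes the thickness of the squares
  harmless.\<close>

definition row_weights :: "real \<Rightarrow> real \<Rightarrow> (real \<Rightarrow> real) \<Rightarrow> (nat \<Rightarrow> real) \<Rightarrow> bool" where
  "row_weights t D f q \<longleftrightarrow>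
     (\<forall>m. 0 \<le> q m \<and> q m * half m \<le> f (half m) \<and> q m * exp (- (real m * t)) / D \<le> 1 / 3 ^ m \<and>
        (0 < q m \<longrightarrow> 8 * half m \<le> q m * exp (- (real m * t)) / D)) \<and>
     \<not> summable (\<lambda>m. q m * exp (- (real m * t)) / D * 3 ^ m)"

text \<open>Rows with these gaps are filled with squares of weight \<open>q m * half m\<close>. A
  ball larger than \<open>l\<close> is handled by the total mass, one meeting a single row by
  \<open>single\<close> or by the area density, and one meeting several rows by
  \<open>multi\<close>, whose premises record what the separation of the gaps implies.\<close>

lemma spread_rows:
  assumes t: "0 \<le> t" and D: "0 < D" and q: "row_weights t D f q"
    and f: "dimension_function f" and l: "0 < l" and inside: "sq p l \<subseteq> {0..<1} \<times> {0..<1}"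
    and K: "K = D * l ^ 2 / 192"
    and K_le: "\<And>r. 0 < r \<Longrightarrow> r \<le> R \<Longrightarrow> K * min 1 ((r / l) ^ 2) \<le> f r"
    and single: "\<And>m r. half m \<le> r \<Longrightarrow> r \<le> R \<Longrightarrow> r < 1 / 2 ^ m \<Longrightarrow> q m * min (side1 t m) r \<le> 1000 * f r"
    and multi: "\<And>r S. 0 < r \<Longrightarrow> r \<le> R \<Longrightarrow> r \<le> l \<Longrightarrow> finite S \<Longrightarrow>
      (\<And>m j. (m, j) \<in> S \<Longrightarrow> N1 \<le> m \<and> 0 < q m \<and> q m * exp (- (real m * t)) / D \<le> 3 * r \<and> half m \<le> r) \<Longrightarrow>
      (\<Sum>s\<in>S. q (fst s) * exp (- (real (fst s) * t)) / D) \<le> 5 * r \<Longrightarrow>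
      (\<And>m. r < 1 / 3 ^ m \<Longrightarrow> card {j::int. (m, j) \<in> S} \<le> 2) \<Longrightarrow>
      (\<Sum>s\<in>S. row_mass t q (fst s) r) \<le> 1000 * f r"
  shows "spread f (level_set t) half (fst \<circ> fst) corner 2000 R N p l K"
proof -
  define gap where "gap m = q m * exp (- (real m * t)) / D" for m
  have q_nonneg: "0 \<le> q m" and q_le: "q m * half m \<le> f (half m)" and gap_le: "gap m \<le> 1 / 3 ^ m"
    and gap_ge: "0 < q m \<Longrightarrow> 8 * half m \<le> gap m" and gap_div: "\<not> summable (\<lambda>m. gap m * 3 ^ m)" for m
    using q by (simp_all add: row_weights_def gap_def)
  have gap_nonneg: "0 \<le> gap m" for m using q_nonneg D by (simp add: gap_def)
  have gap_pos_iff: "0 < gap m \<longleftrightarrow> 0 < q m" for m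
    using D by (simp add: gap_def zero_less_mult_iff zero_less_divide_iff)
  have q_side1: "q m * side1 t m = D * gap m / 2 ^ m" for m using D by (simp add: gap_def side1_def)
  \<comment> \<open>\<open>4 \<le> l * 2 ^ m\<close> guarantees at least
    \<open>l * 2 ^ m / 2\<close> whole cells of width \<open>1 / 2 ^ m\<close> inside the
    square.\<close>
  obtain N2 where N2: "4 / l < 2 ^ N2" using real_arch_pow[of 2 "4 / l"] by auto
  define M where "M = max (max N N1) (max N2 (nat \<lceil>t\<rceil>))"
  have M: "N \<le> m" "N1 \<le> m" "t \<le> real m" "4 \<le> l * 2 ^ m" if "M \<le> m" for m
  proof -
    show "N \<le> m" "N1 \<le> m" "t \<le> real m" using that unfolding M_def by linarith+
    have "(2::real) ^ N2 \<le> 2 ^ m" using that by (intro power_increasing) (auto simp: M_def)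
    with N2 have "4 / l < 2 ^ m" by (rule less_le_trans)
    then show "4 \<le> l * 2 ^ m" using l by (simp add: divide_less_eq mult.commute)
  qed
  obtain S :: "(nat \<times> int) set" where "finite S"
    and S: "\<And>m j. (m, j) \<in> S \<Longrightarrow> M \<le> m \<and> 0 < gap m \<and> snd p \<le> j / 3 ^ m - gap m / 2 \<and> j / 3 ^ m + gap m / 2 \<le> snd p + l"
    and S_sep: "\<And>m j m' j'. (m, j) \<in> S \<Longrightarrow> (m', j') \<in> S \<Longrightarrow> (m, j) \<noteq> (m', j') \<Longrightarrow>
       (gap m + gap m') / 2 \<le> \<bar>j / 3 ^ m - j' / 3 ^ m'\<bar>"
    and S_sum: "l / 24 \<le> (\<Sum>s\<in>S. gap (fst s))"
    by (rule exists_separated_rows[where \<delta> = gap and l = l and N = M and v = "snd p", OF gap_nonneg gap_le l gap_div]) blast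
  define Y where "Y s = real_of_int (snd s) / 3 ^ fst s" for s :: "nat \<times> int"
  have S_M: "M \<le> fst s" and S_gap: "0 < gap (fst s)" and S_q: "0 < q (fst s)" and S_half: "8 * half (fst s) \<le> gap (fst s)"
    and S_range: "snd p \<le> Y s - gap (fst s) / 2" "Y s + gap (fst s) / 2 \<le> snd p + l" if "s \<in> S" for s
    using S[of "fst s" "snd s"] that gap_ge[of "fst s"] gap_pos_iff[of "fst s"] by (auto simp: Y_def gap_def)
  have Y_sep: "(gap (fst s) + gap (fst s')) / 2 \<le> \<bar>Y s - Y s'\<bar>" if "s \<in> S" "s' \<in> S" "s \<noteq> s'" for s s'
    using S_sep[of "fst s" "snd s" "fst s'" "snd s'"] that unfolding Y_def by (simp add: prod_eq_iff)
  \<comment> \<open>The \<open>- 1\<close> keeps the whole cell from \<open>k / 2 ^ m\<close> to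
    \<open>(k + 1) / 2 ^ m\<close> inside the square.\<close>
  define Kset where "Kset m = {\<lceil>fst p * 2 ^ m\<rceil>..\<lfloor>(fst p + l) * 2 ^ m\<rfloor> - 1}" for m :: nat
  define X where "X s = Kset (fst s) \<times> {..<column_count t (fst s)}" for s :: "nat \<times> int"
  define I where "I = Sigma S X"
  define w where "w \<tau> = q (fst (fst \<tau>)) * half (fst (fst \<tau>))" for \<tau> :: "(nat \<times> int) \<times> (int \<times> nat)"
  have fin: "finite (X s)" for s by (simp add: X_def Kset_def)
  have Kset_card: "l * 2 ^ m / 2 \<le> real (card (Kset m))" "real (card (Kset m)) \<le> l * 2 ^ m" if "M \<le> m" for m
  proof -
    have "real (card {\<lceil>a\<rceil>..\<lfloor>a + b\<rfloor> - 1}) \<le> b" "b / 2 \<le> real (card {\<lceil>a\<rceil>..\<lfloor>a + b\<rfloor> - 1})" if "4 \<le> b" for a b :: real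
    proof -
      have "b - 2 \<le> of_int (\<lfloor>a + b\<rfloor> - \<lceil>a\<rceil>)" "of_int (\<lfloor>a + b\<rfloor> - \<lceil>a\<rceil>) \<le> b" by linarith+
      moreover from this(1) have "0 \<le> \<lfloor>a + b\<rfloor> - \<lceil>a\<rceil>" using that by linarith
      then have "real (card {\<lceil>a\<rceil>..\<lfloor>a + b\<rfloor> - 1}) = of_int (\<lfloor>a + b\<rfloor> - \<lceil>a\<rceil>)" by simp
      ultimately show "real (card {\<lceil>a\<rceil>..\<lfloor>a + b\<rfloor> - 1}) \<le> b" "b / 2 \<le> real (card {\<lceil>a\<rceil>..\<lfloor>a + b\<rfloor> - 1})"
        using that by linarith+
    qed
    from this[OF M(4)[OF that], of "fst p * 2 ^ m"] show "l * 2 ^ m / 2 \<le> real (card (Kset m))" "real (card (Kset m)) \<le> l * 2 ^ m"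
      by (simp_all add: Kset_def distrib_right)
  qed
  have Kset_D: "fst p \<le> of_int k / 2 ^ m" "of_int k / 2 ^ m + 1 / 2 ^ m \<le> fst p + l" if "k \<in> Kset m" for k m
  proof -
    have "fst p * 2 ^ m \<le> of_int k" "of_int k + 1 \<le> (fst p + l) * 2 ^ m" using that unfolding Kset_def by simp_all linarith+
    then show "fst p \<le> of_int k / 2 ^ m" by (simp add: pos_le_divide_eq)
    show "of_int k / 2 ^ m + 1 / 2 ^ m \<le> fst p + l"
      unfolding add_divide_distrib[symmetric] using \<open>of_int k + 1 \<le> _\<close> by (simp add: pos_divide_le_eq)
  qed
  have sub: "sq (corner (s, x)) (half (fst s)) \<subseteq> sq p l \<inter> level_set t (fst s)" if "s \<in> S" "x \<in> X s" for s x
  proof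
    fix z assume z: "z \<in> sq (corner (s, x)) (half (fst s))"
    obtain m j where s: "s = (m, j)" by (cases s)
    obtain k i where x: "x = (k, i)" by (cases x)
    obtain z1 z2 where z12: "z = (z1, z2)" by (cases z)
    have ki: "k \<in> Kset m" "i < column_count t m" using that(2) by (auto simp: X_def s x)
    have "real (Suc i) * side2 m \<le> real (column_count t m) * side2 m" using ki(2) by (intro mult_right_mono) (auto simp: less_imp_le)
    also have "\<dots> \<le> side1 t m" using column_count_bounds(2) M(3) S_M[OF that(1)] by (simp add: s)
    finally have "real i * side2 m + side2 m \<le> side1 t m" by (simp add: algebra_simps)
    moreover have "0 \<le> real i * side2 m" by (simp add: less_imp_le)
    moreover have "of_int k / 2 ^ m + real i * side2 m \<le> z1" "z1 \<le> of_int k / 2 ^ m + real i * side2 m + side2 m / 2"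
      "of_int j / 3 ^ m \<le> z2" "z2 \<le> of_int j / 3 ^ m + half m"
      using z by (auto simp: sq_def corner_def half_def s x z12)
    ultimately have z1: "of_int k / 2 ^ m \<le> z1" "z1 < of_int k / 2 ^ m + side1 t m"
      and z2: "of_int j / 3 ^ m \<le> z2" "z2 \<le> of_int j / 3 ^ m + half m" using side2_pos[of m] by linarith+
    have "half m \<le> gap m / 2" "0 < gap m" using S_half[OF that(1)] half_pos[of m] unfolding s fst_conv by linarith+
    then have "snd p \<le> z2 \<and> z2 \<le> snd p + l" using S_range[OF that(1)] z2 by (auto simp: s Y_def)
    moreover have "fst p \<le> z1 \<and> z1 \<le> fst p + l" using Kset_D[OF ki(1)] z1 side1_le[OF t, of m] by linarith
    ultimately have *: "z \<in> sq p l" by (auto simp: sq_def z12)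
    moreover have "z2 < of_int j / 3 ^ m + side2 m" using z2 side2_pos[of m] unfolding half_def by linarith
    ultimately show "z \<in> sq p l \<inter> level_set t (fst s)"
      using level_setI[of z1 z2 k m t j] z1 z2 t inside by (auto simp: z12 s)
  qed
  have sum_w: "(\<Sum>\<tau> | \<tau> \<in> I \<and> P \<tau>. w \<tau>) = (\<Sum>s\<in>S. real (card {x \<in> X s. P (s, x)}) * (q (fst s) * half (fst s)))" for P
  proof -
    have "{\<tau> \<in> I. P \<tau>} = Sigma S (\<lambda>s. {x \<in> X s. P (s, x)})" by (auto simp: I_def)
    then have "(\<Sum>\<tau> | \<tau> \<in> I \<and> P \<tau>. w \<tau>) = (\<Sum>s\<in>S. \<Sum>x\<in>{x \<in> X s. P (s, x)}. q (fst s) * half (fst s))"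
      using \<open>finite S\<close> fin by (subst sum.Sigma) (auto simp: w_def split_beta)
    then show ?thesis by simp
  qed
  have w0: "0 \<le> w \<tau>" for \<tau> using q_nonneg by (simp add: w_def less_imp_le)
  have card_X: "real (card (X s)) * (q (fst s) * half (fst s)) \<le> l * D * gap (fst s) / 2"
    "l * D * gap (fst s) / 8 \<le> real (card (X s)) * (q (fst s) * half (fst s))" if "s \<in> S" for s
  proof -
    let ?m = "fst s"
    have m: "M \<le> ?m" "t \<le> real ?m" using S_M[OF that] M(3) by auto
    have eq: "real (card (X s)) * (q ?m * half ?m) = real (card (Kset ?m)) * (q ?m * (column_count t ?m * side2 ?m / 2))"
      by (simp add: X_def card_cartesian_product half_def)
    have "real (card (X s)) * (q ?m * half ?m) \<le> l * 2 ^ ?m * (q ?m * (side1 t ?m / 2))"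
      unfolding eq using Kset_card[OF m(1)] column_count_bounds[OF m(2)] q_nonneg l side1_pos[of t ?m]
      by (intro mult_mono mult_left_mono) (auto simp: less_imp_le)
    also have "\<dots> = l * 2 ^ ?m * (q ?m * side1 t ?m) / 2" by simp
    also have "\<dots> = l * D * gap ?m / 2" unfolding q_side1 by simp
    finally show "real (card (X s)) * (q ?m * half ?m) \<le> l * D * gap ?m / 2" .
    have "l * D * gap ?m / 8 = l * 2 ^ ?m * (q ?m * side1 t ?m) / 8" unfolding q_side1 by simp
    also have "\<dots> = l * 2 ^ ?m / 2 * (q ?m * (side1 t ?m / 2 / 2))" by simp
    also have "\<dots> \<le> real (card (X s)) * (q ?m * half ?m)"
      unfolding eq using Kset_card[OF m(1)] column_count_bounds[OF m(2)] q_nonneg l side1_pos[of t ?m]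
      by (intro mult_mono mult_left_mono divide_right_mono) (auto simp: less_imp_le)
    finally show "l * D * gap ?m / 8 \<le> real (card (X s)) * (q ?m * half ?m)" .
  qed
  have total: "K \<le> sum w I"
  proof -
    \<comment> \<open>Origin of 192: the factor 8 lost in \<open>card_X\<close> times the proportion
      \<open>1 / 24\<close> filled by the gaps.\<close>
    have "K = l * D / 8 * (l / 24)" by (simp add: K power2_eq_square)
    also have "\<dots> \<le> l * D / 8 * (\<Sum>s\<in>S. gap (fst s))" using S_sum l D by (intro mult_left_mono) auto
    also have "\<dots> = (\<Sum>s\<in>S. l * D * gap (fst s) / 8)" by (simp add: sum_distrib_left)
    also have "\<dots> \<le> (\<Sum>s\<in>S. real (card (X s)) * (q (fst s) * half (fst s)))" by (intro sum_mono card_X)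
    also have "\<dots> = sum w I" using sum_w[of "\<lambda>_. True"] by simp
    finally show ?thesis .
  qed
  have ball: "(\<Sum>\<tau> | \<tau> \<in> I \<and> hits z r \<tau>. w \<tau>) \<le> 2000 * f r"
    if r: "0 < r" "r \<le> R" and two: "\<sigma> \<in> I" "\<tau> \<in> I" "\<sigma> \<noteq> \<tau>" "hits z r \<sigma>" "hits z r \<tau>" for z r \<sigma> \<tau>
  proof (cases "r \<le> l")
    case False
    have "(\<Sum>\<tau> | \<tau> \<in> I \<and> hits z r \<tau>. w \<tau>) \<le> sum w I"
      using \<open>finite S\<close> fin w0 by (intro sum_mono2) (auto simp: I_def)
    also have "\<dots> = (\<Sum>s\<in>S. real (card (X s)) * (q (fst s) * half (fst s)))" using sum_w[of "\<lambda>_. True"] by simp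
    also have "\<dots> \<le> (\<Sum>s\<in>S. l * D * gap (fst s) / 2)" by (intro sum_mono card_X)
    also have "\<dots> = l * D / 2 * (\<Sum>s\<in>S. gap (fst s))" by (simp add: sum_distrib_left)
    also have "(\<Sum>s\<in>S. gap (fst s)) \<le> (snd p + l) - snd p"
      using \<open>finite S\<close> l gap_nonneg S_range Y_sep by (intro sum_separated_le[where y = Y]) auto
    also have "l * D / 2 * (snd p + l - snd p) = 96 * K" by (simp add: K power2_eq_square)
    also have "96 * K \<le> 2000 * f r"
    proof -
      have "1 \<le> (r / l) ^ 2" using False l by (intro one_le_power) simp
      then have "K \<le> f r" using K_le[OF r] by simp
      then show ?thesis using dimension_function_pos[OF f r(1)] by linarith
    qed
    finally show ?thesis using l D by simp
  next
    case True': True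
    have D_r: "D * r ^ 2 \<le> 192 * f r"
    proof -
      have "(r / l) ^ 2 \<le> 1" using True' l r by (intro power_le_one) auto
      then have "K * (r / l) ^ 2 \<le> f r" using K_le[OF r] by simp
      moreover have "D * r ^ 2 = 192 * (K * (r / l) ^ 2)" using l by (simp add: K power_divide)
      ultimately show ?thesis by simp
    qed
    define H where "H s = {x \<in> X s. hits z r (s, x)}" for s
    define S' where "S' = {s \<in> S. H s \<noteq> {}}"
    have finS': "finite S'" using \<open>finite S\<close> by (simp add: S'_def)
    have sum_eq: "(\<Sum>\<tau> | \<tau> \<in> I \<and> hits z r \<tau>. w \<tau>) = (\<Sum>s\<in>S'. real (card (H s)) * (q (fst s) * half (fst s)))"
      unfolding sum_w H_def[symmetric] using \<open>finite S\<close> by (intro sum.mono_neutral_right) (auto simp: S'_def)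
    have row: "real (card (H s)) * (q (fst s) * half (fst s)) \<le> 2 * row_mass t q (fst s) r"
      if "s \<in> S" "half (fst s) \<le> r" for s
    proof (rule card_hits_row[where z = z and j = "snd s"])
      show "t \<le> real (fst s)" using M(3) S_M[OF that(1)] .
      show "snd x < column_count t (fst s) \<and> hits z r ((fst s, snd s), x)" if "x \<in> H s" for x
        using that unfolding H_def X_def by (auto simp: prod.collapse)
    qed (rule t that(2) q_nonneg)+
    have Y_hit: "snd z - r / 2 - half (fst s) \<le> Y s" "Y s \<le> snd z + r / 2" if "s \<in> S'" for s
    proof -
      from that obtain x where "x \<in> H s" unfolding S'_def by blast
      then have "hits z r (s, x)" unfolding H_def by simp
      moreover have "snd (corner (s, x)) = Y s" by (simp add: corner_def Y_def split_beta)
      ultimately show "snd z - r / 2 - half (fst s) \<le> Y s" "Y s \<le> snd z + r / 2"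
        using hitsD(3,4)[of z r "(s, x)"] by simp_all
    qed
    have mem: "fst \<sigma> \<in> S'" "fst \<tau> \<in> S'"
    proof -
      have "fst \<tau> \<in> S'" if "\<tau> \<in> I" "hits z r \<tau>" for \<tau>
      proof -
        have "fst \<tau> \<in> S" "snd \<tau> \<in> X (fst \<tau>)" using that(1) unfolding I_def by auto
        moreover have "snd \<tau> \<in> H (fst \<tau>)" unfolding H_def using calculation that(2) by simp
        ultimately show ?thesis unfolding S'_def by blast
      qed
      then show "fst \<sigma> \<in> S'" "fst \<tau> \<in> S'" using two by blast+
    qed
    show ?thesis
    proof (cases "\<exists>s\<in>S'. \<exists>s'\<in>S'. s \<noteq> s'")
      case False
      define s where "s = fst \<sigma>"
      have S'_eq: "S' = {s}" "fst \<tau> = s" using False mem by (auto simp: s_def)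
      have s: "s \<in> S" using mem by (auto simp: s_def S'_def)
      let ?m = "fst s"
      \<comment> \<open>Corners of two squares in one row are at least \<open>side2 ?m\<close>
        apart, so a ball meeting both has diameter at least \<open>half ?m\<close>.\<close>
      have "side2 ?m \<le> r + half ?m"
      proof -
        have "t \<le> real ?m" using M(3) S_M[OF s] by simp
        moreover have "snd \<sigma> \<noteq> snd \<tau>" using two(3) S'_eq by (auto simp: s_def prod_eq_iff)
        moreover have "snd (snd \<sigma>) < column_count t ?m" "snd (snd \<tau>) < column_count t ?m"
          using two(1,2) S'_eq by (auto simp: s_def I_def X_def)
        ultimately have "side2 ?m \<le> \<bar>fst (corner ((?m, snd s), (fst (snd \<sigma>), snd (snd \<sigma>))))
            - fst (corner ((?m, snd s), (fst (snd \<tau>), snd (snd \<tau>))))\<bar>"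
          using t by (intro corner_separated) (auto simp: prod_eq_iff)
        moreover have "(s, snd \<tau>) = \<tau>" "(s, snd \<sigma>) = \<sigma>" by (simp_all add: prod_eq_iff S'_eq s_def)
        ultimately have "side2 ?m \<le> \<bar>fst (corner \<sigma>) - fst (corner \<tau>)\<bar>" by simp
        then show ?thesis
          using hitsD(1,2)[OF two(4)] hitsD(1,2)[OF two(5)] unfolding S'_eq(2) s_def[symmetric] by linarith
      qed
      then have h: "half ?m \<le> r" by (simp add: half_def)
      have "row_mass t q ?m r \<le> 1000 * f r"
      proof (cases "r < 1 / 2 ^ ?m")
        case True
        then show ?thesis using single[OF h r(2)] by (simp add: row_mass_def)
      next
        case False
        have "row_mass t q ?m r = q ?m * side1 t ?m * 2 ^ ?m * r" using False by (simp add: row_mass_def)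
        also have "\<dots> = D * (gap ?m * r)" unfolding q_side1 by simp
        also have "gap ?m \<le> 1 / 3 ^ ?m" using gap_le by (simp add: gap_def)
        also have "1 / 3 ^ ?m \<le> (1 / 2 ^ ?m :: real)" by (intro divide_left_mono power_mono) auto
        also have "1 / 2 ^ ?m \<le> r" using False by simp
        finally have "row_mass t q ?m r \<le> D * (r * r)" using D r by simp
        then show ?thesis using D_r dimension_function_pos[OF f r(1)] by (simp add: power2_eq_square)
      qed
      then show ?thesis unfolding sum_eq S'_eq using row[OF s h] by simp
    next
      case True
      \<comment> \<open>The heights of two rows that are hit differ by at most \<open>r\<close> plus
        the side of the lower square, which is at most an eighth of its gap. Comparing with half the
        sum of both gaps gives \<open>3 / 8 * gap \<le> r\<close> in the worst case.\<close>
      have S'_bounds: "gap (fst s) \<le> 8 / 3 * r \<and> half (fst s) \<le> r / 3" if "s \<in> S'" for s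
      proof -
        obtain s' where s': "s' \<in> S'" "s \<noteq> s'" using True that by metis
        have SS: "s \<in> S" "s' \<in> S" using that s' by (auto simp: S'_def)
        show ?thesis
          using Y_sep[OF SS s'(2)] Y_hit[OF that] Y_hit[OF s'(1)] S_half[OF SS(1)] S_half[OF SS(2)] gap_nonneg[of "fst s"] gap_nonneg[of "fst s'"]
          by (simp add: abs_if split: if_splits)
      qed
      \<comment> \<open>A window of half-width \<open>5 / 2 * r\<close> contains all the gap
        intervals, because \<open>r / 2 + r / 3 + 4 / 3 * r \<le> 5 / 2 * r\<close>.\<close>
      have "(\<Sum>s\<in>S'. gap (fst s)) \<le> (snd z + 5 / 2 * r) - (snd z - 5 / 2 * r)"
      proof (rule sum_separated_le[where y = Y])
        fix s assume s: "s \<in> S'"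
        show "snd z - 5 / 2 * r \<le> Y s - gap (fst s) / 2 \<and> Y s + gap (fst s) / 2 \<le> snd z + 5 / 2 * r"
          using S'_bounds[OF s] Y_hit[OF s] r(1) by simp
      qed (use finS' r gap_nonneg Y_sep in \<open>auto simp: S'_def\<close>)
      then have gap_sum: "(\<Sum>s\<in>S'. gap (fst s)) \<le> 5 * r" by simp
      have "(\<Sum>s\<in>S'. row_mass t q (fst s) r) \<le> 1000 * f r"
      proof (rule multi[folded gap_def, OF r True' finS' _ gap_sum])
        fix m j assume mj: "(m, j) \<in> S'"
        then have "(m, j) \<in> S" by (simp add: S'_def)
        then show "N1 \<le> m \<and> 0 < q m \<and> gap m \<le> 3 * r \<and> half m \<le> r"
          using S'_bounds[OF mj] r(1) S_M M(2) S_q by fastforce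
      next
        fix m assume rm: "r < 1 / 3 ^ m"
        let ?J = "{j. (m, j) \<in> S'}"
        \<comment> \<open>The count stays below \<open>1 + 1 / 2 + 1\<close>, hence is at most
          2.\<close>
        have "real (card ?J) \<le> (snd z + r / 2 - (snd z - r / 2 - half m)) / (1 / 3 ^ m) + 1"
        proof (rule card_separated_le[where g = "\<lambda>j. of_int j / 3 ^ m"])
          fix j j' :: int assume "j \<noteq> j'"
          then have "1 \<le> \<bar>j - j'\<bar>" by linarith
          then have "(1::real) \<le> \<bar>of_int j - of_int j'\<bar>" by linarith
          then show "(1::real) / 3 ^ m \<le> \<bar>of_int j / 3 ^ m - of_int j' / 3 ^ m\<bar>"
            by (simp add: diff_divide_distrib[symmetric] abs_divide divide_right_mono)
        next
          fix j assume "j \<in> ?J"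
          then show "snd z - r / 2 - half m \<le> of_int j / 3 ^ m \<and> of_int j / 3 ^ m \<le> snd z + r / 2"
            using Y_hit[of "(m, j)"] by (simp add: Y_def)
        qed (use r less_imp_le[OF half_pos, of m] in auto)
        also have "\<dots> = r * 3 ^ m + half m * 3 ^ m + 1" by (simp add: algebra_simps)
        also have "r * 3 ^ m < 1" using rm by (simp add: pos_less_divide_eq)
        also have "half m * 3 ^ m \<le> 1 / 2" using half_le(1)[of m] by (simp add: pos_le_divide_eq)
        finally show "card ?J \<le> 2" by linarith
      qed
      then have "(\<Sum>s\<in>S'. 2 * row_mass t q (fst s) r) \<le> 2000 * f r" by (simp add: sum_distrib_left[symmetric])
      moreover have "(\<Sum>s\<in>S'. real (card (H s)) * (q (fst s) * half (fst s))) \<le> (\<Sum>s\<in>S'. 2 * row_mass t q (fst s) r)"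
        using S'_bounds r(1) by (intro sum_mono row) (fastforce simp: S'_def)+
      ultimately show ?thesis unfolding sum_eq by linarith
    qed
  qed
  show ?thesis
    unfolding spread_def
  proof (intro exI[of _ I] exI[of _ w] conjI ballI allI impI)
    show "finite I" using \<open>finite S\<close> fin by (auto simp: I_def)
    show "K \<le> sum w I" by (rule total)
    fix \<tau> assume "\<tau> \<in> I"
    then have s: "fst \<tau> \<in> S" "snd \<tau> \<in> X (fst \<tau>)" by (auto simp: I_def)
    show "N \<le> (fst \<circ> fst) \<tau>" using S_M[OF s(1)] M(1) by simp
    show "sq (corner \<tau>) (half ((fst \<circ> fst) \<tau>)) \<subseteq> sq p l \<inter> level_set t ((fst \<circ> fst) \<tau>)"
      using sub[OF s] by simp
    show "0 \<le> w \<tau>" by (rule w0)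
    show "w \<tau> \<le> f (half ((fst \<circ> fst) \<tau>))" using q_le by (simp add: w_def)
  next
    fix z r assume *: "0 < r \<and> r \<le> R \<and>
        (\<exists>\<sigma>\<in>I. \<exists>\<tau>\<in>I. \<sigma> \<noteq> \<tau> \<and> max_ball z (r / 2) \<inter> sq (corner \<sigma>) (half ((fst \<circ> fst) \<sigma>)) \<noteq> {} \<and>
           max_ball z (r / 2) \<inter> sq (corner \<tau>) (half ((fst \<circ> fst) \<tau>)) \<noteq> {})"
    then have "\<exists>\<sigma>\<in>I. \<exists>\<tau>\<in>I. \<sigma> \<noteq> \<tau> \<and> hits z r \<sigma> \<and> hits z r \<tau>" by (simp add: hits_def)
    then obtain \<sigma> \<tau> where "\<sigma> \<in> I" "\<tau> \<in> I" "\<sigma> \<noteq> \<tau>" "hits z r \<sigma>" "hits z r \<tau>" by blast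
    with ball[of r \<sigma> \<tau> z] * show "(\<Sum>\<tau> | \<tau> \<in> I \<and> max_ball z (r / 2) \<inter> sq (corner \<tau>) (half ((fst \<circ> fst) \<tau>)) \<noteq> {}. w \<tau>) \<le> 2000 * f r"
      by (simp add: hits_def)
  qed
qed

text \<open>The squares of one level are rich enough if, for every density \<open>D\<close> that balls of diameter \<open>r \<le> l\<close>
  can afford, there are weights to which \<open>spread_rows\<close> applies.\<close>

definition rich :: "real \<Rightarrow> (real \<Rightarrow> real) \<Rightarrow> bool" where
  "rich t f \<longleftrightarrow> (\<forall>D l R. 0 < D \<and> 0 < l \<and> 0 < R \<and> R \<le> 1 \<and> (\<forall>r. 0 < r \<and> r \<le> R \<and> r \<le> l \<longrightarrow> D * r ^ 2 \<le> 192 * f r) \<longrightarrow>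
     (\<exists>q N. row_weights t D f q \<and>
       (\<forall>m r. half m \<le> r \<and> r \<le> R \<and> r < 1 / 2 ^ m \<longrightarrow> q m * min (side1 t m) r \<le> 1000 * f r) \<and>
       (\<forall>r S. 0 < r \<and> r \<le> R \<and> r \<le> l \<and> finite S \<and>
          (\<forall>m j. (m, j) \<in> S \<longrightarrow> N \<le> m \<and> 0 < q m \<and> q m * exp (- (real m * t)) / D \<le> 3 * r \<and> half m \<le> r) \<and>
          (\<Sum>s\<in>S. q (fst s) * exp (- (real (fst s) * t)) / D) \<le> 5 * r \<and>
          (\<forall>m. r < 1 / 3 ^ m \<longrightarrow> card {j::int. (m, j) \<in> S} \<le> 2) \<longrightarrow>
          (\<Sum>s\<in>S. row_mass t q (fst s) r) \<le> 1000 * f r)))"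

text \<open>\<open>D\<close> is the density of total weight \<open>K\<close> on the square, enlarged
  by the factor 192 that \<open>spread_rows\<close> loses. For \<open>r \<le> l\<close> the bound
  \<open>K_le\<close> then becomes the affordability condition in \<open>rich\<close>.\<close>

lemma rich_spread:
  assumes "rich t f" and t: "0 \<le> t" and f: "dimension_function f" and l: "0 < l" and K: "0 < K" and R: "0 < R" "R \<le> 1"
    and inside: "sq p l \<subseteq> {0..<1} \<times> {0..<1}"
    and K_le: "\<And>r. 0 < r \<Longrightarrow> r \<le> R \<Longrightarrow> K * min 1 ((r / l) ^ 2) \<le> f r"
  shows "spread f (level_set t) half (fst \<circ> fst) corner 2000 R N p l K"
proof -
  define D where "D = 192 * K / l ^ 2"
  have D: "0 < D" and K_eq: "K = D * l ^ 2 / 192" using K l by (simp_all add: D_def)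
  have "D * r ^ 2 \<le> 192 * f r" if "0 < r" "r \<le> R" "r \<le> l" for r
  proof -
    have "(r / l) ^ 2 \<le> 1" using that l by (intro power_le_one) auto
    then have "K * (r / l) ^ 2 \<le> f r" using K_le[OF that(1,2)] by simp
    moreover have "D * r ^ 2 = 192 * (K * (r / l) ^ 2)" using l by (simp add: D_def power_divide)
    ultimately show ?thesis by simp
  qed
  then obtain q N1 where q: "row_weights t D f q"
    and single: "\<forall>m r. half m \<le> r \<and> r \<le> R \<and> r < 1 / 2 ^ m \<longrightarrow> q m * min (side1 t m) r \<le> 1000 * f r"
    and multi: "\<forall>r S. 0 < r \<and> r \<le> R \<and> r \<le> l \<and> finite S \<and>
          (\<forall>m j. (m, j) \<in> S \<longrightarrow> N1 \<le> m \<and> 0 < q m \<and> q m * exp (- (real m * t)) / D \<le> 3 * r \<and> half m \<le> r) \<and>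
          (\<Sum>s\<in>S. q (fst s) * exp (- (real (fst s) * t)) / D) \<le> 5 * r \<and>
          (\<forall>m. r < 1 / 3 ^ m \<longrightarrow> card {j::int. (m, j) \<in> S} \<le> 2) \<longrightarrow>
          (\<Sum>s\<in>S. row_mass t q (fst s) r) \<le> 1000 * f r"
    using assms(1)[unfolded rich_def, rule_format, of D l R] D l R by blast
  show ?thesis
  proof (rule spread_rows[OF t D q f l inside K_eq K_le])
    show "q m * min (side1 t m) r \<le> 1000 * f r" if "half m \<le> r" "r \<le> R" "r < 1 / 2 ^ m" for m r
      using single that by blast
    show "(\<Sum>s\<in>S. row_mass t q (fst s) r) \<le> 1000 * f r"
      if "0 < r" "r \<le> R" "r \<le> l" "finite S"
        "\<And>m j. (m, j) \<in> S \<Longrightarrow> N1 \<le> m \<and> 0 < q m \<and> q m * exp (- (real m * t)) / D \<le> 3 * r \<and> half m \<le> r"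
        "(\<Sum>s\<in>S. q (fst s) * exp (- (real (fst s) * t)) / D) \<le> 5 * r" "\<And>m. r < 1 / 3 ^ m \<Longrightarrow> card {j::int. (m, j) \<in> S} \<le> 2" for r S
      by (rule multi[rule_format]) (use that in simp)
  qed
qed

text \<open>On the first square \<open>K\<close> is arbitrary, because \<open>big\<close> lets
  \<open>f\<close> dominate every multiple of \<open>r ^ 2\<close>; on later squares the demand
  \<open>f (half m)\<close> is affordable by \<open>f \<preceq> pow_fun 2\<close>. The lower bound
  \<open>K / 2000\<close> is therefore unlimited.\<close>

lemma hausdorff_measure_W2_star_eq_top:
  assumes "rich t f" and t: "0 \<le> t" and f: "dimension_function f" "f \<preceq> pow_fun 2"
    and big: "\<And>K. 0 < K \<Longrightarrow> \<exists>\<eta>>0. \<forall>r. 0 < r \<and> r \<le> \<eta> \<longrightarrow> K * r ^ 2 \<le> f r"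
  shows "hausdorff_measure f (W2_star t) = \<infinity>"
proof -
  have ge: "ennreal (K / 2000) \<le> hausdorff_measure f (W2_star t)" if K: "0 < K" for K
  proof -
    \<comment> \<open>The factor 4 accounts for the starting square of side \<open>1 / 2\<close>, a
      closed square inside \<open>{0..<1} \<times> {0..<1}\<close>.\<close>
    obtain \<eta>0 where \<eta>0: "0 < \<eta>0" "\<And>r. 0 < r \<Longrightarrow> r \<le> \<eta>0 \<Longrightarrow> 4 * K * r ^ 2 \<le> f r" using big[of "4 * K"] K by auto
    define \<eta> where "\<eta> = min \<eta>0 1"
    have \<eta>: "0 < \<eta>" "\<eta> \<le> 1" using \<eta>0 by (auto simp: \<eta>_def)
    have "ennreal (K / 2000) \<le> hausdorff_content f \<eta> {x. \<exists>\<^sub>\<infinity>n. x \<in> level_set t n}"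
    proof (rule hausdorff_content_ge_of_spread[OF f(1) _ half_pos half_tendsto_0 K])
      show "spread f (level_set t) half (fst \<circ> fst) corner 2000 \<eta> 0 (0, 0) (1 / 2) K"
      proof (rule rich_spread[OF assms(1) t f(1) _ K \<eta>])
        show "K * min 1 ((r / (1 / 2)) ^ 2) \<le> f r" if "0 < r" "r \<le> \<eta>" for r
        proof -
          have "K * min 1 ((r / (1 / 2)) ^ 2) \<le> K * (4 * r ^ 2)" using K by (intro mult_left_mono) (auto simp: power_mult_distrib)
          also have "\<dots> \<le> f r" using \<eta>0(2)[of r] that by (simp add: \<eta>_def mult_ac)
          finally show ?thesis .
        qed
      qed (auto simp: sq_def)
      fix N p m assume sub: "sq p (half m) \<subseteq> level_set t m"
      show "spread f (level_set t) half (fst \<circ> fst) corner 2000 \<eta> N p (half m) (f (half m))"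
      proof (rule rich_spread[OF assms(1) t f(1) half_pos _ \<eta>])
        show "sq p (half m) \<subseteq> {0..<1} \<times> {0..<1}" using sub by (auto simp: level_set_def)
        show "f (half m) * min 1 ((r / half m) ^ 2) \<le> f r" if "0 < r" for r
        proof (cases "r \<le> half m")
          case True
          have "f (half m) / half m powr 2 \<le> f r / r powr 2" using preceq_powD[OF f(2) that True] .
          then have "f (half m) / half m ^ 2 * r ^ 2 \<le> f r / r ^ 2 * r ^ 2"
            using that by (intro mult_right_mono) (simp_all add: powr_numeral less_imp_le)
          then have "f (half m) * (r / half m) ^ 2 \<le> f r" using that by (simp add: power_divide)
          moreover have "f (half m) * min 1 ((r / half m) ^ 2) \<le> f (half m) * (r / half m) ^ 2"
            using dimension_function_pos[OF f(1) half_pos, of m] by (intro mult_left_mono) auto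
          ultimately show ?thesis by simp
        next
          case False
          have "f (half m) * min 1 ((r / half m) ^ 2) \<le> f (half m) * 1"
            using dimension_function_pos[OF f(1) half_pos, of m] by (intro mult_left_mono) auto
          also have "\<dots> \<le> f r" using dimension_function_mono[OF f(1), of "half m" r] False half_pos[of m] by simp
          finally show ?thesis .
        qed
      qed (use dimension_function_pos[OF f(1)] in auto)
    qed simp
    also have "\<dots> \<le> hausdorff_measure f (W2_star t)"
      unfolding hausdorff_measure_eq_SUP W2_star_eq using \<eta> by (intro SUP_upper) auto
    finally show ?thesis .
  qed
  show ?thesis
  proof (rule ccontr)
    assume "hausdorff_measure f (W2_star t) \<noteq> \<infinity>"
    then obtain c where c: "0 \<le> c" "hausdorff_measure f (W2_star t) = ennreal c"
      by (metis enn2real_nonneg ennreal_enn2real infinity_ennreal_def top.not_eq_extremum)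
    have "ennreal (2000 * (c + 1) / 2000) \<le> ennreal c" using ge[of "2000 * (c + 1)"] c by simp
    then show False using c by (simp add: ennreal_le_iff)
  qed
qed

section \<open>Choice of the weights\<close>

text \<open>If the truncated series converged, its terms would eventually lie below
  \<open>c\<close>, where nothing is truncated. With \<open>c = 1\<close> this allows the cap
  \<open>1 / 3 ^ m\<close> on the gaps.\<close>

lemma not_summable_min:
  fixes p :: "nat \<Rightarrow> real"
  assumes "\<not> summable p" "\<And>m. 0 \<le> p m" "0 < c"
  shows "\<not> summable (\<lambda>m. min (p m) c)"
proof
  assume *: "summable (\<lambda>m. min (p m) c)"
  then have "(\<lambda>m. min (p m) c) \<longlonglongrightarrow> 0" by (rule summable_LIMSEQ_zero)
  then have "\<forall>\<^sub>F m in sequentially. min (p m) c < c" by (rule order_tendstoD(2)) (rule assms(3))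
  then have "\<forall>\<^sub>F m in sequentially. min (p m) c = p m" by eventually_elim auto
  then show False using * assms(1) by (simp add: summable_cong)
qed

text \<open>The dropped terms are dominated by a convergent series.\<close>

lemma not_summable_drop:
  fixes p e :: "nat \<Rightarrow> real"
  assumes "\<not> summable p" "\<And>m. 0 \<le> p m" "summable e" "\<And>m. 0 \<le> e m"
  shows "\<not> summable (\<lambda>m. if e m \<le> p m then p m else 0)"
proof
  assume "summable (\<lambda>m. if e m \<le> p m then p m else 0)"
  then have "summable (\<lambda>m. (if e m \<le> p m then p m else 0) + e m)" using assms(3) by (rule summable_add)
  then have "summable p"
    by (rule summable_comparison_test'[where N = 0]) (use assms(2,4) in auto)
  with assms(1) show False ..
qed

lemma summable_exp_uminus_square: "summable (\<lambda>m. exp (- (real m ^ 2)))"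
proof -
  have "summable (\<lambda>m. exp (- 1) ^ m :: real)" by (rule summable_geometric) simp
  then show ?thesis
  proof (rule summable_comparison_test'[where N = 0])
    fix m :: nat
    have "real m \<le> real m ^ 2" by (cases m) (simp_all add: power2_eq_square)
    then show "norm (exp (- (real m ^ 2))) \<le> exp (- 1) ^ m" by (simp flip: exp_of_nat_mult)
  qed
qed

text \<open>Levels whose gaps are not much larger than their squares are discarded. Their contribution to the series is
  bounded by that of \<open>exp (- (m\<^sup>2))\<close>.\<close>

definition keep :: "real \<Rightarrow> real \<Rightarrow> (nat \<Rightarrow> real) \<Rightarrow> nat \<Rightarrow> real" where
  "keep t D \<phi> m = (if t \<le> real m \<and> 8 * half m \<le> \<phi> m * exp (- (real m * t)) / D then \<phi> m else 0)"

lemma keep_cases: "keep t D \<phi> m = 0 \<or> (t \<le> real m \<and> keep t D \<phi> m = \<phi> m)"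
  by (simp add: keep_def)

lemma row_weights_keep:
  assumes D: "0 < D" and f: "dimension_function f" and \<phi>: "\<And>m. 0 \<le> \<phi> m"
    and le: "\<And>m. t \<le> real m \<Longrightarrow> \<phi> m * half m \<le> f (half m)"
    and gap: "\<And>m. \<phi> m * exp (- (real m * t)) / D \<le> 1 / 3 ^ m"
    and div: "\<not> summable (\<lambda>m. \<phi> m * exp (- (real m * t)) / D * 3 ^ m)"
  shows "row_weights t D f (keep t D \<phi>)"
  unfolding row_weights_def
proof (intro conjI allI impI)
  fix m
  show "0 \<le> keep t D \<phi> m" using \<phi> by (simp add: keep_def)
  show "keep t D \<phi> m * half m \<le> f (half m)"
    using le dimension_function_pos[OF f half_pos, of m] by (simp add: keep_def)
  show "keep t D \<phi> m * exp (- (real m * t)) / D \<le> 1 / 3 ^ m" using gap by (simp add: keep_def)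
  show "8 * half m \<le> keep t D \<phi> m * exp (- (real m * t)) / D" if "0 < keep t D \<phi> m"
    using that by (simp add: keep_def split: if_splits)
next
  let ?p = "\<lambda>m. \<phi> m * exp (- (real m * t)) / D * 3 ^ m"
  let ?e = "\<lambda>m. 4 * exp (- (real m ^ 2))"
  have "\<not> summable (\<lambda>m. if ?e m \<le> ?p m then ?p m else 0)"
    using div \<phi> D by (intro not_summable_drop summable_mult summable_exp_uminus_square) simp_all
  moreover have "\<forall>\<^sub>F m in sequentially. (if ?e m \<le> ?p m then ?p m else 0) = keep t D \<phi> m * exp (- (real m * t)) / D * 3 ^ m"
    using eventually_ge_at_top[of "nat \<lceil>t\<rceil>"]
  proof eventually_elim
    case (elim m)
    then have "t \<le> real m" by linarith
    moreover have "8 * half m = ?e m / 3 ^ m" by (simp add: half_def side2_def)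
    ultimately show ?case by (simp add: keep_def pos_divide_le_eq)
  qed
  ultimately show "\<not> summable (\<lambda>m. keep t D \<phi> m * exp (- (real m * t)) / D * 3 ^ m)"
    by (simp add: summable_cong)
qed

text \<open>The averaged density \<open>D * gap\<close> of a row bounds the mass once the length is
  rounded up to a full period; this is the origin of the maximum.\<close>

lemma row_mass_le:
  assumes "0 \<le> q m" "0 < D"
  shows "row_mass t q m r \<le> D * (q m * exp (- (real m * t)) / D) * max r (1 / 2 ^ m)"
proof -
  have "row_mass t q m r \<le> q m * (side1 t m * 2 ^ m * max r (1 / 2 ^ m))"
    unfolding row_mass_def using assms(1) side1_pos[of t m]
    by (intro mult_left_mono) (auto simp: max_def)
  also have "\<dots> = D * (q m * exp (- (real m * t)) / D) * max r (1 / 2 ^ m)"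
    using assms(2) by (simp add: side1_def)
  finally show ?thesis .
qed

section \<open>Weights when \<open>f \<preceq> pow_fun 1\<close>\<close>

lemma preceq_one_divide_le:
  assumes "f \<preceq> pow_fun 1" "0 < x" "x \<le> y"
  shows "f y / y \<le> f x / x"
  using preceq_powD[OF assms] assms(2,3) by simp

text \<open>As \<open>f r / r\<close> is nonincreasing, the density
  \<open>f (side1 t m) / side1 t m\<close> within a rectangle is affordable for every ball: one with
  \<open>r \<le> side1 t m\<close> has the larger ratio, and a longer one costs at least
  \<open>f (side1 t m)\<close>, the mass of the whole rectangle up to a constant.\<close>

lemma rich_of_preceq_one:
  assumes t: "0 \<le> t" and f: "dimension_function f" "f \<preceq> pow_fun 1"
    and div: "\<not> summable (\<lambda>m. f (side1 t m) * 6 ^ m)"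
  shows "rich t f"
  unfolding rich_def
proof (intro allI impI, elim conjE)
  fix D l R :: real
  assume D: "0 < D" and l: "0 < l" and R: "0 < R" "R \<le> 1"
    and Dr: "\<forall>r. 0 < r \<and> r \<le> R \<and> r \<le> l \<longrightarrow> D * r ^ 2 \<le> 192 * f r"
  have fpos: "0 < f r" if "0 < r" for r using dimension_function_pos[OF f(1) that] .
  \<comment> \<open>The second entry of the minimum is the weight whose gap is exactly
    \<open>1 / 3 ^ m\<close>.\<close>
  define \<phi> where "\<phi> m = min (f (side1 t m) / side1 t m) (D * exp (real m * t) / 3 ^ m)" for m
  define q where "q = keep t D \<phi>"
  have \<phi>0: "0 \<le> \<phi> m" for m using fpos[of "side1 t m"] D by (simp add: \<phi>_def less_imp_le)
  have \<phi>_le: "\<phi> m \<le> f (side1 t m) / side1 t m" for m by (simp add: \<phi>_def)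
  have q0: "0 \<le> q m" for m using \<phi>0 by (simp add: q_def keep_def)
  have q_le: "q m \<le> f (side1 t m) / side1 t m" for m
    using keep_cases[of t D \<phi> m] \<phi>_le[of m] \<phi>0[of m] unfolding q_def by auto
  have rw: "row_weights t D f q"
    unfolding q_def
  proof (rule row_weights_keep[OF D f(1) \<phi>0])
    fix m assume m: "t \<le> real m"
    have "half m \<le> side1 t m" using side2_le_side1[OF m] side2_pos[of m] unfolding half_def by linarith
    then have "\<phi> m \<le> f (half m) / half m"
      using \<phi>_le[of m] preceq_one_divide_le[OF f(2) half_pos, of m "side1 t m"] by linarith
    then show "\<phi> m * half m \<le> f (half m)" by (simp add: pos_le_divide_eq)
  next
    fix m
    have "\<phi> m * exp (- (real m * t)) / D \<le> (D * exp (real m * t) / 3 ^ m) * exp (- (real m * t)) / D"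
      using D by (intro divide_right_mono mult_right_mono) (auto simp: \<phi>_def)
    also have "\<dots> = 1 / 3 ^ m" using D by (simp add: exp_minus)
    finally show "\<phi> m * exp (- (real m * t)) / D \<le> 1 / 3 ^ m" .
  next
    have eq: "\<phi> m * exp (- (real m * t)) / D * 3 ^ m = min (f (side1 t m) * 6 ^ m / D) 1" for m
    proof -
      let ?c = "exp (- (real m * t)) / D * 3 ^ m"
      have c: "0 \<le> ?c" using D by simp
      have "\<phi> m * exp (- (real m * t)) / D * 3 ^ m = \<phi> m * ?c" by simp
      also have "\<dots> = min (f (side1 t m) / side1 t m * ?c) (D * exp (real m * t) / 3 ^ m * ?c)"
        unfolding \<phi>_def using min_mult_distrib_right[of "f (side1 t m) / side1 t m" "D * exp (real m * t) / 3 ^ m" ?c] c by simp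
      also have "D * exp (real m * t) / 3 ^ m * ?c = 1" using D by (simp add: exp_minus)
      also have "f (side1 t m) / side1 t m * ?c = f (side1 t m) * 6 ^ m / D"
      proof -
        have "(6::real) ^ m = 2 ^ m * 3 ^ m" by (simp flip: power_mult_distrib)
        then show ?thesis by (simp add: side1_def)
      qed
      finally show ?thesis .
    qed
    have "\<not> summable (\<lambda>m. f (side1 t m) * 6 ^ m / D)"
      using div D summable_mult[of "\<lambda>m. f (side1 t m) * 6 ^ m / D" D] by auto
    then show "\<not> summable (\<lambda>m. \<phi> m * exp (- (real m * t)) / D * 3 ^ m)"
      unfolding eq using fpos[of "side1 t _"] D by (intro not_summable_min) (auto simp: less_imp_le)
  qed
  \<comment> \<open>From level \<open>N\<close> on
    \<open>D / 2 ^ m \<le> f l / l \<le> f r / r\<close>, so rounding \<open>r\<close> up to a full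
    horizontal period is affordable and only the gap total \<open>5 * r\<close> matters.\<close>
  obtain N where "D * l / f l < 2 ^ N" using real_arch_pow[of 2 "D * l / f l"] by auto
  then have N: "D / 2 ^ N \<le> f l / l" using fpos[OF l] l by (simp add: field_simps)
  have single: "q m * min (side1 t m) r \<le> 1000 * f r" if "half m \<le> r" for m r
  proof -
    have r: "0 < r" using that half_pos[of m] by linarith
    have "q m * min (side1 t m) r \<le> f r"
    proof (cases "r \<le> side1 t m")
      case True
      have "q m \<le> f r / r" using q_le[of m] preceq_one_divide_le[OF f(2) r True] by linarith
      then show ?thesis using True r by (simp add: pos_le_divide_eq)
    next
      case False
      have "q m * side1 t m \<le> f (side1 t m)" using q_le[of m] by (simp add: pos_le_divide_eq)
      also have "\<dots> \<le> f r" using False by (intro dimension_function_mono[OF f(1)]) (auto simp: less_imp_le)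
      finally show ?thesis using False by simp
    qed
    then show ?thesis using fpos[OF r] by linarith
  qed
  have multi: "(\<Sum>s\<in>S. row_mass t q (fst s) r) \<le> 1000 * f r"
    if r: "0 < r" "r \<le> R" "r \<le> l" and "finite S" and S: "\<And>m j. (m, j) \<in> S \<Longrightarrow> N \<le> m"
      and sum: "(\<Sum>s\<in>S. q (fst s) * exp (- (real (fst s) * t)) / D) \<le> 5 * r"
    for r and S :: "(nat \<times> int) set"
  proof -
    have "D * max r (1 / 2 ^ N) \<le> 193 * (f r / r)"
    proof -
      have "D * r \<le> 192 * (f r / r)" using Dr r by (simp add: pos_le_divide_eq power2_eq_square mult.assoc)
      moreover have "D * (1 / 2 ^ N) \<le> f r / r" using N preceq_one_divide_le[OF f(2) r(1,3)] by simp
      moreover have "0 < f r / r" using fpos r by simp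
      ultimately show ?thesis by (auto simp: max_def)
    qed
    have "(\<Sum>s\<in>S. row_mass t q (fst s) r) \<le> (\<Sum>s\<in>S. q (fst s) * exp (- (real (fst s) * t)) / D * (D * max r (1 / 2 ^ N)))"
    proof (rule sum_mono)
      fix s assume "s \<in> S"
      then have "N \<le> fst s" using S[of "fst s" "snd s"] by simp
      then have "1 / 2 ^ fst s \<le> (1 / 2 ^ N :: real)" by (intro divide_left_mono power_increasing) auto
      then have "max r (1 / 2 ^ fst s) \<le> max r (1 / 2 ^ N)" by auto
      then have "D * (q (fst s) * exp (- (real (fst s) * t)) / D) * max r (1 / 2 ^ fst s)
          \<le> D * (q (fst s) * exp (- (real (fst s) * t)) / D) * max r (1 / 2 ^ N)"
        using D q0 by (intro mult_left_mono) simp_all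
      with row_mass_le[where q = q and m = "fst s" and t = t and r = r, OF q0 D]
      have "row_mass t q (fst s) r \<le> D * (q (fst s) * exp (- (real (fst s) * t)) / D) * max r (1 / 2 ^ N)"
        by linarith
      then show "row_mass t q (fst s) r \<le> q (fst s) * exp (- (real (fst s) * t)) / D * (D * max r (1 / 2 ^ N))"
        by (simp only: mult_ac)
    qed
    also have "\<dots> = (\<Sum>s\<in>S. q (fst s) * exp (- (real (fst s) * t)) / D) * (D * max r (1 / 2 ^ N))"
      by (simp add: sum_distrib_right)
    also have "\<dots> \<le> (5 * r) * (193 * (f r / r))"
      by (rule mult_mono[OF sum \<open>D * max r (1 / 2 ^ N) \<le> _\<close>]) (use r D in auto)
    also have "\<dots> = 965 * f r" using r by simp
    finally show ?thesis using fpos[OF r(1)] by linarith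
  qed
  show "\<exists>q N. row_weights t D f q \<and>
       (\<forall>m r. half m \<le> r \<and> r \<le> R \<and> r < 1 / 2 ^ m \<longrightarrow> q m * min (side1 t m) r \<le> 1000 * f r) \<and>
       (\<forall>r S. 0 < r \<and> r \<le> R \<and> r \<le> l \<and> finite S \<and>
          (\<forall>m j. (m, j) \<in> S \<longrightarrow> N \<le> m \<and> 0 < q m \<and> q m * exp (- (real m * t)) / D \<le> 3 * r \<and> half m \<le> r) \<and>
          (\<Sum>s\<in>S. q (fst s) * exp (- (real (fst s) * t)) / D) \<le> 5 * r \<and>
          (\<forall>m. r < 1 / 3 ^ m \<longrightarrow> card {j::int. (m, j) \<in> S} \<le> 2) \<longrightarrow>
          (\<Sum>s\<in>S. row_mass t q (fst s) r) \<le> 1000 * f r)"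
    by (intro exI[of _ q] exI[of _ N] conjI allI impI rw; (elim conjE)?; rule single multi; blast)
qed

text \<open>The exponent for which \<open>(3 ^ (-m)) powr crit = 2 ^ (-m)\<close>: it compares the vertical with the horizontal spacing of
  the rectangles.\<close>

definition crit :: real where "crit = ln 2 / ln 3"

section \<open>Weights when \<open>pow_fun 1 \<preceq> f\<close>\<close>

lemma crit_bounds: "0 < crit" "crit \<le> 1"
  by (simp_all add: crit_def)

lemma powr_crit: "(1 / 3 ^ m) powr crit = 1 / 2 ^ m"
proof -
  have "(3::real) powr crit = 2" by (simp add: powr_def crit_def)
  then have "((3::real) ^ m) powr crit = 2 ^ m"
    by (metis powr_powr powr_realpow mult.commute zero_less_numeral)
  then show ?thesis by (simp add: powr_divide)
qed

lemma side2_antimono: "m \<le> n \<Longrightarrow> side2 n \<le> side2 m"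
  unfolding side2_def by (intro frac_le power_increasing) (auto intro: power_mono)

lemma half_antimono: "m \<le> n \<Longrightarrow> half n \<le> half m"
  using side2_antimono by (simp add: half_def)

text \<open>Each level at least halves \<open>side1\<close>, so the sum is at most twice its largest
  term, which is below \<open>r\<close>.\<close>

lemma sum_side1_le:
  assumes t: "0 \<le> t" and F: "finite F" "\<And>m. m \<in> F \<Longrightarrow> side1 t m < r" and "0 < r"
  shows "(\<Sum>m\<in>F. side1 t m) \<le> 2 * r"
proof (cases "F = {}")
  case False
  define n where "n = Min F"
  have n: "n \<in> F" "\<And>m. m \<in> F \<Longrightarrow> n \<le> m" using F(1) False by (auto simp: n_def)
  have le: "side1 t m \<le> r * (1 / 2) ^ (m - n)" if "m \<in> F" for m
  proof -
    obtain k where m: "m = n + k" using n(2)[OF \<open>m \<in> F\<close>] le_Suc_ex by blast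
    have "real n * t \<le> real m * t" using t by (intro mult_right_mono) (auto simp: m)
    then have "side1 t m \<le> exp (- (real n * t)) / 2 ^ m" unfolding side1_def by (intro divide_right_mono) auto
    also have "\<dots> = side1 t n * (1 / 2) ^ k" by (simp add: side1_def m power_add power_divide)
    also have "\<dots> \<le> r * (1 / 2) ^ k" using F(2)[OF n(1)] by (intro mult_right_mono) auto
    finally show ?thesis by (simp add: m)
  qed
  have "(\<Sum>m\<in>F. (1 / 2) ^ (m - n)) = (\<Sum>k\<in>(\<lambda>m. m - n) ` F. (1 / 2 :: real) ^ k)"
    by (rule sum.reindex_cong[symmetric, OF _ refl]) (use n(2) in \<open>auto simp: inj_on_def intro: eq_diff_iff[THEN iffD1]\<close>)
  also have "\<dots> \<le> (\<Sum>k. (1 / 2) ^ k)" using F(1) by (intro sum_le_suminf summable_geometric) auto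
  also have "\<dots> = 2" by (subst suminf_geometric) auto
  finally have "r * (\<Sum>m\<in>F. (1 / 2) ^ (m - n)) \<le> r * 2" using \<open>0 < r\<close> by (intro mult_left_mono) auto
  moreover have "(\<Sum>m\<in>F. side1 t m) \<le> r * (\<Sum>m\<in>F. (1 / 2) ^ (m - n))"
    unfolding sum_distrib_left by (intro sum_mono le)
  ultimately show ?thesis by simp
qed (use \<open>0 < r\<close> in simp)

text \<open>Summation by parts: partial sums of the differences are at least
  \<open>1 - 1 / c\<close> times those of \<open>p\<close>, minus 1. The boundary term is controlled
  by \<open>p n \<le> 1\<close>.\<close>

lemma not_summable_abel:
  fixes p :: "nat \<Rightarrow> real"
  assumes "\<not> summable p" "\<And>m. 0 \<le> p m" "\<And>m. p m \<le> 1" "1 < c" "\<And>m. p (Suc m) / c \<le> p m"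
  shows "\<not> summable (\<lambda>m. p m - p (Suc m) / c)"
proof
  assume s: "summable (\<lambda>m. p m - p (Suc m) / c)"
  define G where "G = (\<Sum>m. p m - p (Suc m) / c)"
  have "summable p"
  proof (rule summableI_nonneg_bounded[where x = "(G + 1) / (1 - 1 / c)"])
    fix n
    have "(\<Sum>m<n. p m - p (Suc m) / c) \<le> G"
      unfolding G_def using s assms(5) by (intro sum_le_suminf) auto
    moreover have tele: "(\<Sum>m<n. p (Suc m)) = (\<Sum>m<n. p m) + p n - p 0"
      by (induction n) auto
    have "(\<Sum>m<n. p m - p (Suc m) / c) = (\<Sum>m<n. p m) - ((\<Sum>m<n. p m) + p n - p 0) / c"
      unfolding tele[symmetric] by (simp add: sum_subtractf sum_divide_distrib)
    moreover have "((\<Sum>m<n. p m) + p n - p 0) / c \<le> (\<Sum>m<n. p m) / c + 1"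
    proof -
      have "(p n - p 0) / c \<le> 1" using assms(2)[of 0] assms(3)[of n] assms(4) by (simp add: pos_divide_le_eq)
      then show ?thesis by (simp add: add_divide_distrib diff_divide_distrib)
    qed
    ultimately have "(\<Sum>m<n. p m) - (\<Sum>m<n. p m) / c \<le> G + 1" by linarith
    then have "(\<Sum>m<n. p m) * (1 - 1 / c) \<le> G + 1" by (simp add: algebra_simps)
    then show "(\<Sum>m<n. p m) \<le> (G + 1) / (1 - 1 / c)" using assms(4) by (simp add: pos_le_divide_eq)
  qed (rule assms(2))
  with assms(1) show False ..
qed

text \<open>For \<open>t < ln 3\<close> the weights are differenced so that their tails are controlled by their first term;
  for \<open>t = ln 3\<close> those below \<open>3 * D / 2 ^ m\<close> are dropped altogether.\<close>

lemma exists_tame_weights: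
  fixes \<psi> :: "nat \<Rightarrow> real"
  assumes t: "t \<le> ln 3" and D: "0 < D" and \<psi>: "\<And>m. 0 \<le> \<psi> m" "decseq \<psi>"
    and gap: "\<And>m. \<psi> m * exp (- (real m * t)) / D \<le> 1 / 3 ^ m"
    and div: "\<not> summable (\<lambda>m. \<psi> m * exp (- (real m * t)) / D * 3 ^ m)"
  obtains \<phi> where "\<And>m. 0 \<le> \<phi> m" "\<And>m. \<phi> m \<le> \<psi> m"
    "\<not> summable (\<lambda>m. \<phi> m * exp (- (real m * t)) / D * 3 ^ m)"
    "\<And>F n. finite F \<Longrightarrow> (\<And>m. m \<in> F \<Longrightarrow> n \<le> m \<and> \<phi> m \<le> 3 * D / 2 ^ m) \<Longrightarrow> sum \<phi> F \<le> \<psi> n"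
proof (cases "t = ln 3")
  case True
  have e: "exp (- (real m * t)) * 3 ^ m = 1" for m
    by (simp add: True exp_minus exp_of_nat_mult)
  have e': "x * exp (- (real m * t)) / D * 3 ^ m = x / D" for x m
  proof -
    have "x * exp (- (real m * t)) / D * 3 ^ m = x / D * (exp (- (real m * t)) * 3 ^ m)" by simp
    then show ?thesis unfolding e by simp
  qed
  \<comment> \<open>The dropped weights are at most \<open>3 * D / 2 ^ m\<close>, hence summable.
    Every surviving weight exceeds that threshold, so the smallness condition of the tail bound
    leaves only zeros.\<close>
  define \<phi> where "\<phi> m = (if \<psi> m \<le> 3 * D / 2 ^ m then 0 else \<psi> m)" for m
  have "summable \<psi>" if "summable \<phi>"
  proof -
    have "summable (\<lambda>m. 3 * D * (1 / 2) ^ m)" by (intro summable_mult summable_geometric) auto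
    with that have "summable (\<lambda>m. \<phi> m + 3 * D * (1 / 2) ^ m)" by (rule summable_add)
    then show ?thesis
      by (rule summable_comparison_test'[where N = 0]) (use \<psi>(1) D in \<open>auto simp: \<phi>_def power_divide\<close>)
  qed
  moreover have "\<not> summable \<psi>" using div unfolding e' by (auto intro: summable_divide)
  ultimately have "\<not> summable \<phi>" by blast
  then have div': "\<not> summable (\<lambda>m. \<phi> m * exp (- (real m * t)) / D * 3 ^ m)"
    unfolding e' using summable_mult[of "\<lambda>m. \<phi> m / D" D] D by auto
  have tail: "sum \<phi> F \<le> \<psi> n" if "\<And>m. m \<in> F \<Longrightarrow> n \<le> m \<and> \<phi> m \<le> 3 * D / 2 ^ m" for F n
  proof -
    have "\<phi> m = 0" if "m \<in> F" for m using \<open>\<And>m. m \<in> F \<Longrightarrow> _\<close>[OF that] by (auto simp: \<phi>_def split: if_splits)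
    then show ?thesis using \<psi>(1) by (simp add: sum.neutral)
  qed
  show ?thesis by (rule that[of \<phi>]) (use \<psi>(1) div' tail in \<open>auto simp: \<phi>_def\<close>)
next
  case False
  \<comment> \<open>The level factors grow by \<open>c\<close> per step, so the difference
    \<open>\<psi> m - \<psi> (Suc m)\<close> contributes \<open>p m - p (Suc m) / c\<close> to the
    series; the strict inequality \<open>t < ln 3\<close> gives \<open>1 < c\<close>. The sum of
    differences telescopes to the tail bound.\<close>
  define c where "c = 3 * exp (- t)"
  have "exp t < exp (ln 3)" using t False by (simp only: exp_less_cancel_iff)
  then have "exp t < 3" by simp
  then have c: "1 < c" by (simp add: c_def exp_minus field_simps)
  define p where "p m = \<psi> m * exp (- (real m * t)) / D * 3 ^ m" for m
  define \<phi> where "\<phi> m = \<psi> m - \<psi> (Suc m)" for m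
  have dec: "\<psi> (Suc m) \<le> \<psi> m" for m using \<psi>(2) by (simp add: decseq_Suc_iff)
  have eq: "\<phi> m * exp (- (real m * t)) / D * 3 ^ m = p m - p (Suc m) / c" for m
  proof -
    have "exp (- (real (Suc m) * t)) = exp (- (real m * t)) * exp (- t)"
      by (simp add: algebra_simps exp_add[symmetric])
    then have "p (Suc m) = c * (\<psi> (Suc m) * exp (- (real m * t)) / D * 3 ^ m)"
      unfolding p_def c_def by simp
    then have "p (Suc m) / c = \<psi> (Suc m) * exp (- (real m * t)) / D * 3 ^ m" using c by simp
    then show ?thesis unfolding p_def \<phi>_def by (simp add: left_diff_distrib diff_divide_distrib)
  qed
  have "\<not> summable (\<lambda>m. p m - p (Suc m) / c)"
  proof (rule not_summable_abel[OF _ _ _ c])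
    show "\<not> summable p" using div unfolding p_def .
    show "0 \<le> p m" for m using \<psi>(1) D by (simp add: p_def)
    show "p m \<le> 1" for m using gap[of m] by (simp add: p_def pos_le_divide_eq)
    show "p (Suc m) / c \<le> p m" for m
    proof -
      have "0 \<le> \<phi> m * exp (- (real m * t)) / D * 3 ^ m" using dec[of m] D by (simp add: \<phi>_def)
      then show ?thesis unfolding eq by simp
    qed
  qed
  then have div': "\<not> summable (\<lambda>m. \<phi> m * exp (- (real m * t)) / D * 3 ^ m)" unfolding eq .
  have tail: "sum \<phi> F \<le> \<psi> n" if F: "finite F" "\<And>m. m \<in> F \<Longrightarrow> n \<le> m" for F n
  proof -
    obtain k where k: "F \<subseteq> {..<k}" using F(1) finite_nat_iff_bounded by blast
    have "sum \<phi> F \<le> sum \<phi> {n..<n + k}"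
      using k F(2) dec by (intro sum_mono2) (force simp: \<phi>_def)+
    also have "\<dots> = \<psi> n - \<psi> (n + k)"
      by (induction k) (auto simp: \<phi>_def)
    also have "\<dots> \<le> \<psi> n" using \<psi>(1)[of "n + k"] by simp
    finally show ?thesis .
  qed
  show ?thesis by (rule that[of \<phi>]) (use \<psi>(1) dec div' tail in \<open>auto simp: \<phi>_def\<close>)
qed

lemma side2_series_eq:
  "f (side2 m) * 9 ^ m * exp (real m ^ 2 - real m * t) = f (side2 m) / side2 m * exp (- (real m * t)) * 3 ^ m"
proof -
  have "(9::real) ^ m = 3 ^ m * 3 ^ m" by (simp flip: power_mult_distrib)
  then show ?thesis by (simp add: side2_def exp_diff exp_minus field_simps)
qed

text \<open>A function comparable to \<open>r powr (1 + crit)\<close> near \<open>0\<close> would make the series converge, because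
  \<open>side2 m powr crit\<close> decays like \<open>exp (- crit * m\<^sup>2)\<close>.\<close>

lemma ge_crit_powr_of_not_summable:
  assumes t: "0 \<le> t" and f: "dimension_function f" "f \<preceq> pow_fun (1 + crit)"
    and div: "\<not> summable (\<lambda>m. f (side2 m) * 9 ^ m * exp (real m ^ 2 - real m * t))" and D: "0 < D"
  shows "\<exists>r0>0. \<forall>r. 0 < r \<and> r \<le> r0 \<longrightarrow> D * r powr (1 + crit) \<le> f r"
proof (rule ccontr)
  assume neg: "\<not> ?thesis"
  \<comment> \<open>Since \<open>f r / r powr (1 + crit)\<close> is nonincreasing, a single
    \<open>r\<close> with the reverse inequality would give it for all smaller arguments; so the
    failure is global.\<close>
  have less: "f r < D * r powr (1 + crit)" if r: "0 < r" for r
  proof (rule ccontr)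
    assume "\<not> f r < D * r powr (1 + crit)"
    then have "D \<le> f r / r powr (1 + crit)" using r by (simp add: pos_le_divide_eq)
    have "D * x powr (1 + crit) \<le> f x" if "0 < x \<and> x \<le> r" for x
    proof -
      have "D \<le> f x / x powr (1 + crit)"
        using \<open>D \<le> _\<close> preceq_powD[OF f(2), of x r] that by linarith
      then show ?thesis using that by (simp add: pos_le_divide_eq)
    qed
    with neg r show False by blast
  qed
  have "summable (\<lambda>m. f (side2 m) * 9 ^ m * exp (real m ^ 2 - real m * t))"
  proof (rule summable_comparison_test_ev)
    have "summable (\<lambda>m. exp (- 1) ^ m :: real)" by (rule summable_geometric) simp
    then show "summable (\<lambda>m. D * exp (- 1) ^ m :: real)" by (rule summable_mult)
    have "\<forall>\<^sub>F m in sequentially. (1 + ln 3) / crit \<le> real m"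
      using eventually_ge_at_top[of "nat \<lceil>(1 + ln 3) / crit\<rceil>"] by eventually_elim linarith
    then show "\<forall>\<^sub>F m in sequentially. norm (f (side2 m) * 9 ^ m * exp (real m ^ 2 - real m * t)) \<le> D * exp (- 1) ^ m"
    proof eventually_elim
      case (elim m)
      have pos: "0 < f (side2 m)" using dimension_function_pos[OF f(1)] by simp
      have "f (side2 m) / side2 m \<le> D * side2 m powr crit"
        using less[of "side2 m"] by (simp add: powr_add pos_divide_le_eq mult_ac less_imp_le)
      also have "side2 m powr crit \<le> exp (- (real m ^ 2)) powr crit"
        using crit_bounds by (intro powr_mono2) (auto simp: side2_def divide_le_eq)
      also have "\<dots> = exp (- (crit * real m ^ 2))" by (simp add: powr_def)
      finally have "f (side2 m) / side2 m \<le> D * exp (- (crit * real m ^ 2))" using D by simp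
      then have "f (side2 m) / side2 m * exp (- (real m * t)) * 3 ^ m \<le> D * exp (- (crit * real m ^ 2)) * 1 * 3 ^ m"
        using t D pos by (intro mult_mono mult_right_mono) (auto simp: less_imp_le)
      also have "D * exp (- (crit * real m ^ 2)) * 1 * 3 ^ m = D * exp (real m * ln 3 - crit * real m ^ 2)"
      proof -
        have "(3::real) ^ m = exp (real m * ln 3)" by (simp add: exp_of_nat_mult)
        then show ?thesis by (simp add: mult_exp_exp)
      qed
      \<comment> \<open>The lower bound \<open>(1 + ln 3) / crit\<close> on \<open>m\<close> was
        chosen for this estimate, which leaves a geometric majorant.\<close>
      also have "real m * ln 3 - crit * real m ^ 2 \<le> - real m"
      proof -
        have "1 + ln 3 \<le> crit * real m" using elim crit_bounds by (simp add: pos_divide_le_eq mult.commute)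
        then have "real m * (1 + ln 3) \<le> real m * (crit * real m)" by (intro mult_left_mono) auto
        then show ?thesis by (simp add: power2_eq_square algebra_simps)
      qed
      also have "D * exp (- real m) = D * exp (- 1) ^ m" by (simp flip: exp_of_nat_mult)
      finally have "f (side2 m) / side2 m * exp (- (real m * t)) * 3 ^ m \<le> D * exp (- 1) ^ m" using D by simp
      then show ?case unfolding side2_series_eq using pos by (simp add: abs_of_pos)
    qed
  qed
  with div show False ..
qed

text \<open>Now \<open>f r / r\<close> is nondecreasing, so the squares themselves limit the density
  to \<open>f (half m) / half m\<close>. For a ball meeting several rows, those with
  \<open>1 / 3 ^ m \<le> r\<close> are bounded through their gap total and the growth of
  \<open>f\<close>; the others, at most two per level, through the tame weights.\<close>

lemma rich_of_one_preceq:
  assumes t: "0 \<le> t" "t \<le> ln 3" and f: "dimension_function f" "pow_fun 1 \<preceq> f" "f \<preceq> pow_fun 2" "f \<preceq> pow_fun (1 + crit)"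
    and div: "\<not> summable (\<lambda>m. f (side2 m) * 9 ^ m * exp (real m ^ 2 - real m * t))"
  shows "rich t f"
  unfolding rich_def
proof (intro allI impI, elim conjE)
  fix D l R :: real
  assume D: "0 < D" and l: "0 < l" and R: "0 < R" "R \<le> 1"
    and Dr: "\<forall>r. 0 < r \<and> r \<le> R \<and> r \<le> l \<longrightarrow> D * r ^ 2 \<le> 192 * f r"
  have fpos: "0 < f r" if "0 < r" for r using dimension_function_pos[OF f(1) that] .
  have up: "f x / x \<le> f y / y" if "0 < x" "x \<le> y" for x y using pow_one_preceqD[OF f(1,2) that] .
  define \<psi> where "\<psi> m = min (f (half m) / half m) (D * exp (real m * t) / 3 ^ m)" for m
  have \<psi>0: "0 \<le> \<psi> m" for m using fpos[of "half m"] D by (simp add: \<psi>_def less_imp_le)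
  have dec: "decseq \<psi>"
  proof (rule decseq_SucI)
    fix m
    \<comment> \<open>The cap \<open>D * exp (real m * t) / 3 ^ m\<close> decreases precisely
      because \<open>exp t \<le> 3\<close>.\<close>
    have "exp t \<le> 3" using t(2) by (metis exp_le_cancel_iff exp_ln zero_less_numeral)
    then have "D * exp (real (Suc m) * t) / 3 ^ Suc m \<le> D * exp (real m * t) / 3 ^ m"
      using D by (simp add: distrib_right exp_add divide_simps)
    moreover have "f (half (Suc m)) / half (Suc m) \<le> f (half m) / half m" by (intro up half_antimono) auto
    ultimately show "\<psi> (Suc m) \<le> \<psi> m" unfolding \<psi>_def by (rule min.mono[rotated])
  qed
  have gap: "\<psi> m * exp (- (real m * t)) / D \<le> 1 / 3 ^ m" for m
  proof -
    have "\<psi> m * exp (- (real m * t)) / D \<le> (D * exp (real m * t) / 3 ^ m) * exp (- (real m * t)) / D"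
      using D by (intro divide_right_mono mult_right_mono) (auto simp: \<psi>_def)
    also have "\<dots> = 1 / 3 ^ m" using D by (simp add: exp_minus)
    finally show ?thesis .
  qed
  have div\<psi>: "\<not> summable (\<lambda>m. \<psi> m * exp (- (real m * t)) / D * 3 ^ m)"
  proof -
    let ?p = "\<lambda>m. f (half m) / half m * exp (- (real m * t)) / D * 3 ^ m"
    have eq: "\<psi> m * exp (- (real m * t)) / D * 3 ^ m = min (?p m) 1" for m
    proof -
      let ?c = "exp (- (real m * t)) / D * 3 ^ m"
      have c: "0 \<le> ?c" using D by simp
      have "\<psi> m * exp (- (real m * t)) / D * 3 ^ m = \<psi> m * ?c" by simp
      also have "\<dots> = min (f (half m) / half m * ?c) (D * exp (real m * t) / 3 ^ m * ?c)"
        unfolding \<psi>_def using min_mult_distrib_right[of "f (half m) / half m" "D * exp (real m * t) / 3 ^ m" ?c] c by simp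
      also have "D * exp (real m * t) / 3 ^ m * ?c = 1" using D by (simp add: exp_minus)
      also have "f (half m) / half m * ?c = ?p m" by simp
      finally show ?thesis .
    qed
    have "\<not> summable ?p"
    proof
      assume "summable ?p"
      then have summ: "summable (\<lambda>m. 2 * D * ?p m)" by (rule summable_mult)
      \<comment> \<open>The given series uses \<open>side2 m\<close>, the weights use
        \<open>half m\<close>; by doubling, the ratio \<open>f r / r\<close> at the former is at
        most twice that at the latter.\<close>
      have bound: "norm (f (side2 m) * 9 ^ m * exp (real m ^ 2 - real m * t)) \<le> 2 * D * ?p m" for m
      proof -
        have "f (side2 m) \<le> 4 * f (half m)" using preceq_two_doubling[OF f(3) half_pos, of m] by (simp add: half_def)
        then have "f (side2 m) / side2 m \<le> 4 * f (half m) / side2 m" by (intro divide_right_mono) (auto simp: less_imp_le)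
        also have "\<dots> = 2 * (f (half m) / half m)" by (simp add: half_def)
        finally have "f (side2 m) / side2 m * (exp (- (real m * t)) * 3 ^ m) \<le> 2 * (f (half m) / half m) * (exp (- (real m * t)) * 3 ^ m)"
          by (intro mult_right_mono) auto
        then show ?thesis unfolding side2_series_eq using D fpos[of "side2 m"] by (simp add: mult.assoc abs_of_pos)
      qed
      have "summable (\<lambda>m. f (side2 m) * 9 ^ m * exp (real m ^ 2 - real m * t))"
        by (rule summable_comparison_test'[OF summ, of 0]) (rule bound)
      with div show False ..
    qed
    moreover have "0 \<le> ?p m" for m using fpos[of "half m"] D by (simp add: less_imp_le)
    ultimately show ?thesis unfolding eq by (intro not_summable_min) auto
  qed
  obtain \<phi> where \<phi>0: "\<And>m. 0 \<le> \<phi> m" and \<phi>_le: "\<And>m. \<phi> m \<le> \<psi> m"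
    and div\<phi>: "\<not> summable (\<lambda>m. \<phi> m * exp (- (real m * t)) / D * 3 ^ m)"
    and tail: "\<And>F n. finite F \<Longrightarrow> (\<And>m. m \<in> F \<Longrightarrow> n \<le> m \<and> \<phi> m \<le> 3 * D / 2 ^ m) \<Longrightarrow> sum \<phi> F \<le> \<psi> n"
    by (rule exists_tame_weights[where \<psi> = \<psi>, OF t(2) D \<psi>0 dec gap div\<psi>]) blast
  define q where "q = keep t D \<phi>"
  have q0: "0 \<le> q m" for m using \<phi>0 by (simp add: q_def keep_def)
  have q_pos: "q m = \<phi> m" if "0 < q m" for m using that by (simp add: q_def keep_def split: if_splits)
  have \<psi>_le: "\<psi> m \<le> f (half m) / half m" for m by (simp add: \<psi>_def)
  have q_le: "q m \<le> f (half m) / half m" for m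
    using \<phi>_le[of m] \<psi>_le[of m] \<psi>0[of m] by (auto simp: q_def keep_def)
  have rw: "row_weights t D f q"
    unfolding q_def
  proof (rule row_weights_keep[OF D f(1) \<phi>0 _ _ div\<phi>])
    fix m
    have "\<phi> m \<le> f (half m) / half m" using \<phi>_le[of m] \<psi>_le[of m] by linarith
    then show "\<phi> m * half m \<le> f (half m)" by (simp add: pos_le_divide_eq)
    have "\<phi> m * exp (- (real m * t)) / D \<le> \<psi> m * exp (- (real m * t)) / D"
      using D \<phi>_le by (intro divide_right_mono mult_right_mono) auto
    then show "\<phi> m * exp (- (real m * t)) / D \<le> 1 / 3 ^ m" using gap[of m] by linarith
  qed
  obtain r0 where r0: "0 < r0" "\<And>r. 0 < r \<Longrightarrow> r \<le> r0 \<Longrightarrow> D * r powr (1 + crit) \<le> f r"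
    using ge_crit_powr_of_not_summable[OF t(1) f(1,4) div D] by blast
  obtain N where "1 / r0 < 2 ^ N" using real_arch_pow[of 2 "1 / r0"] by auto
  then have N: "1 / 2 ^ N \<le> r0" using r0(1) by (simp add: field_simps)
  have single: "q m * min (side1 t m) r \<le> 1000 * f r" if "half m \<le> r" for m r
  proof -
    have r: "0 < r" using that half_pos[of m] by linarith
    have "q m * min (side1 t m) r \<le> q m * r" using q0 by (intro mult_left_mono) auto
    also have "\<dots> \<le> f r / r * r" using q_le[of m] up[OF half_pos that] r by (intro mult_right_mono) auto
    finally show ?thesis using fpos[OF r] r by simp
  qed
  have multi: "(\<Sum>s\<in>S. row_mass t q (fst s) r) \<le> 1000 * f r"
    if r: "0 < r" "r \<le> R" "r \<le> l" and finS: "finite S"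
      and S: "\<And>m j. (m, j) \<in> S \<Longrightarrow> N \<le> m \<and> 0 < q m \<and> q m * exp (- (real m * t)) / D \<le> 3 * r \<and> half m \<le> r"
      and sum: "(\<Sum>s\<in>S. q (fst s) * exp (- (real (fst s) * t)) / D) \<le> 5 * r"
      and two: "\<And>m. r < 1 / 3 ^ m \<Longrightarrow> card {j. (m, j) \<in> S} \<le> 2"
    for r and S :: "(nat \<times> int) set"
  proof -
    define S1 where "S1 = {s \<in> S. 1 / 3 ^ fst s \<le> r}"
    define S2 where "S2 = {s \<in> S. r < 1 / 3 ^ fst s}"
    have S12: "S = S1 \<union> S2" "S1 \<inter> S2 = {}" "finite S1" "finite S2" using finS by (auto simp: S1_def S2_def)
    let ?gap = "\<lambda>m. q m * exp (- (real m * t)) / D"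
    have "(\<Sum>s\<in>S1. row_mass t q (fst s) r) \<le> (\<Sum>s\<in>S1. ?gap (fst s) * (192 * (f r / r)))"
    proof (rule sum_mono)
      fix s assume s: "s \<in> S1"
      let ?m = "fst s"
      have m: "N \<le> ?m" "1 / 3 ^ ?m \<le> r" using s S[of ?m "snd s"] by (auto simp: S1_def)
      have "D * max r (1 / 2 ^ ?m) \<le> 192 * (f r / r)"
      proof (cases "1 / 2 ^ ?m \<le> r")
        case True
        then have "max r (1 / 2 ^ ?m) = r" by simp
        then show ?thesis using Dr r by (simp add: pos_le_divide_eq power2_eq_square mult.assoc)
      next
        \<comment> \<open>Here \<open>1 / 3 ^ m \<le> r < 1 / 2 ^ m\<close>, hence
          \<open>1 / 2 ^ m \<le> r powr crit\<close>. The ball is charged for a full horizontal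
          period, and \<open>D * r powr (1 + crit) \<le> f r\<close> pays for it.\<close>
        case False
        have "1 / 2 ^ ?m \<le> (1 / 2 ^ N :: real)" using m(1) by (intro divide_left_mono power_increasing) auto
        then have "D * r powr (1 + crit) \<le> f r" using r0(2)[OF r(1)] N False by linarith
        then have "D * r powr crit \<le> f r / r" using r(1) by (simp add: powr_add pos_le_divide_eq mult_ac)
        moreover have "1 / 2 ^ ?m \<le> r powr crit"
          unfolding powr_crit[symmetric] using m(2) crit_bounds by (intro powr_mono2) auto
        then have "D * (1 / 2 ^ ?m) \<le> D * r powr crit" using D by (intro mult_left_mono) auto
        moreover have "0 < f r / r" using fpos r by simp
        ultimately show ?thesis using False by (simp add: max_def)
      qed
      then have "?gap ?m * (D * max r (1 / 2 ^ ?m)) \<le> ?gap ?m * (192 * (f r / r))"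
        using q0[of ?m] D by (intro mult_left_mono) auto
      moreover have "row_mass t q ?m r \<le> ?gap ?m * (D * max r (1 / 2 ^ ?m))"
        using row_mass_le[where q = q and m = ?m and t = t and r = r, OF q0 D] by (simp only: mult_ac)
      ultimately show "row_mass t q ?m r \<le> ?gap ?m * (192 * (f r / r))" by linarith
    qed
    also have "\<dots> = (\<Sum>s\<in>S1. ?gap (fst s)) * (192 * (f r / r))" by (rule sum_distrib_right[symmetric])
    also have "\<dots> \<le> (5 * r) * (192 * (f r / r))"
    proof (rule mult_right_mono)
      have "(\<Sum>s\<in>S1. ?gap (fst s)) \<le> (\<Sum>s\<in>S. ?gap (fst s))"
        using finS q0 D by (intro sum_mono2) (auto simp: S1_def)
      then show "(\<Sum>s\<in>S1. ?gap (fst s)) \<le> 5 * r" using sum by linarith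
    qed (use fpos[OF r(1)] r(1) in \<open>simp add: less_imp_le\<close>)
    finally have part1: "(\<Sum>s\<in>S1. row_mass t q (fst s) r) \<le> 960 * f r" using r by simp
    \<comment> \<open>For the levels with \<open>r < 1 / 3 ^ m\<close>, rectangles narrower than
      \<open>r\<close> give a geometric sum over levels. Each wider one contributes up to
      \<open>q m * r\<close>, so there the weights themselves have to be summed.\<close>
    define F where "F = fst ` S2"
    define Fa where "Fa = {m \<in> F. side1 t m < r}"
    define Fb where "Fb = {m \<in> F. r \<le> side1 t m}"
    have F: "finite F" "F = Fa \<union> Fb" "Fa \<inter> Fb = {}" "finite Fa" "finite Fb"
      using S12(4) by (auto simp: F_def Fa_def Fb_def)
    have Fm: "N \<le> m \<and> 0 < q m \<and> ?gap m \<le> 3 * r \<and> half m \<le> r \<and> r < 1 / 3 ^ m" if m: "m \<in> F" for m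
    proof -
      obtain j where "(m, j) \<in> S" "r < 1 / 3 ^ m" using m by (auto simp: F_def S2_def)
      then show ?thesis using S by blast
    qed
    have mass: "row_mass t q m r = q m * min (side1 t m) r" if "m \<in> F" for m
    proof -
      have "(1 / 3 ^ m :: real) \<le> 1 / 2 ^ m" by (intro divide_left_mono power_mono) auto
      then have "r < 1 / 2 ^ m" using Fm[OF that] by linarith
      then show ?thesis by (simp add: row_mass_def)
    qed
    have "(\<Sum>s\<in>S2. row_mass t q (fst s) r) = (\<Sum>m\<in>F. \<Sum>s\<in>{s \<in> S2. fst s = m}. row_mass t q (fst s) r)"
      unfolding F_def using S12(4) by (rule sum.image_gen)
    also have "\<dots> \<le> (\<Sum>m\<in>F. 2 * (q m * min (side1 t m) r))"
    proof (rule sum_mono)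
      fix m assume m: "m \<in> F"
      have "{s \<in> S2. fst s = m} = Pair m ` {j. (m, j) \<in> S}" using Fm[OF m] by (auto simp: S2_def)
      then have "card {s \<in> S2. fst s = m} = card {j. (m, j) \<in> S}" by (simp add: card_image inj_on_def)
      then have "real (card {s \<in> S2. fst s = m}) \<le> 2" using two[of m] Fm[OF m] by simp
      moreover have "0 \<le> q m * min (side1 t m) r" using q0[of m] r(1) less_imp_le[OF side1_pos, of t m] by (intro mult_nonneg_nonneg) auto
      ultimately have "real (card {s \<in> S2. fst s = m}) * (q m * min (side1 t m) r) \<le> 2 * (q m * min (side1 t m) r)"
        by (intro mult_right_mono)
      moreover have "(\<Sum>s\<in>{s \<in> S2. fst s = m}. row_mass t q (fst s) r) = real (card {s \<in> S2. fst s = m}) * (q m * min (side1 t m) r)"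
        by (subst sum.cong[OF refl, of _ _ "\<lambda>_. q m * min (side1 t m) r"]) (auto simp: mass[OF m])
      ultimately show "(\<Sum>s\<in>{s \<in> S2. fst s = m}. row_mass t q (fst s) r) \<le> 2 * (q m * min (side1 t m) r)" by linarith
    qed
    also have "\<dots> = 2 * ((\<Sum>m\<in>Fa. q m * min (side1 t m) r) + (\<Sum>m\<in>Fb. q m * min (side1 t m) r))"
      unfolding F(2) sum_distrib_left[symmetric] using F by (subst sum.union_disjoint) auto
    finally have part2: "(\<Sum>s\<in>S2. row_mass t q (fst s) r) \<le> 2 * ((\<Sum>m\<in>Fa. q m * min (side1 t m) r) + (\<Sum>m\<in>Fb. q m * min (side1 t m) r))" .
    have "(\<Sum>m\<in>Fa. q m * min (side1 t m) r) \<le> (\<Sum>m\<in>Fa. f r / r * side1 t m)"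
    proof (rule sum_mono)
      fix m assume "m \<in> Fa"
      then have "half m \<le> r" using Fm by (simp add: Fa_def)
      then have "q m \<le> f r / r" using q_le[of m] up[OF half_pos, of m r] by linarith
      then show "q m * min (side1 t m) r \<le> f r / r * side1 t m"
        using q0[of m] r(1) less_imp_le[OF side1_pos, of t m] by (intro mult_mono) auto
    qed
    also have "\<dots> = f r / r * (\<Sum>m\<in>Fa. side1 t m)" by (simp add: sum_distrib_left)
    also have "\<dots> \<le> f r / r * (2 * r)"
    proof (rule mult_left_mono)
      show "(\<Sum>m\<in>Fa. side1 t m) \<le> 2 * r" by (rule sum_side1_le[OF t(1) F(4) _ r(1)]) (simp add: Fa_def)
    qed (use fpos[OF r(1)] r(1) in \<open>simp add: less_imp_le\<close>)
    finally have parta: "(\<Sum>m\<in>Fa. q m * min (side1 t m) r) \<le> 2 * f r" using r by simp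
    have partb: "(\<Sum>m\<in>Fb. q m * min (side1 t m) r) \<le> f r"
    proof (cases "Fb = {}")
      case True
      then show ?thesis using fpos[OF r(1)] by simp
    next
      case False
      define n where "n = Min Fb"
      have n: "n \<in> Fb" "\<And>m. m \<in> Fb \<Longrightarrow> n \<le> m" using F False by (auto simp: n_def)
      have \<phi>_small: "\<phi> m \<le> 3 * D / 2 ^ m" and q\<phi>: "q m = \<phi> m" if "m \<in> Fb" for m
      proof -
        have m: "m \<in> F" "r \<le> side1 t m" using that by (auto simp: Fb_def)
        then show "q m = \<phi> m" using Fm q_pos by blast
        \<comment> \<open>Dividing out \<open>exp (- (real m * t))\<close>, which occurs in both the
          gap and \<open>side1\<close>, leaves the smallness condition of
          \<open>exists_tame_weights\<close>.\<close>
        have "?gap m \<le> 3 * side1 t m" using Fm[OF m(1)] m(2) by linarith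
        then have "q m * exp (- (real m * t)) \<le> 3 * side1 t m * D" using D by (simp only: pos_divide_le_eq)
        also have "\<dots> = 3 * D / 2 ^ m * exp (- (real m * t))" by (simp add: side1_def)
        finally have "q m \<le> 3 * D / 2 ^ m" by (rule mult_right_le_imp_le) simp
        then show "\<phi> m \<le> 3 * D / 2 ^ m" unfolding \<open>q m = \<phi> m\<close> .
      qed
      have "(\<Sum>m\<in>Fb. q m * min (side1 t m) r) \<le> (\<Sum>m\<in>Fb. \<phi> m * r)"
      proof (rule sum_mono)
        fix m assume "m \<in> Fb"
        then show "q m * min (side1 t m) r \<le> \<phi> m * r" using q\<phi>[of m] \<phi>0[of m] by (simp add: mult_left_mono)
      qed
      also have "\<dots> = sum \<phi> Fb * r" by (simp add: sum_distrib_right)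
      also have "sum \<phi> Fb \<le> \<psi> n" using n(2) \<phi>_small F by (intro tail) auto
      also have "\<psi> n \<le> f r / r"
      proof -
        have "half n \<le> r" using n(1) Fm by (simp add: Fb_def)
        then show ?thesis using \<psi>_le[of n] up[OF half_pos, of n r] by linarith
      qed
      finally show ?thesis using r(1) by simp
    qed
    have "(\<Sum>s\<in>S. row_mass t q (fst s) r) = (\<Sum>s\<in>S1. row_mass t q (fst s) r) + (\<Sum>s\<in>S2. row_mass t q (fst s) r)"
      unfolding S12(1) using S12 by (intro sum.union_disjoint) auto
    \<comment> \<open>The constants add up to \<open>960 + 2 * (2 + 1) = 966\<close>.\<close>
    then show ?thesis using part1 part2 parta partb fpos[OF r(1)] unfolding distrib_left by linarith
  qed
  show "\<exists>q N. row_weights t D f q \<and>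
       (\<forall>m r. half m \<le> r \<and> r \<le> R \<and> r < 1 / 2 ^ m \<longrightarrow> q m * min (side1 t m) r \<le> 1000 * f r) \<and>
       (\<forall>r S. 0 < r \<and> r \<le> R \<and> r \<le> l \<and> finite S \<and>
          (\<forall>m j. (m, j) \<in> S \<longrightarrow> N \<le> m \<and> 0 < q m \<and> q m * exp (- (real m * t)) / D \<le> 3 * r \<and> half m \<le> r) \<and>
          (\<Sum>s\<in>S. q (fst s) * exp (- (real (fst s) * t)) / D) \<le> 5 * r \<and>
          (\<forall>m. r < 1 / 3 ^ m \<longrightarrow> card {j::int. (m, j) \<in> S} \<le> 2) \<longrightarrow>
          (\<Sum>s\<in>S. row_mass t q (fst s) r) \<le> 1000 * f r)"
    by (intro exI[of _ q] exI[of _ N] conjI allI impI rw; (elim conjE)?; rule single multi; blast)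
qed

section \<open>Infinite measure and the dichotomy\<close>

lemma prec_one_ge:
  assumes "f \<prec> pow_fun 1"
  shows "\<exists>\<eta>>0. \<forall>r. 0 < r \<and> r \<le> \<eta> \<longrightarrow> K * r \<le> f r"
proof -
  have "\<forall>\<^sub>F r in at_right 0. K \<le> f r / pow_fun 1 r"
    using assms unfolding dim_prec_def filterlim_at_top by blast
  then obtain b where b: "0 < b" "\<And>r. 0 < r \<Longrightarrow> r < b \<Longrightarrow> K \<le> f r / pow_fun 1 r"
    unfolding eventually_at_right_field by auto
  have "K * r \<le> f r" if "0 < r" "r \<le> b / 2" for r
    using b(2)[of r] b(1) that by (simp add: pow_fun_def pos_le_divide_eq)
  with b(1) show ?thesis by (intro exI[of _ "b / 2"]) simp
qed

text \<open>Contents only increase as \<open>\<eta>\<close> shrinks, so it suffices to compare them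
  for \<open>\<eta> \<le> r0\<close>.\<close>

lemma hausdorff_measure_mono_fun:
  assumes "0 < r0" and le: "\<And>r. 0 < r \<Longrightarrow> r \<le> r0 \<Longrightarrow> g r \<le> f r"
  shows "hausdorff_measure g A \<le> hausdorff_measure f A"
proof -
  have *: "hausdorff_content g \<eta> A \<le> hausdorff_content f \<eta> A" if "\<eta> \<le> r0" for \<eta>
    unfolding hausdorff_content_def
  proof (rule Inf_mono, clarify)
    fix B :: "nat \<Rightarrow> (real \<times> real) set"
    assume B: "A \<subseteq> (\<Union>i. B i)" "\<forall>i. (\<exists>x r. 0 < r \<and> B i = max_ball x r) \<and> max_diam (B i) \<le> \<eta>"
    have "g (max_diam (B i)) \<le> f (max_diam (B i))" for i
    proof (rule le)
      obtain x r where "0 < r" "B i = max_ball x r" using B(2) by blast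
      then show "0 < max_diam (B i)" by (simp add: max_diam_max_ball)
      show "max_diam (B i) \<le> r0" using B(2) that by (meson order_trans)
    qed
    then have "(\<Sum>i. ennreal (g (max_diam (B i)))) \<le> (\<Sum>i. ennreal (f (max_diam (B i))))"
      by (intro suminf_le ennreal_leI) auto
    with B show "\<exists>a\<in>{\<Sum>i. ennreal (g (max_diam (B i))) | B :: nat \<Rightarrow> (real \<times> real) set.
            A \<subseteq> (\<Union>i. B i) \<and> (\<forall>i. (\<exists>x r. 0 < r \<and> B i = max_ball x r) \<and> max_diam (B i) \<le> \<eta>)}.
          a \<le> (\<Sum>i. ennreal (f (max_diam (B i))))"
      by blast
  qed
  show ?thesis
    unfolding hausdorff_measure_eq_SUP
  proof (rule SUP_mono)
    fix \<eta> :: real assume "\<eta> \<in> {0<..}"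
    then show "\<exists>\<delta>\<in>{0<..}. hausdorff_content g \<eta> A \<le> hausdorff_content f \<delta> A"
      using assms(1) order_trans[OF hausdorff_content_antimono[of "min \<eta> r0" \<eta> g A] *[of "min \<eta> r0"]]
      by (intro bexI[of _ "min \<eta> r0"]) auto
  qed
qed

lemma hausdorff_measure_W2_star_eq_top_side1:
  assumes t: "0 \<le> t" and f: "dimension_function f" "f \<preceq> pow_fun 2" "f \<prec> pow_fun 1"
    and div: "\<not> summable (\<lambda>n. f (side1 t n) * 6 ^ n)"
  shows "hausdorff_measure f (W2_star t) = \<infinity>"
proof (rule hausdorff_measure_W2_star_eq_top[OF rich_of_preceq_one[OF t f(1) _ div] t f(1,2)])
  show "f \<preceq> pow_fun 1" using f(3) by (simp add: dim_prec_def)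
  fix K :: real assume "0 < K"
  obtain \<eta> where \<eta>: "0 < \<eta>" "\<forall>r. 0 < r \<and> r \<le> \<eta> \<longrightarrow> K * r \<le> f r" using prec_one_ge[OF f(3)] by blast
  have "K * r ^ 2 \<le> f r" if "0 < r" "r \<le> min \<eta> 1" for r
  proof -
    have "K * r ^ 2 \<le> K * r" using that \<open>0 < K\<close> by (simp add: power2_eq_square mult_left_le)
    then show ?thesis using \<eta>(2) that by fastforce
  qed
  then show "\<exists>\<eta>>0. \<forall>r. 0 < r \<and> r \<le> \<eta> \<longrightarrow> K * r ^ 2 \<le> f r"
    using \<eta>(1) by (intro exI[of _ "min \<eta> 1"]) simp
qed

lemma hausdorff_measure_W2_star_eq_top_side2:
  assumes t: "0 \<le> t" "t \<le> ln 3" and f: "dimension_function f" "f \<preceq> pow_fun 2" "pow_fun 1 \<preceq> f" "f \<preceq> pow_fun (1 + crit)"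
    and div: "\<not> summable (\<lambda>n. f (side2 n) * 9 ^ n * exp (real n ^ 2 - real n * t))"
  shows "hausdorff_measure f (W2_star t) = \<infinity>"
proof (rule hausdorff_measure_W2_star_eq_top[OF rich_of_one_preceq[OF t f(1,3,2,4) div] t(1) f(1,2)])
  fix K :: real assume "0 < K"
  obtain \<eta> where \<eta>: "0 < \<eta>" "\<forall>r. 0 < r \<and> r \<le> \<eta> \<longrightarrow> K * r powr (1 + crit) \<le> f r"
    using ge_crit_powr_of_not_summable[OF t(1) f(1,4) div \<open>0 < K\<close>] by blast
  have "K * r ^ 2 \<le> f r" if r: "0 < r" "r \<le> min \<eta> 1" for r
  proof -
    have "r powr 2 \<le> r powr (1 + crit)" using r crit_bounds by (intro powr_mono') auto
    then have "K * r ^ 2 \<le> K * r powr (1 + crit)" using \<open>0 < K\<close> r by (simp add: powr_numeral)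
    then show ?thesis using \<eta>(2) r by fastforce
  qed
  then show "\<exists>\<eta>>0. \<forall>r. 0 < r \<and> r \<le> \<eta> \<longrightarrow> K * r ^ 2 \<le> f r"
    using \<eta>(1) by (intro exI[of _ "min \<eta> 1"]) simp
qed

lemma hausdorff_measure_W2_star_eq_top_of_prec_one:
  assumes t: "0 \<le> t" "t \<le> ln 3" and f: "f \<prec> pow_fun 1"
  shows "hausdorff_measure f (W2_star t) = \<infinity>"
proof -
  have preceq: "(\<lambda>r. r) \<preceq> pow_fun (1 + s)" if "0 \<le> s" for s
    unfolding dim_preceq_def pow_fun_def
  proof (intro allI impI)
    fix x y :: real assume *: "0 < x \<and> x < y"
    have "y / y powr (1 + s) = y powr (- s)" "x / x powr (1 + s) = x powr (- s)"
      using * by (simp_all add: powr_add powr_minus divide_simps)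
    moreover have "y powr (- s) \<le> x powr (- s)" using * that by (intro powr_mono2') auto
    ultimately show "y / y powr (1 + s) \<le> x / x powr (1 + s)" by simp
  qed
  have "hausdorff_measure (\<lambda>r. r) (W2_star t) = \<infinity>"
  proof (rule hausdorff_measure_W2_star_eq_top_side2[OF t])
    show "dimension_function (\<lambda>r. r)" by (auto simp: dimension_function_def mono_on_def)
    show "(\<lambda>r. r) \<preceq> pow_fun 2" using preceq[of 1] by simp
    show "(\<lambda>r. r) \<preceq> pow_fun (1 + crit)" using preceq crit_bounds by simp
    show "pow_fun 1 \<preceq> (\<lambda>r. r)" by (auto simp: dim_preceq_def pow_fun_def)
    show "\<not> summable (\<lambda>n. side2 n * 9 ^ n * exp (real n ^ 2 - real n * t))"
    proof
      assume "summable (\<lambda>n. side2 n * 9 ^ n * exp (real n ^ 2 - real n * t))"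
      then have lim: "(\<lambda>n. side2 n * 9 ^ n * exp (real n ^ 2 - real n * t)) \<longlonglongrightarrow> 0" by (rule summable_LIMSEQ_zero)
      \<comment> \<open>The term equals \<open>(3 * exp (- t)) ^ n\<close>, at least 1 because
        \<open>t \<le> ln 3\<close>.\<close>
      have "1 \<le> side2 n * 9 ^ n * exp (real n ^ 2 - real n * t)" for n
      proof -
        have "exp (real n * t) \<le> exp (real n * ln 3)" using t(2) by (intro exp_mono mult_left_mono) auto
        also have "\<dots> = 3 ^ n" by (simp add: exp_of_nat_mult)
        finally have "1 \<le> exp (- (real n * t)) * 3 ^ n" by (simp add: exp_minus field_simps)
        also have "\<dots> = side2 n * 9 ^ n * exp (real n ^ 2 - real n * t)"
          using side2_series_eq[of "\<lambda>r. r" n t] side2_pos[of n] by (simp add: less_imp_neq[OF side2_pos, symmetric])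
        finally show ?thesis .
      qed
      then have "(1::real) \<le> 0" by (intro LIMSEQ_le_const[OF lim]) auto
      then show False by simp
    qed
  qed
  moreover obtain r0 where "0 < r0" "\<forall>r. 0 < r \<and> r \<le> r0 \<longrightarrow> 1 * r \<le> f r" using prec_one_ge[OF f] by blast
  then have "hausdorff_measure (\<lambda>r. r) (W2_star t) \<le> hausdorff_measure f (W2_star t)"
    by (intro hausdorff_measure_mono_fun[of r0]) auto
  ultimately show ?thesis by (simp add: top.extremum_uniqueI)
qed

lemma W2_star_subset: "W2_star t \<subseteq> {0..1} \<times> {0..1}"
  by (auto simp: W2_star_def)

theorem theorem1p3:
  fixes t :: real and f :: "real \<Rightarrow> real"
  assumes "0 \<le> t"
    and "dimension_function f"
    and "f \<preceq> pow_fun 2"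
    and "pow_fun 1 \<preceq> f \<or> f \<preceq> pow_fun 1"
  shows
    "(ln 3 < t \<longrightarrow>
        (pow_fun 1 \<preceq> f \<longrightarrow> hausdorff_measure f (W2_star t) = 0) \<and>
        (f \<prec> pow_fun 1 \<longrightarrow>
           ((\<Sum>\<^sub>\<infinity>n\<in>{1::nat..}. ennreal (f (exp (- (real n * t)) / 2 ^ n) * 6 ^ n)) < \<infinity> \<longrightarrow>
              hausdorff_measure f (W2_star t) = 0) \<and>
           ((\<Sum>\<^sub>\<infinity>n\<in>{1::nat..}. ennreal (f (exp (- (real n * t)) / 2 ^ n) * 6 ^ n)) = \<infinity> \<longrightarrow>
              hausdorff_measure f (W2_star t) = hausdorff_measure f ({0..1} \<times> {0..1})))) \<and>
     (t \<le> ln 3 \<longrightarrow>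
        (f \<prec> pow_fun 1 \<longrightarrow>
           hausdorff_measure f (W2_star t) = hausdorff_measure f ({0..1} \<times> {0..1}) \<and>
           hausdorff_measure f ({0..1} \<times> {0..1}) = \<infinity>) \<and>
        (pow_fun 1 \<preceq> f \<and> f \<preceq> pow_fun (1 + ln 2 / ln 3) \<longrightarrow>
           ((\<Sum>\<^sub>\<infinity>n\<in>{1::nat..}.
               ennreal (f (exp (- (real n ^ 2)) / 3 ^ n) * 9 ^ n * exp (real n ^ 2 - real n * t))) < \<infinity> \<longrightarrow>
              hausdorff_measure f (W2_star t) = 0) \<and>
           ((\<Sum>\<^sub>\<infinity>n\<in>{1::nat..}.
               ennreal (f (exp (- (real n ^ 2)) / 3 ^ n) * 9 ^ n * exp (real n ^ 2 - real n * t))) = \<infinity> \<longrightarrow>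
              hausdorff_measure f (W2_star t) = hausdorff_measure f ({0..1} \<times> {0..1}))))"
proof -
  have nonneg: "0 \<le> f (side1 t n) * 6 ^ n" "0 \<le> f (side2 n) * 9 ^ n * exp (real n ^ 2 - real n * t)" for n
    using dimension_function_pos[OF assms(2) side1_pos, of t n] dimension_function_pos[OF assms(2) side2_pos, of n]
    by (simp_all add: less_imp_le)
  note summable1 = infsum_ennreal_less_top_iff[of "\<lambda>n. f (side1 t n) * 6 ^ n", OF nonneg(1)]
  note summable2 = infsum_ennreal_less_top_iff[of "\<lambda>n. f (side2 n) * 9 ^ n * exp (real n ^ 2 - real n * t)", OF nonneg(2)]
  \<comment> \<open>By monotonicity each equality with the unit square reduces to the infinite
    measure of the limsup set.\<close>
  have square: "hausdorff_measure f (W2_star t) = hausdorff_measure f ({0..1} \<times> {0..1}) \<and>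
      hausdorff_measure f ({0..1} \<times> {0..1}) = \<infinity>" if "hausdorff_measure f (W2_star t) = \<infinity>"
    using hausdorff_measure_mono[OF W2_star_subset, of f t] that by (metis infinity_ennreal_def top.extremum_uniqueI)
  show ?thesis
    unfolding side1_def[symmetric] side2_def[symmetric]
  proof (intro conjI impI)
    assume "ln 3 < t" "pow_fun 1 \<preceq> f"
    then show "hausdorff_measure f (W2_star t) = 0"
      using assms by (intro hausdorff_measure_W2_star_eq_0_of_one_preceq)
  next
    assume "(\<Sum>\<^sub>\<infinity>n\<in>{1..}. ennreal (f (side1 t n) * 6 ^ n)) < \<infinity>"
    then show "hausdorff_measure f (W2_star t) = 0"
      using assms summable1 by (intro hausdorff_measure_W2_star_eq_0_side1) blast+
  next
    assume "f \<prec> pow_fun 1" "(\<Sum>\<^sub>\<infinity>n\<in>{1..}. ennreal (f (side1 t n) * 6 ^ n)) = \<infinity>"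
    then have "hausdorff_measure f (W2_star t) = \<infinity>"
      using assms summable1 by (intro hausdorff_measure_W2_star_eq_top_side1) auto
    then show "hausdorff_measure f (W2_star t) = hausdorff_measure f ({0..1} \<times> {0..1})" using square by blast
  next
    assume "t \<le> ln 3" "f \<prec> pow_fun 1"
    then have "hausdorff_measure f (W2_star t) = \<infinity>"
      using assms by (intro hausdorff_measure_W2_star_eq_top_of_prec_one)
    then show "hausdorff_measure f (W2_star t) = hausdorff_measure f ({0..1} \<times> {0..1})"
      "hausdorff_measure f ({0..1} \<times> {0..1}) = \<infinity>" using square by blast+
  next
    assume "(\<Sum>\<^sub>\<infinity>n\<in>{1..}. ennreal (f (side2 n) * 9 ^ n * exp (real n ^ 2 - real n * t))) < \<infinity>"
    then show "hausdorff_measure f (W2_star t) = 0"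
      using assms summable2 by (intro hausdorff_measure_W2_star_eq_0_side2) blast+
  next
    assume "t \<le> ln 3" "pow_fun 1 \<preceq> f \<and> f \<preceq> pow_fun (1 + ln 2 / ln 3)"
      "(\<Sum>\<^sub>\<infinity>n\<in>{1..}. ennreal (f (side2 n) * 9 ^ n * exp (real n ^ 2 - real n * t))) = \<infinity>"
    then have "hausdorff_measure f (W2_star t) = \<infinity>"
      using assms summable2 by (intro hausdorff_measure_W2_star_eq_top_side2) (auto simp: crit_def)
    then show "hausdorff_measure f (W2_star t) = hausdorff_measure f ({0..1} \<times> {0..1})" using square by blast
  qed
qed

end
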